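(* Let $\mathcal{G}$ be a locally compact Hausdorff étale groupoid, $c:\mathcal{G}\to\mathbb{R}$ an exact cocycle, $\mathcal{H}=\ker(c)$, and $\sigma$ a normalised $2$-cocycle on $\mathcal{G}$. If $c$ is $r$-unbounded, then the $*$-homomorphism $$ \varphi:C^*_r(\mathcal{G},\sigma)\to\mathcal{Q}(E_{C^*_r(\mathcal{H},\sigma)}),\qquad \varphi(a)=q(\Pi_c\,a\,\Pi_c), $$ is injective.
   Context: Twisted algebras. A $2$-cocycle on $\mathcal{G}$ is a continuous map $\sigma:\mathcal{G}^{(2)}\to\mathbb{T}$ (or $\{\pm1\}$ in the real case) with $\sigma(\gamma,\xi)\sigma(\gamma\xi,\eta)=\sigma(\gamma,\xi\eta)\sigma(\xi,\eta)$ and $\sigma(\gamma,s(\gamma))=1=\sigma(r(\gamma),\gamma)$; it is normalised if $\sigma(\gamma,\gamma^{-1})=1$. $C_c(\mathcal{G},\sigma)$ has the product $(f_1*f_2)(\gamma)=\sum_{\gamma=\xi\eta}f_1(\xi)f_2(\eta)\sigma(\xi,\eta)$ and involution $f^*(\gamma)=\overline{f(\gamma^{-1})}$. $C^*_r(\mathcal{G},\sigma)$ is its completion in the operator norm for left multiplication on the Hilbert $C_0(\mathcal{G}^{(0)})$-module completion of $C_c(\mathcal{G},\sigma)$ with inner product $(f_1^**f_2)|_{\mathcal{G}^{(0)}}$. A continuous $1$-cocycle (groupoid homomorphism) $c:\mathcal{G}\to\mathbb{R}$ is exact if $\ker(c)$ admits a Haar system and $r\times c:\mathcal{G}\to\mathcal{G}^{(0)}\times\mathbb{R}$,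 $\xi\mapsto(r(\xi),c(\xi))$, is a quotient map onto its image. It is $r$-unbounded if for all $x\in\mathcal{G}^{(0)}$ and all $M>0$ there exists $\eta\in r^{-1}(x)$ with $c(\eta)>M$. $E=E_{C^*_r(\mathcal{H},\sigma)}$ is the right Hilbert $C^*_r(\mathcal{H},\sigma)$-module completing $C_c(\mathcal{G},\sigma)$ in the inner product $(f_1\mid f_2)=(f_1^**f_2)|_{\mathcal{H}}$, with right action by twisted convolution with functions on $\mathcal{H}$; $C^*_r(\mathcal{G},\sigma)$ acts on it by left multiplication. $\mathcal{Q}(E)=\mathrm{End}^*(E)/\mathbb{K}(E)$ is the Calkin algebra and $q:\mathrm{End}^*(E)\to\mathcal{Q}(E)$ the quotient map. Fix $\varepsilon>0$ and a continuous non-decreasing function $\chi_+:\mathbb{R}\to\mathbb{R}$ with $\chi_+(x)=0$ for $x\le-\varepsilon$ and $\chi_+(x)=1$ for $x\ge0$. $\Pi_c\in\mathrm{End}^*(E)$ is the self-adjoint contraction extending $(\Pi_cf)(\eta)=\chi_+(c(\eta))f(\eta)$, $f\in C_c(\mathcal{G},\sigma)$.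
   Formalization: The formal statement proves that φ is a well-defined injective map into the Calkin algebra, but does not assert that φ is a *-homomorphism: under the stated hypotheses multiplicativity can fail (when the image of r×c is not closed). Injectivity is stated in full generality. *)

theory Defs
  imports "HOL-Analysis.Analysis"
begin

section \<open>Topological groupoids\<close>

text \<open>The set of arrows of a groupoid is the carrier of its topology, and the unit space is the
  subset of identity arrows.  Nothing is assumed about the values of \<open>rng\<close>, \<open>src\<close>, \<open>mul\<close> and
  \<open>ginv\<close> outside the arrows (respectively, the composable pairs).\<close>

record 'g groupoid =
  gtop :: "'g topology"
  rng :: "'g \<Rightarrow> 'g"
  src :: "'g \<Rightarrow> 'g"
  mul :: "'g \<Rightarrow> 'g \<Rightarrow> 'g"
  ginv :: "'g \<Rightarrow> 'g"

definition arrows :: "'g groupoid \<Rightarrow> 'g set" where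
  "arrows G = topspace (gtop G)"

definition units :: "'g groupoid \<Rightarrow> 'g set" where
  "units G = rng G ` arrows G"

definition composable :: "'g groupoid \<Rightarrow> ('g \<times> 'g) set" where
  "composable G = {(\<xi>, \<eta>). \<xi> \<in> arrows G \<and> \<eta> \<in> arrows G \<and> src G \<xi> = rng G \<eta>}"

definition composable_top :: "'g groupoid \<Rightarrow> ('g \<times> 'g) topology" where
  "composable_top G = subtopology (prod_topology (gtop G) (gtop G)) (composable G)"

definition unit_top :: "'g groupoid \<Rightarrow> 'g topology" where
  "unit_top G = subtopology (gtop G) (units G)"

locale topological_groupoid =
  fixes G :: "'g groupoid"
  assumes rng_closed: "\<And>\<gamma>. \<gamma> \<in> arrows G \<Longrightarrow> rng G \<gamma> \<in> arrows G"
    and src_closed: "\<And>\<gamma>. \<gamma> \<in> arrows G \<Longrightarrow> src G \<gamma> \<in> arrows G"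
    and rng_rng: "\<And>\<gamma>. \<gamma> \<in> arrows G \<Longrightarrow> rng G (rng G \<gamma>) = rng G \<gamma>"
    and src_rng: "\<And>\<gamma>. \<gamma> \<in> arrows G \<Longrightarrow> src G (rng G \<gamma>) = rng G \<gamma>"
    and rng_src: "\<And>\<gamma>. \<gamma> \<in> arrows G \<Longrightarrow> rng G (src G \<gamma>) = src G \<gamma>"
    and src_src: "\<And>\<gamma>. \<gamma> \<in> arrows G \<Longrightarrow> src G (src G \<gamma>) = src G \<gamma>"
    and mul_closed: "\<And>\<xi> \<eta>. (\<xi>, \<eta>) \<in> composable G \<Longrightarrow> mul G \<xi> \<eta> \<in> arrows G"
    and rng_mul: "\<And>\<xi> \<eta>. (\<xi>, \<eta>) \<in> composable G \<Longrightarrow> rng G (mul G \<xi> \<eta>) = rng G \<xi>"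
    and src_mul: "\<And>\<xi> \<eta>. (\<xi>, \<eta>) \<in> composable G \<Longrightarrow> src G (mul G \<xi> \<eta>) = src G \<eta>"
    and mul_assoc: "\<And>\<gamma> \<xi> \<eta>. (\<gamma>, \<xi>) \<in> composable G \<Longrightarrow> (\<xi>, \<eta>) \<in> composable G \<Longrightarrow>
      mul G (mul G \<gamma> \<xi>) \<eta> = mul G \<gamma> (mul G \<xi> \<eta>)"
    and rng_mul_self: "\<And>\<gamma>. \<gamma> \<in> arrows G \<Longrightarrow> mul G (rng G \<gamma>) \<gamma> = \<gamma>"
    and mul_src_self: "\<And>\<gamma>. \<gamma> \<in> arrows G \<Longrightarrow> mul G \<gamma> (src G \<gamma>) = \<gamma>"
    and ginv_closed: "\<And>\<gamma>. \<gamma> \<in> arrows G \<Longrightarrow> ginv G \<gamma> \<in> arrows G"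
    and rng_ginv: "\<And>\<gamma>. \<gamma> \<in> arrows G \<Longrightarrow> rng G (ginv G \<gamma>) = src G \<gamma>"
    and src_ginv: "\<And>\<gamma>. \<gamma> \<in> arrows G \<Longrightarrow> src G (ginv G \<gamma>) = rng G \<gamma>"
    and mul_ginv: "\<And>\<gamma>. \<gamma> \<in> arrows G \<Longrightarrow> mul G \<gamma> (ginv G \<gamma>) = rng G \<gamma>"
    and ginv_mul: "\<And>\<gamma>. \<gamma> \<in> arrows G \<Longrightarrow> mul G (ginv G \<gamma>) \<gamma> = src G \<gamma>"
    and continuous_mul: "continuous_map (composable_top G) (gtop G) (\<lambda>(\<xi>, \<eta>). mul G \<xi> \<eta>)"
    and continuous_ginv: "continuous_map (gtop G) (gtop G) (ginv G)"

text \<open>Etale means that the range map, as a map onto the unit space, is a local homeomorphism.\<close>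

locale lch_etale_groupoid = topological_groupoid +
  assumes Hausdorff: "Hausdorff_space (gtop G)"
    and locally_compact: "locally_compact_space (gtop G)"
    and etale: "\<And>\<gamma>. \<gamma> \<in> arrows G \<Longrightarrow> \<exists>U. openin (gtop G) U \<and> \<gamma> \<in> U \<and>
      openin (unit_top G) (rng G ` U) \<and>
      homeomorphic_map (subtopology (gtop G) U) (subtopology (unit_top G) (rng G ` U)) (rng G)"

definition restrict_groupoid :: "'g groupoid \<Rightarrow> 'g set \<Rightarrow> 'g groupoid" where
  "restrict_groupoid G S = G\<lparr>gtop := subtopology (gtop G) S\<rparr>"


section \<open>Compactly supported functions and Haar systems\<close>

text \<open>The real and the complex case are treated together: the scalars are a set \<open>F\<close> of complex
  numbers which is either all of them or the reals.  Functions on the arrows are extended by zero.\<close>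

definition scalar_field :: "complex set \<Rightarrow> bool" where
  "scalar_field F \<longleftrightarrow> F = UNIV \<or> F = \<real>"

definition Cc :: "'g groupoid \<Rightarrow> complex set \<Rightarrow> ('g \<Rightarrow> complex) set" where
  "Cc G F = {f. continuous_map (gtop G) euclidean f \<and> range f \<subseteq> F \<and>
     (\<exists>C. compactin (gtop G) C \<and> (\<forall>\<gamma>. \<gamma> \<notin> C \<longrightarrow> f \<gamma> = 0))}"

definition radon_measure :: "'a topology \<Rightarrow> 'a measure \<Rightarrow> bool" where
  "radon_measure X M \<longleftrightarrow>
     sets M = sets (sigma (topspace X) {U. openin X U}) \<and>
     (\<forall>C. compactin X C \<and> C \<in> sets M \<longrightarrow> emeasure M C < \<infinity>) \<and>
     (\<forall>A\<in>sets M. emeasure M A = (INF U\<in>{U. openin X U \<and> A \<subseteq> U}. emeasure M U)) \<and>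
     (\<forall>U. openin X U \<longrightarrow>
        emeasure M U = (SUP C\<in>{C. compactin X C \<and> C \<in> sets M \<and> C \<subseteq> U}. emeasure M C))"

definition measure_support :: "'a topology \<Rightarrow> 'a measure \<Rightarrow> 'a set" where
  "measure_support X M = {x \<in> topspace X. \<forall>U. openin X U \<and> x \<in> U \<longrightarrow> emeasure M U > 0}"

text \<open>In the invariance condition the integrand \<open>\<eta> \<mapsto> f (\<gamma> \<eta>)\<close> only makes sense on the support
  of the measure \<open>\<mu> (src G \<gamma>)\<close>, so it is extended by zero.\<close>

definition haar_system :: "'g groupoid \<Rightarrow> ('g \<Rightarrow> 'g measure) \<Rightarrow> bool" where
  "haar_system G \<mu> \<longleftrightarrow>
     (\<forall>x\<in>units G. radon_measure (gtop G) (\<mu> x) \<and>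
        measure_support (gtop G) (\<mu> x) = {\<eta> \<in> arrows G. rng G \<eta> = x}) \<and>
     (\<forall>f\<in>Cc G UNIV. continuous_map (unit_top G) euclidean (\<lambda>x. \<integral>\<eta>. f \<eta> \<partial>\<mu> x)) \<and>
     (\<forall>f\<in>Cc G UNIV. \<forall>\<gamma>\<in>arrows G.
        (\<integral>\<eta>. (if \<eta> \<in> arrows G \<and> rng G \<eta> = src G \<gamma> then f (mul G \<gamma> \<eta>) else 0) \<partial>\<mu> (src G \<gamma>)) =
        (\<integral>\<eta>. f \<eta> \<partial>\<mu> (rng G \<gamma>)))"


section \<open>Cocycles\<close>

definition continuous_cocycle :: "'g groupoid \<Rightarrow> ('g \<Rightarrow> real) \<Rightarrow> bool" where
  "continuous_cocycle G c \<longleftrightarrow> continuous_map (gtop G) euclideanreal c \<and>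
     (\<forall>(\<xi>, \<eta>)\<in>composable G. c (mul G \<xi> \<eta>) = c \<xi> + c \<eta>)"

definition kernel :: "'g groupoid \<Rightarrow> ('g \<Rightarrow> real) \<Rightarrow> 'g groupoid" where
  "kernel G c = restrict_groupoid G {\<gamma> \<in> arrows G. c \<gamma> = 0}"

definition exact_cocycle :: "'g groupoid \<Rightarrow> ('g \<Rightarrow> real) \<Rightarrow> bool" where
  "exact_cocycle G c \<longleftrightarrow> continuous_cocycle G c \<and>
     (\<exists>\<mu>. haar_system (kernel G c) \<mu>) \<and>
     quotient_map (gtop G)
       (subtopology (prod_topology (unit_top G) euclideanreal) ((\<lambda>\<xi>. (rng G \<xi>, c \<xi>)) ` arrows G))
       (\<lambda>\<xi>. (rng G \<xi>, c \<xi>))"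

definition r_unbounded :: "'g groupoid \<Rightarrow> ('g \<Rightarrow> real) \<Rightarrow> bool" where
  "r_unbounded G c \<longleftrightarrow> (\<forall>x\<in>units G. \<forall>M>0. \<exists>\<eta>\<in>arrows G. rng G \<eta> = x \<and> c \<eta> > M)"

text \<open>For real scalars, the values of modulus one in \<open>F\<close> are \<open>1\<close> and \<open>-1\<close>.\<close>

definition two_cocycle :: "'g groupoid \<Rightarrow> complex set \<Rightarrow> ('g \<Rightarrow> 'g \<Rightarrow> complex) \<Rightarrow> bool" where
  "two_cocycle G F \<sigma> \<longleftrightarrow>
     continuous_map (composable_top G) euclidean (\<lambda>(\<xi>, \<eta>). \<sigma> \<xi> \<eta>) \<and>
     (\<forall>(\<xi>, \<eta>)\<in>composable G. cmod (\<sigma> \<xi> \<eta>) = 1 \<and> \<sigma> \<xi> \<eta> \<in> F) \<and>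
     (\<forall>\<gamma> \<xi> \<eta>. (\<gamma>, \<xi>) \<in> composable G \<and> (\<xi>, \<eta>) \<in> composable G \<longrightarrow>
        \<sigma> \<gamma> \<xi> * \<sigma> (mul G \<gamma> \<xi>) \<eta> = \<sigma> \<gamma> (mul G \<xi> \<eta>) * \<sigma> \<xi> \<eta>) \<and>
     (\<forall>\<gamma>\<in>arrows G. \<sigma> \<gamma> (src G \<gamma>) = 1 \<and> \<sigma> (rng G \<gamma>) \<gamma> = 1)"

definition normalised_two_cocycle ::
    "'g groupoid \<Rightarrow> complex set \<Rightarrow> ('g \<Rightarrow> 'g \<Rightarrow> complex) \<Rightarrow> bool" where
  "normalised_two_cocycle G F \<sigma> \<longleftrightarrow>
     two_cocycle G F \<sigma> \<and> (\<forall>\<gamma>\<in>arrows G. \<sigma> \<gamma> (ginv G \<gamma>) = 1)"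


section \<open>Completions of spaces of functions\<close>

text \<open>The completion of a space \<open>V\<close> of functions in a (semi)norm \<open>N\<close> consists of the Cauchy
  sequences modulo the null sequences.  Maps are extended to completions term by term on
  representatives; the unions below are over equal classes whenever the map is uniformly continuous
  on bounded sets.\<close>

definition cauchy_seqs :: "('g \<Rightarrow> complex) set \<Rightarrow> (('g \<Rightarrow> complex) \<Rightarrow> real) \<Rightarrow>
    (nat \<Rightarrow> 'g \<Rightarrow> complex) set" where
  "cauchy_seqs V N = {u. (\<forall>n. u n \<in> V) \<and>
     (\<forall>e>0. \<exists>n0. \<forall>m\<ge>n0. \<forall>n\<ge>n0. N (\<lambda>\<gamma>. u m \<gamma> - u n \<gamma>) < e)}"

definition null_rel :: "('g \<Rightarrow> complex) set \<Rightarrow> (('g \<Rightarrow> complex) \<Rightarrow> real) \<Rightarrow>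
    ((nat \<Rightarrow> 'g \<Rightarrow> complex) \<times> (nat \<Rightarrow> 'g \<Rightarrow> complex)) set" where
  "null_rel V N = {(u, v). u \<in> cauchy_seqs V N \<and> v \<in> cauchy_seqs V N \<and>
     (\<lambda>n. N (\<lambda>\<gamma>. u n \<gamma> - v n \<gamma>)) \<longlonglongrightarrow> 0}"

type_synonym 'g completed = "(nat \<Rightarrow> 'g \<Rightarrow> complex) set"

definition completion ::
    "('g \<Rightarrow> complex) set \<Rightarrow> (('g \<Rightarrow> complex) \<Rightarrow> real) \<Rightarrow> 'g completed set" where
  "completion V N = cauchy_seqs V N // null_rel V N"

definition completion_norm :: "(('g \<Rightarrow> complex) \<Rightarrow> real) \<Rightarrow> 'g completed \<Rightarrow> real" where
  "completion_norm N X = (THE l. \<forall>u\<in>X. (\<lambda>n. N (u n)) \<longlonglongrightarrow> l)"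

definition extend1 :: "('g \<Rightarrow> complex) set \<Rightarrow> (('g \<Rightarrow> complex) \<Rightarrow> real) \<Rightarrow>
    (('g \<Rightarrow> complex) \<Rightarrow> ('g \<Rightarrow> complex)) \<Rightarrow> 'g completed \<Rightarrow> 'g completed" where
  "extend1 V N op X = (\<Union>u\<in>X. null_rel V N `` {\<lambda>n. op (u n)})"

definition extend2 :: "('g \<Rightarrow> complex) set \<Rightarrow> (('g \<Rightarrow> complex) \<Rightarrow> real) \<Rightarrow>
    (('g \<Rightarrow> complex) \<Rightarrow> ('g \<Rightarrow> complex) \<Rightarrow> ('g \<Rightarrow> complex)) \<Rightarrow>
    'g completed \<Rightarrow> 'g completed \<Rightarrow> 'g completed" where
  "extend2 V N op X Y = (\<Union>u\<in>X. \<Union>v\<in>Y. null_rel V N `` {\<lambda>n. op (u n) (v n)})"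


section \<open>The twisted reduced algebra\<close>

text \<open>For compactly supported functions on an etale groupoid only finitely many terms of the sum
  are nonzero.\<close>

definition conv :: "'g groupoid \<Rightarrow> ('g \<Rightarrow> 'g \<Rightarrow> complex) \<Rightarrow>
    ('g \<Rightarrow> complex) \<Rightarrow> ('g \<Rightarrow> complex) \<Rightarrow> 'g \<Rightarrow> complex" where
  "conv G \<sigma> f g \<gamma> =
     (\<Sum>\<^sub>\<infinity>(\<xi>, \<eta>)\<in>{(\<xi>, \<eta>) \<in> composable G. mul G \<xi> \<eta> = \<gamma>}. f \<xi> * g \<eta> * \<sigma> \<xi> \<eta>)"

definition invol :: "'g groupoid \<Rightarrow> ('g \<Rightarrow> complex) \<Rightarrow> 'g \<Rightarrow> complex" where
  "invol G f \<gamma> = (if \<gamma> \<in> arrows G then cnj (f (ginv G \<gamma>)) else 0)"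

text \<open>The norm of the Hilbert module over the functions on the unit space; the \<open>0\<close> only matters
  for the empty groupoid.\<close>

definition unit_module_norm ::
    "'g groupoid \<Rightarrow> ('g \<Rightarrow> 'g \<Rightarrow> complex) \<Rightarrow> ('g \<Rightarrow> complex) \<Rightarrow> real" where
  "unit_module_norm G \<sigma> f =
     sqrt (Sup (insert 0 ((\<lambda>x. cmod (conv G \<sigma> (invol G f) f x)) ` units G)))"

text \<open>The operator norm of left multiplication by \<open>f\<close> on the completion of \<open>Cc G F\<close> in
  \<open>unit_module_norm\<close>, computed on the unit ball of the dense subspace \<open>Cc G F\<close>.\<close>

definition reduced_norm :: "'g groupoid \<Rightarrow> complex set \<Rightarrow> ('g \<Rightarrow> 'g \<Rightarrow> complex) \<Rightarrow>
    ('g \<Rightarrow> complex) \<Rightarrow> real" where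
  "reduced_norm G F \<sigma> f =
     Sup {unit_module_norm G \<sigma> (conv G \<sigma> f g) | g. g \<in> Cc G F \<and> unit_module_norm G \<sigma> g \<le> 1}"

definition reduced_algebra ::
    "'g groupoid \<Rightarrow> complex set \<Rightarrow> ('g \<Rightarrow> 'g \<Rightarrow> complex) \<Rightarrow> 'g completed set" where
  "reduced_algebra G F \<sigma> = completion (Cc G F) (reduced_norm G F \<sigma>)"


section \<open>Hilbert modules, adjointable and compact operators, the Calkin algebra\<close>

record ('a, 'e) hilbert_module =
  hcarrier :: "'e set"
  hadd :: "'e \<Rightarrow> 'e \<Rightarrow> 'e"
  hminus :: "'e \<Rightarrow> 'e \<Rightarrow> 'e"
  hact :: "'e \<Rightarrow> 'a \<Rightarrow> 'e"
  hinner :: "'e \<Rightarrow> 'e \<Rightarrow> 'a"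
  hcoeff_norm :: "'a \<Rightarrow> real"

definition hnorm :: "('a, 'e) hilbert_module \<Rightarrow> 'e \<Rightarrow> real" where
  "hnorm E x = sqrt (hcoeff_norm E (hinner E x x))"

text \<open>Operators are functions on the carrier, extended by \<open>undefined\<close> outside of it.  As usual,
  linearity and boundedness of adjointable operators are consequences of the existence of an
  adjoint.\<close>

definition adjointable :: "('a, 'e) hilbert_module \<Rightarrow> ('e \<Rightarrow> 'e) set" where
  "adjointable E = {T \<in> hcarrier E \<rightarrow>\<^sub>E hcarrier E. \<exists>S\<in>hcarrier E \<rightarrow>\<^sub>E hcarrier E.
     \<forall>x\<in>hcarrier E. \<forall>y\<in>hcarrier E. hinner E (T x) y = hinner E x (S y)}"

definition op_norm :: "('a, 'e) hilbert_module \<Rightarrow> ('e \<Rightarrow> 'e) \<Rightarrow> real" where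
  "op_norm E T = Sup {hnorm E (T x) | x. x \<in> hcarrier E \<and> hnorm E x \<le> 1}"

definition op_minus :: "('a, 'e) hilbert_module \<Rightarrow> ('e \<Rightarrow> 'e) \<Rightarrow> ('e \<Rightarrow> 'e) \<Rightarrow> 'e \<Rightarrow> 'e" where
  "op_minus E S T = (\<lambda>x\<in>hcarrier E. hminus E (S x) (T x))"

definition rank_one :: "('a, 'e) hilbert_module \<Rightarrow> 'e \<Rightarrow> 'e \<Rightarrow> 'e \<Rightarrow> 'e" where
  "rank_one E x y = (\<lambda>z\<in>hcarrier E. hact E x (hinner E y z))"

text \<open>Sums of rank one operators already form a linear subspace, since scalars can be moved into
  the first vector.\<close>

inductive_set finite_rank :: "('a, 'e) hilbert_module \<Rightarrow> ('e \<Rightarrow> 'e) set"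
  for E :: "('a, 'e) hilbert_module" where
  rank_one: "x \<in> hcarrier E \<Longrightarrow> y \<in> hcarrier E \<Longrightarrow> rank_one E x y \<in> finite_rank E"
| add: "S \<in> finite_rank E \<Longrightarrow> T \<in> finite_rank E \<Longrightarrow>
    (\<lambda>z\<in>hcarrier E. hadd E (S z) (T z)) \<in> finite_rank E"

definition compact_ops :: "('a, 'e) hilbert_module \<Rightarrow> ('e \<Rightarrow> 'e) set" where
  "compact_ops E = {T \<in> adjointable E. \<forall>e>0. \<exists>S\<in>finite_rank E. op_norm E (op_minus E T S) < e}"

definition compact_rel :: "('a, 'e) hilbert_module \<Rightarrow> (('e \<Rightarrow> 'e) \<times> ('e \<Rightarrow> 'e)) set" where
  "compact_rel E = {(S, T). S \<in> adjointable E \<and> T \<in> adjointable E \<and>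
     op_minus E S T \<in> compact_ops E}"

definition calkin :: "('a, 'e) hilbert_module \<Rightarrow> ('e \<Rightarrow> 'e) set set" where
  "calkin E = adjointable E // compact_rel E"

definition calkin_quot :: "('a, 'e) hilbert_module \<Rightarrow> ('e \<Rightarrow> 'e) \<Rightarrow> ('e \<Rightarrow> 'e) set" where
  "calkin_quot E T = compact_rel E `` {T}"


section \<open>The Hilbert module of a cocycle\<close>

definition kernel_inner :: "'g groupoid \<Rightarrow> ('g \<Rightarrow> 'g \<Rightarrow> complex) \<Rightarrow> ('g \<Rightarrow> real) \<Rightarrow>
    ('g \<Rightarrow> complex) \<Rightarrow> ('g \<Rightarrow> complex) \<Rightarrow> 'g \<Rightarrow> complex" where
  "kernel_inner G \<sigma> c f g \<gamma> = (if \<gamma> \<in> arrows (kernel G c) then conv G \<sigma> (invol G f) g \<gamma> else 0)"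

definition kernel_module_norm :: "'g groupoid \<Rightarrow> complex set \<Rightarrow> ('g \<Rightarrow> 'g \<Rightarrow> complex) \<Rightarrow>
    ('g \<Rightarrow> real) \<Rightarrow> ('g \<Rightarrow> complex) \<Rightarrow> real" where
  "kernel_module_norm G F \<sigma> c f = sqrt (reduced_norm (kernel G c) F \<sigma> (kernel_inner G \<sigma> c f f))"

text \<open>The coefficients are \<open>reduced_algebra (kernel G c) F \<sigma>\<close>.  Functions on the kernel are zero
  outside of it, so that the right action is given by the convolution over \<open>G\<close>.\<close>

definition kernel_module :: "'g groupoid \<Rightarrow> complex set \<Rightarrow> ('g \<Rightarrow> 'g \<Rightarrow> complex) \<Rightarrow>
    ('g \<Rightarrow> real) \<Rightarrow> ('g completed, 'g completed) hilbert_module" where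
  "kernel_module G F \<sigma> c =
    (let V = Cc G F; N = kernel_module_norm G F \<sigma> c;
         W = Cc (kernel G c) F; M = reduced_norm (kernel G c) F \<sigma> in
     \<lparr>hcarrier = completion V N,
      hadd = extend2 V N (\<lambda>f g \<gamma>. f \<gamma> + g \<gamma>),
      hminus = extend2 V N (\<lambda>f g \<gamma>. f \<gamma> - g \<gamma>),
      hact = extend2 V N (conv G \<sigma>),
      hinner = extend2 W M (kernel_inner G \<sigma> c),
      hcoeff_norm = completion_norm M\<rparr>)"

definition left_mult :: "'g groupoid \<Rightarrow> complex set \<Rightarrow> ('g \<Rightarrow> 'g \<Rightarrow> complex) \<Rightarrow>
    ('g \<Rightarrow> real) \<Rightarrow> 'g completed \<Rightarrow> 'g completed \<Rightarrow> 'g completed" where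
  "left_mult G F \<sigma> c a = (\<lambda>x\<in>hcarrier (kernel_module G F \<sigma> c).
     extend2 (Cc G F) (kernel_module_norm G F \<sigma> c) (conv G \<sigma>) a x)"

definition cutoff_op :: "'g groupoid \<Rightarrow> complex set \<Rightarrow> ('g \<Rightarrow> 'g \<Rightarrow> complex) \<Rightarrow>
    ('g \<Rightarrow> real) \<Rightarrow> (real \<Rightarrow> real) \<Rightarrow> 'g completed \<Rightarrow> 'g completed" where
  "cutoff_op G F \<sigma> c chi = (\<lambda>x\<in>hcarrier (kernel_module G F \<sigma> c).
     extend1 (Cc G F) (kernel_module_norm G F \<sigma> c) (\<lambda>f \<eta>. complex_of_real (chi (c \<eta>)) * f \<eta>) x)"

definition calkin_map :: "'g groupoid \<Rightarrow> complex set \<Rightarrow> ('g \<Rightarrow> 'g \<Rightarrow> complex) \<Rightarrow>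
    ('g \<Rightarrow> real) \<Rightarrow> (real \<Rightarrow> real) \<Rightarrow> 'g completed \<Rightarrow> ('g completed \<Rightarrow> 'g completed) set" where
  "calkin_map G F \<sigma> c chi a =
    (let E = kernel_module G F \<sigma> c; P = cutoff_op G F \<sigma> c chi in
     calkin_quot E (compose (hcarrier E) P (compose (hcarrier E) (left_mult G F \<sigma> c a) P)))"

end

theory Submission
  imports Defs
begin

text \<open>
  Both norms are computed on fibres: for \<open>f\<close> in \<open>Cc G F\<close>, the reduced norm is the supremum over the
  units \<open>x\<close> of the operator norms of convolution by \<open>f\<close> on the square summable functions on the source
  fibre over \<open>x\<close>, and the norm of the Hilbert module is the same supremum with the arguments restricted
  to functions supported on the kernel of the cocycle.  The Haar system forces the range map of the kernel
  to be open, hence the kernel to be open in \<open>G\<close> and etale.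

  A finite rank operator built from compactly supported functions vanishes on every function which
  is supported where \<open>c\<close> is large, so compact operators are small there.  On the other hand, a nonzero
  element of the reduced algebra is detected by a finitely supported vector on one fibre.  Right
  translation by an arrow \<open>\<eta>\<close> with \<open>c \<eta>\<close> large commutes with convolution from the left and
  preserves all norms, but moves the vector to where the cutoff is the identity and compact
  operators are small.
\<close>


section \<open>Completions\<close>

text \<open>The module norm is a supremum over all vectors supported on the kernel in any fibre, not
  only over point masses at units. A compactly supported extension of a fibre vector may therefore
  have a module norm far above the l2 norm of that vector, and its size might depend on how far the
  vector was translated. The l1 norm is a safe bound: a bump on a bisection acts on every fibre as a
  weighted partial permutation, and translation by an arrow leaves the l1 norm unchanged. The
  detecting vector is thus scaled to l1 norm at most 1 before the arrow is chosen, and all errors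
  are measured against its fixed l2 norm. An element of the completion has no support on which
  \<open>c\<close> is bounded; it is replaced by a late member \<open>f\<close> of its sequence, at
  the cost of an eighth of the limit norm l, and for \<open>f\<close> both cutoffs disappear far
  out. The vector detects more than l/2, of which 3/8 remain, while compactness allows only 1/8 (all
  times the l2 norm of the vector). Injectivity is proved for pairs of elements, through the
  difference of their representing sequences, rather than through a trivial kernel.\<close>

lemma UN_prod: "(\<Union>a\<in>A. \<Union>b\<in>B. f a b) = (\<Union>p\<in>A \<times> B. f (fst p) (snd p))"
  by force

definition seq_class :: "('g \<Rightarrow> complex) set \<Rightarrow> (('g \<Rightarrow> complex) \<Rightarrow> real) \<Rightarrow>
    (nat \<Rightarrow> 'g \<Rightarrow> complex) \<Rightarrow> 'g completed" where
  "seq_class V N u = null_rel V N `` {u}"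

text \<open>The axioms describe an additive group with a subadditive size function; symmetry and
  both triangle inequalities follow from the single inequality for differences. Definiteness is left
  to \<open>null_rel\<close>, which divides out the null sequences.\<close>

locale function_seminorm =
  fixes V :: "('g \<Rightarrow> complex) set" and N :: "('g \<Rightarrow> complex) \<Rightarrow> real"
  assumes zero_mem: "(\<lambda>_. 0) \<in> V"
    and diff_mem: "f \<in> V \<Longrightarrow> g \<in> V \<Longrightarrow> (\<lambda>\<gamma>. f \<gamma> - g \<gamma>) \<in> V"
    and nonneg: "f \<in> V \<Longrightarrow> 0 \<le> N f"
    and zero: "N (\<lambda>_. 0) = 0"
    and diff_le: "f \<in> V \<Longrightarrow> g \<in> V \<Longrightarrow> N (\<lambda>\<gamma>. f \<gamma> - g \<gamma>) \<le> N f + N g"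
begin

lemma uminus_mem:
  assumes "f \<in> V"
  shows "(\<lambda>\<gamma>. - f \<gamma>) \<in> V"
  using diff_mem[OF zero_mem assms] by simp

lemma uminus_le:
  assumes "f \<in> V"
  shows "N (\<lambda>\<gamma>. - f \<gamma>) \<le> N f"
  using diff_le[OF zero_mem assms] by (simp add: zero)

lemma add_mem:
  assumes "f \<in> V" "g \<in> V"
  shows "(\<lambda>\<gamma>. f \<gamma> + g \<gamma>) \<in> V"
  using diff_mem[OF assms(1) uminus_mem[OF assms(2)]] by simp

lemma add_le:
  assumes "f \<in> V" "g \<in> V"
  shows "N (\<lambda>\<gamma>. f \<gamma> + g \<gamma>) \<le> N f + N g"
  using diff_le[OF assms(1) uminus_mem[OF assms(2)]] uminus_le[OF assms(2)] by simp

lemma commute: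
  assumes "f \<in> V" "g \<in> V"
  shows "N (\<lambda>\<gamma>. f \<gamma> - g \<gamma>) = N (\<lambda>\<gamma>. g \<gamma> - f \<gamma>)"
  using uminus_le[OF diff_mem[OF assms]] uminus_le[OF diff_mem[OF assms(2,1)]] by simp

lemma triangle:
  assumes "f \<in> V" "g \<in> V" "h \<in> V"
  shows "N (\<lambda>\<gamma>. f \<gamma> - h \<gamma>) \<le> N (\<lambda>\<gamma>. f \<gamma> - g \<gamma>) + N (\<lambda>\<gamma>. g \<gamma> - h \<gamma>)"
  using add_le[OF diff_mem[OF assms(1,2)] diff_mem[OF assms(2,3)]] by simp

lemma reverse_triangle:
  assumes "f \<in> V" "g \<in> V"
  shows "\<bar>N f - N g\<bar> \<le> N (\<lambda>\<gamma>. f \<gamma> - g \<gamma>)"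
  using add_le[OF diff_mem[OF assms] assms(2)] add_le[OF diff_mem[OF assms(2,1)] assms(1)]
    commute[OF assms] by simp

lemma cauchy_seqsD: "u \<in> cauchy_seqs V N \<Longrightarrow> u n \<in> V"
  by (simp add: cauchy_seqs_def)

lemma const_cauchy:
  assumes "f \<in> V"
  shows "(\<lambda>_. f) \<in> cauchy_seqs V N"
  using assms by (simp add: cauchy_seqs_def zero)

lemma equiv_null_rel: "equiv (cauchy_seqs V N) (null_rel V N)"
proof (rule equivI)
  show "null_rel V N \<subseteq> cauchy_seqs V N \<times> cauchy_seqs V N"
    by (auto simp: null_rel_def)
  show "refl_on (cauchy_seqs V N) (null_rel V N)"
    by (auto simp: refl_on_def null_rel_def zero)
  show "sym (null_rel V N)"
  proof (rule symI)
    fix u v assume uv: "(u, v) \<in> null_rel V N"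
    then have "N (\<lambda>\<gamma>. v n \<gamma> - u n \<gamma>) = N (\<lambda>\<gamma>. u n \<gamma> - v n \<gamma>)" for n
      by (intro commute) (auto simp: null_rel_def cauchy_seqsD)
    with uv show "(v, u) \<in> null_rel V N" by (simp add: null_rel_def)
  qed
  show "trans (null_rel V N)"
  proof (rule transI)
    fix u v w assume uv: "(u, v) \<in> null_rel V N" and vw: "(v, w) \<in> null_rel V N"
    then have mem: "u n \<in> V" "v n \<in> V" "w n \<in> V" for n
      by (auto simp: null_rel_def cauchy_seqsD)
    have lim: "(\<lambda>n. N (\<lambda>\<gamma>. u n \<gamma> - v n \<gamma>) + N (\<lambda>\<gamma>. v n \<gamma> - w n \<gamma>)) \<longlonglongrightarrow> 0"
      using tendsto_add[of _ 0 _ _ 0] uv vw by (fastforce simp: null_rel_def)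
    have "(\<lambda>n. N (\<lambda>\<gamma>. u n \<gamma> - w n \<gamma>)) \<longlonglongrightarrow> 0"
      by (rule tendsto_sandwich[OF _ _ tendsto_const lim])
        (simp_all add: nonneg mem triangle diff_mem)
    with uv vw show "(u, w) \<in> null_rel V N" by (auto simp: null_rel_def)
  qed
qed

lemma seq_class_eq_iff:
  assumes "u \<in> cauchy_seqs V N" "v \<in> cauchy_seqs V N"
  shows "seq_class V N u = seq_class V N v \<longleftrightarrow> (\<lambda>n. N (\<lambda>\<gamma>. u n \<gamma> - v n \<gamma>)) \<longlonglongrightarrow> 0"
  using eq_equiv_class_iff[OF equiv_null_rel assms] assms
  by (simp add: seq_class_def null_rel_def)

lemma mem_seq_class:
  assumes "v \<in> seq_class V N u"
  shows "v \<in> cauchy_seqs V N" "(\<lambda>n. N (\<lambda>\<gamma>. u n \<gamma> - v n \<gamma>)) \<longlonglongrightarrow> 0"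
  using assms by (auto simp: seq_class_def null_rel_def)

lemma self_mem_seq_class: "u \<in> cauchy_seqs V N \<Longrightarrow> u \<in> seq_class V N u"
  using equiv_class_self[OF equiv_null_rel] by (simp add: seq_class_def)

lemma seq_class_mem: "u \<in> cauchy_seqs V N \<Longrightarrow> seq_class V N u \<in> completion V N"
  by (simp add: seq_class_def completion_def quotientI)

lemma completion_cases:
  assumes "X \<in> completion V N"
  obtains u where "u \<in> cauchy_seqs V N" "X = seq_class V N u"
  using assms unfolding completion_def seq_class_def by (elim quotientE)

lemma cauchy_seqsD2:
  assumes "u \<in> cauchy_seqs V N" "e > 0"
  obtains n0 where "\<And>m n. m \<ge> n0 \<Longrightarrow> n \<ge> n0 \<Longrightarrow> N (\<lambda>\<gamma>. u m \<gamma> - u n \<gamma>) < e"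
proof -
  have "\<exists>n0. \<forall>m\<ge>n0. \<forall>n\<ge>n0. N (\<lambda>\<gamma>. u m \<gamma> - u n \<gamma>) < e"
    using assms by (simp add: cauchy_seqs_def)
  with that show thesis by blast
qed

lemma cauchy_seqsI:
  assumes "\<And>n. u n \<in> V"
    and "\<And>e. e > 0 \<Longrightarrow> \<exists>n0. \<forall>m\<ge>n0. \<forall>n\<ge>n0. N (\<lambda>\<gamma>. u m \<gamma> - u n \<gamma>) < e"
  shows "u \<in> cauchy_seqs V N"
  using assms by (simp add: cauchy_seqs_def)

lemma cauchy_norm:
  assumes u: "u \<in> cauchy_seqs V N"
  shows "Cauchy (\<lambda>n. N (u n))"
proof (rule metric_CauchyI)
  fix e :: real assume "e > 0"
  with u obtain n0 where n0: "\<And>m n. m \<ge> n0 \<Longrightarrow> n \<ge> n0 \<Longrightarrow> N (\<lambda>\<gamma>. u m \<gamma> - u n \<gamma>) < e"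
    using cauchy_seqsD2 by blast
  have "dist (N (u m)) (N (u n)) < e" if "m \<ge> n0" "n \<ge> n0" for m n
    using n0[OF that] reverse_triangle[OF cauchy_seqsD[OF u, of m] cauchy_seqsD[OF u, of n]]
    by (simp add: dist_real_def)
  then show "\<exists>M. \<forall>m\<ge>M. \<forall>n\<ge>M. dist (N (u m)) (N (u n)) < e" by blast
qed

lemma cauchy_bounded:
  assumes "u \<in> cauchy_seqs V N"
  obtains B where "B > 0" "\<And>n. N (u n) \<le> B"
  using Cauchy_Bseq[OF cauchy_norm[OF assms]] by (auto simp: Bseq_def abs_le_iff)

text \<open>The description by \<open>THE\<close> is proper because the reverse triangle inequality
  gives all representatives of a class the same limit.\<close>

lemma completion_norm_seq_class:
  assumes "u \<in> cauchy_seqs V N" "(\<lambda>n. N (u n)) \<longlonglongrightarrow> l"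
  shows "completion_norm N (seq_class V N u) = l"
proof -
  have lim: "(\<lambda>n. N (v n)) \<longlonglongrightarrow> l" if "v \<in> seq_class V N u" for v
  proof -
    note v = mem_seq_class[OF that]
    have "(\<lambda>n. N (v n) - N (u n)) \<longlonglongrightarrow> 0"
      using reverse_triangle[OF cauchy_seqsD[OF assms(1)] cauchy_seqsD[OF v(1)]]
      by (intro Lim_null_comparison[OF _ v(2)]) (simp add: abs_minus_commute)
    from tendsto_add[OF this assms(2)] show ?thesis by simp
  qed
  show ?thesis unfolding completion_norm_def
  proof (rule the_equality)
    fix l' assume "\<forall>v\<in>seq_class V N u. (\<lambda>n. N (v n)) \<longlonglongrightarrow> l'"
    then have "(\<lambda>n. N (u n)) \<longlonglongrightarrow> l'" using self_mem_seq_class[OF assms(1)] by blast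
    with assms(2) show "l' = l" using LIMSEQ_unique by blast
  qed (use lim in blast)
qed

text \<open>The unions in \<open>extend1\<close> and \<open>extend2\<close> run over all
  representatives. Once the resulting sequences are all equivalent, every member of the union is the
  same class; \<open>A\<close> must be nonempty, or the union would be empty instead of a
  class.\<close>

lemma seq_class_subset_eq:
  assumes "A \<noteq> {}" "u \<in> cauchy_seqs V N" "\<And>a. a \<in> A \<Longrightarrow> f a \<in> cauchy_seqs V N"
    "\<And>a. a \<in> A \<Longrightarrow> (\<lambda>n. N (\<lambda>\<gamma>. f a n \<gamma> - u n \<gamma>)) \<longlonglongrightarrow> 0"
  shows "(\<Union>a\<in>A. null_rel V N `` {f a}) = seq_class V N u"
proof -
  have "null_rel V N `` {f a} = seq_class V N u" if "a \<in> A" for a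
    using seq_class_eq_iff[OF assms(3)[OF that] assms(2)] assms(4)[OF that]
    by (simp add: seq_class_def)
  with assms(1) show ?thesis by auto
qed

lemma extend1_seq_class:
  assumes op: "\<And>f. f \<in> V \<Longrightarrow> op f \<in> V"
    and le: "\<And>f g. f \<in> V \<Longrightarrow> g \<in> V \<Longrightarrow> N (\<lambda>\<gamma>. op f \<gamma> - op g \<gamma>) \<le> N (\<lambda>\<gamma>. f \<gamma> - g \<gamma>)"
    and u: "u \<in> cauchy_seqs V N"
  shows "(\<lambda>n. op (u n)) \<in> cauchy_seqs V N"
    and "extend1 V N op (seq_class V N u) = seq_class V N (\<lambda>n. op (u n))"
proof -
  have cau: "(\<lambda>n. op (v n)) \<in> cauchy_seqs V N" if "v \<in> cauchy_seqs V N" for v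
  proof (rule cauchy_seqsI)
    fix e :: real assume "e > 0"
    with that obtain n0 where n0: "\<And>m n. m \<ge> n0 \<Longrightarrow> n \<ge> n0 \<Longrightarrow> N (\<lambda>\<gamma>. v m \<gamma> - v n \<gamma>) < e"
      using cauchy_seqsD2 by blast
    have "N (\<lambda>\<gamma>. op (v m) \<gamma> - op (v n) \<gamma>) < e" if "m \<ge> n0" "n \<ge> n0" for m n
      using n0[OF that] le[OF cauchy_seqsD[OF \<open>v \<in> _\<close>, of m] cauchy_seqsD[OF \<open>v \<in> _\<close>, of n]]
      by simp
    then show "\<exists>n0. \<forall>m\<ge>n0. \<forall>n\<ge>n0. N (\<lambda>\<gamma>. op (v m) \<gamma> - op (v n) \<gamma>) < e" by blast
  qed (simp add: op cauchy_seqsD[OF that])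
  then show "(\<lambda>n. op (u n)) \<in> cauchy_seqs V N" using u .
  show "extend1 V N op (seq_class V N u) = seq_class V N (\<lambda>n. op (u n))"
    unfolding extend1_def
  proof (rule seq_class_subset_eq)
    fix v assume v: "v \<in> seq_class V N u"
    note v' = mem_seq_class[OF v]
    show "(\<lambda>n. N (\<lambda>\<gamma>. op (v n) \<gamma> - op (u n) \<gamma>)) \<longlonglongrightarrow> 0"
    proof (rule tendsto_sandwich[OF _ _ tendsto_const v'(2)])
      show "\<forall>\<^sub>F n in sequentially. N (\<lambda>\<gamma>. op (v n) \<gamma> - op (u n) \<gamma>) \<le> N (\<lambda>\<gamma>. u n \<gamma> - v n \<gamma>)"
        using le[OF cauchy_seqsD[OF v'(1)] cauchy_seqsD[OF u]]
          commute[OF cauchy_seqsD[OF v'(1)] cauchy_seqsD[OF u]] by simp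
    qed (simp add: nonneg diff_mem op cauchy_seqsD[OF u] cauchy_seqsD[OF v'(1)])
  qed (use self_mem_seq_class[OF u] cau u mem_seq_class(1) in auto)
qed

end

text \<open>One estimate serves bilinear maps as well as sums and differences: for a bilinear map
  the factors \<open>N2 g\<close> and \<open>N1 f'\<close> would do, while addition needs the
  constant 1. Both factors stay bounded along Cauchy sequences, which gives Cauchy images and
  independence of the representatives.\<close>

locale bounded_op2 = V1: function_seminorm V1 N1 + V2: function_seminorm V2 N2 +
    V: function_seminorm V N
  for V1 V2 V :: "('g \<Rightarrow> complex) set" and N1 N2 N :: "('g \<Rightarrow> complex) \<Rightarrow> real" +
  fixes op :: "('g \<Rightarrow> complex) \<Rightarrow> ('g \<Rightarrow> complex) \<Rightarrow> 'g \<Rightarrow> complex"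
  assumes mem: "f \<in> V1 \<Longrightarrow> g \<in> V2 \<Longrightarrow> op f g \<in> V"
    and le: "f \<in> V1 \<Longrightarrow> f' \<in> V1 \<Longrightarrow> g \<in> V2 \<Longrightarrow> g' \<in> V2 \<Longrightarrow>
      N (\<lambda>\<gamma>. op f g \<gamma> - op f' g' \<gamma>) \<le>
      N1 (\<lambda>\<gamma>. f \<gamma> - f' \<gamma>) * (1 + N2 g) + (1 + N1 f') * N2 (\<lambda>\<gamma>. g \<gamma> - g' \<gamma>)"
begin

lemma op_cauchy:
  assumes u: "u \<in> cauchy_seqs V1 N1" and v: "v \<in> cauchy_seqs V2 N2"
  shows "(\<lambda>n. op (u n) (v n)) \<in> cauchy_seqs V N"
proof -
  obtain A where A: "A > 0" "\<And>n. N1 (u n) \<le> A" using V1.cauchy_bounded[OF u] by blast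
  obtain B where B: "B > 0" "\<And>n. N2 (v n) \<le> B" using V2.cauchy_bounded[OF v] by blast
  have "\<exists>n0. \<forall>m\<ge>n0. \<forall>n\<ge>n0. N (\<lambda>\<gamma>. op (u m) (v m) \<gamma> - op (u n) (v n) \<gamma>) < e" if "e > 0" for e
  proof -
    define d where "d = e / (2 * (1 + B))"
    define d' where "d' = e / (2 * (1 + A))"
    have d: "d > 0" "d' > 0" using A B that by (auto simp: d_def d'_def)
    have e: "d * (1 + B) + (1 + A) * d' = e"
    proof -
      have "d * (1 + B) = e / 2" "(1 + A) * d' = e / 2"
        using A(1) B(1) by (simp_all add: d_def d'_def divide_simps)
      then show ?thesis by simp
    qed
    obtain n1 where n1: "\<forall>m\<ge>n1. \<forall>n\<ge>n1. N1 (\<lambda>\<gamma>. u m \<gamma> - u n \<gamma>) < d"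
      using u d by (auto simp: cauchy_seqs_def)
    obtain n2 where n2: "\<forall>m\<ge>n2. \<forall>n\<ge>n2. N2 (\<lambda>\<gamma>. v m \<gamma> - v n \<gamma>) < d'"
      using v d by (auto simp: cauchy_seqs_def)
    have "N (\<lambda>\<gamma>. op (u m) (v m) \<gamma> - op (u n) (v n) \<gamma>) < e"
      if "m \<ge> max n1 n2" "n \<ge> max n1 n2" for m n
    proof -
      have *: "0 \<le> N1 (\<lambda>\<gamma>. u m \<gamma> - u n \<gamma>)" "0 \<le> N2 (\<lambda>\<gamma>. v m \<gamma> - v n \<gamma>)"
        by (simp_all add: V1.nonneg V2.nonneg V1.diff_mem V2.diff_mem V1.cauchy_seqsD[OF u] V2.cauchy_seqsD[OF v])
      have "N (\<lambda>\<gamma>. op (u m) (v m) \<gamma> - op (u n) (v n) \<gamma>) \<le>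
          N1 (\<lambda>\<gamma>. u m \<gamma> - u n \<gamma>) * (1 + N2 (v m)) + (1 + N1 (u n)) * N2 (\<lambda>\<gamma>. v m \<gamma> - v n \<gamma>)"
        by (rule le; simp add: V1.cauchy_seqsD[OF u] V2.cauchy_seqsD[OF v])
      also have "\<dots> \<le> N1 (\<lambda>\<gamma>. u m \<gamma> - u n \<gamma>) * (1 + B) + (1 + A) * N2 (\<lambda>\<gamma>. v m \<gamma> - v n \<gamma>)"
        using * A B by (intro add_mono mult_left_mono mult_right_mono) auto
      also have "\<dots> < d * (1 + B) + (1 + A) * d'"
        using n1 n2 that A(1) B(1)
        by (intro add_strict_mono mult_strict_right_mono mult_strict_left_mono) auto
      finally show ?thesis using e by simp
    qed
    then show ?thesis by blast
  qed
  then show ?thesis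
    using mem V1.cauchy_seqsD[OF u] V2.cauchy_seqsD[OF v] by (simp add: cauchy_seqs_def)
qed

lemma extend2_seq_class:
  assumes u: "u \<in> cauchy_seqs V1 N1" and v: "v \<in> cauchy_seqs V2 N2"
  shows "extend2 V N op (seq_class V1 N1 u) (seq_class V2 N2 v) =
    seq_class V N (\<lambda>n. op (u n) (v n))"
proof -
  have "(\<Union>p\<in>seq_class V1 N1 u \<times> seq_class V2 N2 v. null_rel V N `` {(\<lambda>n. op (fst p n) (snd p n))}) =
    seq_class V N (\<lambda>n. op (u n) (v n))"
  proof (rule V.seq_class_subset_eq)
    fix p assume "p \<in> seq_class V1 N1 u \<times> seq_class V2 N2 v"
    then obtain u' v' where p: "p = (u', v')" and "u' \<in> seq_class V1 N1 u" "v' \<in> seq_class V2 N2 v"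
      by auto
    note u' = V1.mem_seq_class[OF this(2)] and v' = V2.mem_seq_class[OF this(3)]
    show "(\<lambda>n. op (fst p n) (snd p n)) \<in> cauchy_seqs V N" using op_cauchy[OF u'(1) v'(1)] p by simp
    obtain A where A: "A > 0" "\<And>n. N1 (u' n) \<le> A" using V1.cauchy_bounded[OF u'(1)] by blast
    obtain B where B: "B > 0" "\<And>n. N2 (v n) \<le> B" using V2.cauchy_bounded[OF v] by blast
    note mems = V1.cauchy_seqsD[OF u] V1.cauchy_seqsD[OF u'(1)] V2.cauchy_seqsD[OF v] V2.cauchy_seqsD[OF v'(1)]
    have lim: "(\<lambda>n. N1 (\<lambda>\<gamma>. u n \<gamma> - u' n \<gamma>) * (1 + B) + (1 + A) * N2 (\<lambda>\<gamma>. v n \<gamma> - v' n \<gamma>)) \<longlonglongrightarrow> 0"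
      by (rule tendsto_eq_intros u'(2) v'(2) refl | simp)+
    have "N (\<lambda>\<gamma>. op (u' n) (v' n) \<gamma> - op (u n) (v n) \<gamma>) \<le>
      N1 (\<lambda>\<gamma>. u n \<gamma> - u' n \<gamma>) * (1 + B) + (1 + A) * N2 (\<lambda>\<gamma>. v n \<gamma> - v' n \<gamma>)" for n
    proof -
      have "N (\<lambda>\<gamma>. op (u' n) (v' n) \<gamma> - op (u n) (v n) \<gamma>) = N (\<lambda>\<gamma>. op (u n) (v n) \<gamma> - op (u' n) (v' n) \<gamma>)"
        by (rule V.commute; simp add: mem mems)
      also have "\<dots> \<le> N1 (\<lambda>\<gamma>. u n \<gamma> - u' n \<gamma>) * (1 + N2 (v n)) + (1 + N1 (u' n)) * N2 (\<lambda>\<gamma>. v n \<gamma> - v' n \<gamma>)"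
        by (rule le; simp add: mems)
      also have "\<dots> \<le> N1 (\<lambda>\<gamma>. u n \<gamma> - u' n \<gamma>) * (1 + B) + (1 + A) * N2 (\<lambda>\<gamma>. v n \<gamma> - v' n \<gamma>)"
        using A B by (intro add_mono mult_left_mono mult_right_mono)
          (auto simp: mems V1.nonneg V2.nonneg V1.diff_mem V2.diff_mem)
      finally show ?thesis .
    qed
    then show "(\<lambda>n. N (\<lambda>\<gamma>. op (fst p n) (snd p n) \<gamma> - op (u n) (v n) \<gamma>)) \<longlonglongrightarrow> 0"
      by (intro tendsto_sandwich[OF _ _ tendsto_const lim])
        (simp_all add: p V.nonneg V.diff_mem mem mems)
  qed (use V1.self_mem_seq_class[OF u] V2.self_mem_seq_class[OF v] op_cauchy[OF u v] in auto)
  moreover have "extend2 V N op (seq_class V1 N1 u) (seq_class V2 N2 v) =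
    (\<Union>p\<in>seq_class V1 N1 u \<times> seq_class V2 N2 v. null_rel V N `` {(\<lambda>n. op (fst p n) (snd p n))})"
    unfolding extend2_def by (rule UN_prod)
  ultimately show ?thesis by simp
qed

end


section \<open>Finitely supported functions\<close>

definition nonzeros :: "('g \<Rightarrow> complex) \<Rightarrow> 'g set" where
  "nonzeros v = {\<gamma>. v \<gamma> \<noteq> 0}"

text \<open>Meant for finitely supported functions, which are dense among the square summable ones,
  so that no Hilbert space has to be built. A sum over an infinite set is 0 by convention, whence
  the finiteness assumptions in the estimates.\<close>

definition l2norm :: "('g \<Rightarrow> complex) \<Rightarrow> real" where
  "l2norm v = L2_set (\<lambda>\<gamma>. cmod (v \<gamma>)) (nonzeros v)"

definition ip :: "('g \<Rightarrow> complex) \<Rightarrow> ('g \<Rightarrow> complex) \<Rightarrow> complex" where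
  "ip v w = (\<Sum>\<gamma>\<in>nonzeros v \<inter> nonzeros w. cnj (v \<gamma>) * w \<gamma>)"

lemma l2norm_eq:
  assumes "finite B" "nonzeros v \<subseteq> B"
  shows "l2norm v = L2_set (\<lambda>\<gamma>. cmod (v \<gamma>)) B"
  unfolding l2norm_def L2_set_def
  by (rule arg_cong[where f = sqrt], rule sum.mono_neutral_left)
    (use assms in \<open>auto simp: nonzeros_def\<close>)

lemma l2norm_nonneg [simp]: "0 \<le> l2norm v"
  by (simp add: l2norm_def)

lemma l2norm_zero [simp]: "l2norm (\<lambda>_. 0) = 0"
  by (simp add: l2norm_def nonzeros_def)

lemma l2norm_power2:
  assumes "finite B" "nonzeros v \<subseteq> B"
  shows "(l2norm v)\<^sup>2 = (\<Sum>\<gamma>\<in>B. (cmod (v \<gamma>))\<^sup>2)"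
  by (simp add: l2norm_eq[OF assms] L2_set_def sum_nonneg)

lemma l2norm_scale: "l2norm (\<lambda>\<gamma>. a * v \<gamma>) = cmod a * l2norm v"
proof (cases "a = 0")
  case False
  then have "nonzeros (\<lambda>\<gamma>. a * v \<gamma>) = nonzeros v" by (auto simp: nonzeros_def)
  then show ?thesis by (simp add: l2norm_def norm_mult L2_set_right_distrib)
qed simp

lemma l2norm_eq_0D:
  assumes "finite (nonzeros v)" "l2norm v = 0"
  shows "v = (\<lambda>_. 0)"
  using assms by (auto simp: l2norm_def L2_set_eq_0_iff nonzeros_def)

lemma l2norm_add:
  assumes "finite (nonzeros v)" "finite (nonzeros w)"
  shows "l2norm (\<lambda>\<gamma>. v \<gamma> + w \<gamma>) \<le> l2norm v + l2norm w"
proof -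
  let ?B = "nonzeros v \<union> nonzeros w"
  have fin: "finite ?B" using assms by simp
  have "l2norm (\<lambda>\<gamma>. v \<gamma> + w \<gamma>) = L2_set (\<lambda>\<gamma>. cmod (v \<gamma> + w \<gamma>)) ?B"
    by (rule l2norm_eq[OF fin]) (auto simp: nonzeros_def)
  also have "\<dots> \<le> L2_set (\<lambda>\<gamma>. cmod (v \<gamma>) + cmod (w \<gamma>)) ?B"
    by (rule L2_set_mono) (auto intro: norm_triangle_ineq)
  also have "\<dots> \<le> L2_set (\<lambda>\<gamma>. cmod (v \<gamma>)) ?B + L2_set (\<lambda>\<gamma>. cmod (w \<gamma>)) ?B"
    by (rule L2_set_triangle_ineq)
  also have "\<dots> = l2norm v + l2norm w"
    by (simp add: l2norm_eq[OF fin])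
  finally show ?thesis .
qed

lemma l2norm_diff:
  assumes "finite (nonzeros v)" "finite (nonzeros w)"
  shows "l2norm (\<lambda>\<gamma>. v \<gamma> - w \<gamma>) \<le> l2norm v + l2norm w"
proof -
  have neg: "nonzeros (\<lambda>\<gamma>. - w \<gamma>) = nonzeros w" by (auto simp: nonzeros_def)
  have "l2norm (\<lambda>\<gamma>. - w \<gamma>) = l2norm w" using l2norm_scale[of "-1" w] by simp
  with l2norm_add[of v "\<lambda>\<gamma>. - w \<gamma>"] assms neg show ?thesis by simp
qed

lemma l2norm_mono:
  assumes "finite (nonzeros w)" "\<And>\<gamma>. cmod (v \<gamma>) \<le> cmod (w \<gamma>)"
  shows "l2norm v \<le> l2norm w"
proof -
  have "nonzeros v \<subseteq> nonzeros w"
  proof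
    fix \<gamma> assume "\<gamma> \<in> nonzeros v"
    then show "\<gamma> \<in> nonzeros w" using assms(2)[of \<gamma>] by (auto simp: nonzeros_def)
  qed
  then have "l2norm v = L2_set (\<lambda>\<gamma>. cmod (v \<gamma>)) (nonzeros w)" by (rule l2norm_eq[OF assms(1)])
  also have "\<dots> \<le> l2norm w" unfolding l2norm_def by (rule L2_set_mono) (simp_all add: assms(2))
  finally show ?thesis .
qed

lemma ip_eq:
  assumes "finite B" "nonzeros v \<inter> nonzeros w \<subseteq> B"
  shows "ip v w = (\<Sum>\<gamma>\<in>B. cnj (v \<gamma>) * w \<gamma>)"
  unfolding ip_def by (rule sum.mono_neutral_left) (use assms in \<open>auto simp: nonzeros_def\<close>)

lemma ip_self:
  assumes "finite (nonzeros v)"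
  shows "ip v v = of_real ((l2norm v)\<^sup>2)"
  unfolding ip_def l2norm_power2[OF assms order.refl] of_real_sum
  by (rule sum.cong) (simp_all only: Int_absorb complex_norm_square mult.commute)

lemma ip_le:
  assumes "finite (nonzeros v)" "finite (nonzeros w)"
  shows "cmod (ip v w) \<le> l2norm v * l2norm w"
proof -
  let ?B = "nonzeros v \<union> nonzeros w"
  have fin: "finite ?B" using assms by simp
  have "cmod (ip v w) \<le> (\<Sum>\<gamma>\<in>?B. cmod (cnj (v \<gamma>) * w \<gamma>))"
    unfolding ip_eq[OF fin, of v w, simplified] by (subst ip_eq[OF fin]) (auto intro: norm_sum)
  also have "\<dots> = (\<Sum>\<gamma>\<in>?B. \<bar>cmod (v \<gamma>)\<bar> * \<bar>cmod (w \<gamma>)\<bar>)" by (simp add: norm_mult)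
  also have "\<dots> \<le> L2_set (\<lambda>\<gamma>. cmod (v \<gamma>)) ?B * L2_set (\<lambda>\<gamma>. cmod (w \<gamma>)) ?B"
    by (rule L2_set_mult_ineq)
  also have "\<dots> = l2norm v * l2norm w" by (simp add: l2norm_eq[OF fin])
  finally show ?thesis .
qed

definition delta :: "'g \<Rightarrow> 'g \<Rightarrow> complex" where
  "delta \<eta> \<gamma> = (if \<gamma> = \<eta> then 1 else 0)"

lemma nonzeros_delta [simp]: "nonzeros (delta \<eta>) = {\<eta>}"
  by (auto simp: nonzeros_def delta_def)

lemma l2norm_delta [simp]: "l2norm (delta \<eta>) = 1"
  by (simp add: l2norm_def) (simp add: delta_def)

lemma scalar_field_closed:
  assumes "scalar_field F"
  shows "0 \<in> F" "1 \<in> F" "a \<in> F \<Longrightarrow> b \<in> F \<Longrightarrow> a + b \<in> F" "a \<in> F \<Longrightarrow> b \<in> F \<Longrightarrow> a - b \<in> F"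
    "a \<in> F \<Longrightarrow> b \<in> F \<Longrightarrow> a * b \<in> F" "a \<in> F \<Longrightarrow> cnj a \<in> F" "of_real r \<in> F"
  using assms by (auto simp: scalar_field_def Reals_cnj_iff)

lemma scalar_field_sum:
  assumes "scalar_field F" "\<And>x. x \<in> B \<Longrightarrow> h x \<in> F"
  shows "sum h B \<in> F"
  using assms(2) by (induction B rule: infinite_finite_induct) (auto intro: scalar_field_closed[OF assms(1)])


section \<open>Convolution on the fibres of the source map\<close>

context topological_groupoid
begin

definition fibre :: "'g \<Rightarrow> 'g set" where
  "fibre x = {\<gamma> \<in> arrows G. src G \<gamma> = x}"

text \<open>For \<open>b\<close> in the source fibre of \<open>a\<close> this is the unique arrow
  that carries \<open>b\<close> to \<open>a\<close> from the left. It parametrises the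
  factorisations of \<open>a\<close> by the points of a fibre, so that convolution becomes
  multiplication by a matrix indexed by the fibre.\<close>

definition quo :: "'g \<Rightarrow> 'g \<Rightarrow> 'g" where
  "quo a b = mul G a (ginv G b)"

lemma composable_iff: "(a, b) \<in> composable G \<longleftrightarrow> a \<in> arrows G \<and> b \<in> arrows G \<and> src G a = rng G b"
  by (simp add: composable_def)

lemma units_subset: "x \<in> units G \<Longrightarrow> x \<in> arrows G"
  by (auto simp: units_def rng_closed)

lemma rng_units: "x \<in> units G \<Longrightarrow> rng G x = x"
  by (auto simp: units_def rng_rng)

lemma src_units: "x \<in> units G \<Longrightarrow> src G x = x"
  by (auto simp: units_def src_rng)

lemma rng_mem_units: "a \<in> arrows G \<Longrightarrow> rng G a \<in> units G"
  by (auto simp: units_def)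

lemma src_mem_units: "a \<in> arrows G \<Longrightarrow> src G a \<in> units G"
  using rng_ginv ginv_closed by (auto simp: units_def image_iff) metis

lemma inverse_unique:
  assumes "(a, b) \<in> composable G" "mul G a b = rng G a"
  shows "b = ginv G a"
proof -
  have a: "a \<in> arrows G" "b \<in> arrows G" "src G a = rng G b" using assms(1) by (auto simp: composable_iff)
  have "b = mul G (mul G (ginv G a) a) b" using a by (simp add: ginv_mul rng_mul_self)
  also have "\<dots> = mul G (ginv G a) (mul G a b)"
    using a by (intro mul_assoc) (auto simp: composable_iff ginv_closed src_ginv)
  also have "\<dots> = ginv G a"
    using a assms mul_src_self[OF ginv_closed[OF a(1)]] by (simp add: src_ginv)
  finally show ?thesis .
qed

lemma ginv_ginv: "a \<in> arrows G \<Longrightarrow> ginv G (ginv G a) = a"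
  by (rule inverse_unique[symmetric]) (auto simp: composable_iff ginv_closed src_ginv rng_ginv ginv_mul)

lemma ginv_unit: "x \<in> units G \<Longrightarrow> ginv G x = x"
  using units_subset[of x] rng_units[of x] src_units[of x] rng_mul_self[of x]
  by (intro inverse_unique[symmetric]) (auto simp: composable_iff)

context
  fixes a b assumes a: "a \<in> arrows G" and b: "b \<in> arrows G" and ab: "src G a = src G b"
begin

lemma quo_composable: "(a, ginv G b) \<in> composable G"
  using a b ab by (simp add: composable_iff ginv_closed rng_ginv)

lemma quo_closed: "quo a b \<in> arrows G"
  using quo_composable by (simp add: quo_def mul_closed)

lemma rng_quo: "rng G (quo a b) = rng G a"
  using quo_composable by (simp add: quo_def rng_mul)

lemma src_quo: "src G (quo a b) = rng G b"
  using quo_composable b by (simp add: quo_def src_mul src_ginv)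

lemma quo_composable2: "(quo a b, b) \<in> composable G"
  using b by (simp add: composable_iff quo_closed src_quo)

lemma mul_quo: "mul G (quo a b) b = a"
proof -
  have "mul G (quo a b) b = mul G a (mul G (ginv G b) b)" unfolding quo_def
    using quo_composable b by (intro mul_assoc) (auto simp: composable_iff src_ginv)
  also have "\<dots> = a" using a b ab mul_src_self[OF a] by (simp add: ginv_mul)
  finally show ?thesis .
qed

lemma ginv_quo: "ginv G (quo a b) = quo b a"
proof -
  have ba: "(b, ginv G a) \<in> composable G" using a b ab by (simp add: composable_iff ginv_closed rng_ginv)
  have qa: "quo b a \<in> arrows G" "rng G (quo b a) = rng G b" "src G (quo b a) = rng G a"
    using ba a by (simp_all add: quo_def mul_closed rng_mul src_mul src_ginv)
  have "mul G (quo a b) (quo b a) = mul G (mul G (quo a b) b) (ginv G a)"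
    unfolding quo_def[of b a] using ba quo_composable2 by (intro mul_assoc[symmetric]) auto
  also have "\<dots> = rng G (quo a b)" using a by (simp add: mul_quo rng_quo mul_ginv)
  finally show ?thesis using qa
    by (intro inverse_unique[symmetric]) (auto simp: composable_iff quo_closed src_quo)
qed

end

lemma quo_mul:
  assumes "(a, b) \<in> composable G"
  shows "quo (mul G a b) b = a"
proof -
  have a: "a \<in> arrows G" "b \<in> arrows G" "src G a = rng G b" using assms by (auto simp: composable_iff)
  have "quo (mul G a b) b = mul G a (mul G b (ginv G b))" unfolding quo_def
    using a assms by (intro mul_assoc) (auto simp: composable_iff ginv_closed rng_ginv)
  then show ?thesis using a mul_src_self[OF a(1)] by (simp add: mul_ginv)
qed

lemma mul_quo_quo:
  assumes "a \<in> fibre x" "b \<in> fibre x" "d \<in> fibre x"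
  shows "(quo a b, quo b d) \<in> composable G" "mul G (quo a b) (quo b d) = quo a d"
proof -
  have *: "a \<in> arrows G" "b \<in> arrows G" "d \<in> arrows G" "src G a = src G b" "src G b = src G d" "src G a = src G d"
    using assms by (auto simp: fibre_def)
  show "(quo a b, quo b d) \<in> composable G"
    using * by (simp add: composable_iff quo_closed src_quo rng_quo)
  have "mul G (quo a b) (quo b d) = mul G (mul G (quo a b) b) (ginv G d)"
    unfolding quo_def[of b d]
    using * by (intro mul_assoc[symmetric]) (auto simp: composable_iff quo_closed src_quo rng_ginv ginv_closed)
  then show "mul G (quo a b) (quo b d) = quo a d" using * mul_quo[of a b] by (simp add: quo_def[of a d])
qed

text \<open>Right translation by the inverse of \<open>d\<close> cancels in a quotient. This
  invariance lets \<open>mat_conv\<close> reindex a sum over one fibre by a sum over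
  another.\<close>

lemma quo_quo:
  assumes "a \<in> fibre x" "b \<in> fibre x" "d \<in> fibre x"
  shows "quo (quo a d) (quo b d) = quo a b"
  using quo_mul[OF mul_quo_quo(1)[OF assms]] mul_quo_quo(2)[OF assms] by simp

lemma quo_unit: "a \<in> arrows G \<Longrightarrow> quo a (src G a) = a"
  by (simp add: quo_def ginv_unit src_mem_units mul_src_self)

lemma quo_self: "a \<in> arrows G \<Longrightarrow> quo a a = rng G a"
  by (simp add: quo_def mul_ginv)

lemma fibre_src: "a \<in> arrows G \<Longrightarrow> src G a \<in> fibre (src G a)"
  by (simp add: fibre_def src_closed src_src)

lemma fibre_self: "a \<in> arrows G \<Longrightarrow> a \<in> fibre (src G a)"
  by (simp add: fibre_def)

lemma quo_fibre: "a \<in> fibre x \<Longrightarrow> b \<in> fibre x \<Longrightarrow> quo a b \<in> fibre (rng G b)"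
  by (auto simp: fibre_def quo_closed src_quo)

lemma inj_quo: "b \<in> fibre x \<Longrightarrow> inj_on (\<lambda>a. quo a b) (fibre x)"
  by (rule inj_on_inverseI[where g = "\<lambda>a. mul G a b"]) (auto simp: fibre_def mul_quo)

lemma inj_quo2: "a \<in> fibre x \<Longrightarrow> inj_on (\<lambda>b. quo a b) (fibre x)"
  by (rule inj_on_inverseI[where g = "\<lambda>b. mul G (ginv G b) a"])
    (auto simp: fibre_def ginv_quo mul_quo)

lemma mul_fibre:
  assumes "b \<in> fibre x" "a \<in> fibre (rng G b)"
  shows "mul G a b \<in> fibre x" "quo (mul G a b) b = a"
  using assms by (auto simp: fibre_def mul_closed src_mul composable_iff quo_mul)

text \<open>A purely algebraic class in which all convolution sums are finite; it contains the
  compactly supported functions and the finitely supported ones. It is stable under convolution but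
  not under \<open>invol\<close>, which exchanges source and range fibres; hence the separate
  assumptions on \<open>invol G f\<close> further on.\<close>

definition fibre_finite :: "('g \<Rightarrow> complex) \<Rightarrow> bool" where
  "fibre_finite f \<longleftrightarrow> nonzeros f \<subseteq> arrows G \<and> (\<forall>x. finite (fibre x \<inter> nonzeros f))"

lemma fibre_finite_add:
  "fibre_finite f \<Longrightarrow> fibre_finite g \<Longrightarrow> fibre_finite (\<lambda>\<gamma>. f \<gamma> + g \<gamma>)"
  "fibre_finite f \<Longrightarrow> fibre_finite g \<Longrightarrow> fibre_finite (\<lambda>\<gamma>. f \<gamma> - g \<gamma>)"
proof -
  assume f: "fibre_finite f" "fibre_finite g"
  have sub: "nonzeros (\<lambda>\<gamma>. f \<gamma> + g \<gamma>) \<subseteq> nonzeros f \<union> nonzeros g"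
    "nonzeros (\<lambda>\<gamma>. f \<gamma> - g \<gamma>) \<subseteq> nonzeros f \<union> nonzeros g"
    by (auto simp: nonzeros_def)
  have "finite (fibre x \<inter> (nonzeros f \<union> nonzeros g))" for x
    using f by (simp add: fibre_finite_def Int_Un_distrib)
  then show "fibre_finite (\<lambda>\<gamma>. f \<gamma> + g \<gamma>)" "fibre_finite (\<lambda>\<gamma>. f \<gamma> - g \<gamma>)"
    using f sub unfolding fibre_finite_def
    by (meson Un_least finite_subset Int_mono order.refl order.trans)+
qed

lemma fibre_finite_finite: "finite (nonzeros v) \<Longrightarrow> nonzeros v \<subseteq> arrows G \<Longrightarrow> fibre_finite v"
  by (simp add: fibre_finite_def)

lemma invol_eq: "a \<in> arrows G \<Longrightarrow> invol G f a = cnj (f (ginv G a))"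
  by (simp add: invol_def)

end

locale twisted_groupoid = topological_groupoid G
  for G :: "'g groupoid" +
  fixes F :: "complex set" and \<sigma> :: "'g \<Rightarrow> 'g \<Rightarrow> complex"
  assumes scalar: "scalar_field F"
    and cocycle: "normalised_two_cocycle G F \<sigma>"
begin

lemmas scalar_closed = scalar_field_closed[OF scalar]

lemma sigma_norm: "(a, b) \<in> composable G \<Longrightarrow> cmod (\<sigma> a b) = 1"
  and sigma_mem: "(a, b) \<in> composable G \<Longrightarrow> \<sigma> a b \<in> F"
  using cocycle by (auto simp: normalised_two_cocycle_def two_cocycle_def)

lemma sigma_cocycle:
  "(a, b) \<in> composable G \<Longrightarrow> (b, d) \<in> composable G \<Longrightarrow>
    \<sigma> a b * \<sigma> (mul G a b) d = \<sigma> a (mul G b d) * \<sigma> b d"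
  using cocycle by (simp add: normalised_two_cocycle_def two_cocycle_def)

lemma sigma_units: "a \<in> arrows G \<Longrightarrow> \<sigma> a (src G a) = 1" "a \<in> arrows G \<Longrightarrow> \<sigma> (rng G a) a = 1"
  and sigma_ginv: "a \<in> arrows G \<Longrightarrow> \<sigma> a (ginv G a) = 1"
  using cocycle by (auto simp: normalised_two_cocycle_def two_cocycle_def)

text \<open>The matrix of convolution by \<open>f\<close> on each fibre of the source map.\<close>

definition mat :: "('g \<Rightarrow> complex) \<Rightarrow> 'g \<Rightarrow> 'g \<Rightarrow> complex" where
  "mat f a b = f (quo a b) * \<sigma> (quo a b) b"

lemma norm_mat: "a \<in> fibre x \<Longrightarrow> b \<in> fibre x \<Longrightarrow> cmod (mat f a b) = cmod (f (quo a b))"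
  by (auto simp: mat_def norm_mult sigma_norm quo_composable2 fibre_def)

lemma mat_mem: "range f \<subseteq> F \<Longrightarrow> a \<in> fibre x \<Longrightarrow> b \<in> fibre x \<Longrightarrow> mat f a b \<in> F"
  by (auto simp: mat_def fibre_def intro!: scalar_closed sigma_mem quo_composable2)

lemma mat_src:
  assumes "a \<in> fibre x"
  shows "mat f a x = f a"
  using assms by (auto simp: mat_def fibre_def quo_unit sigma_units)

text \<open>The arrows \<open>quo a b\<close> and \<open>quo b a\<close> are inverse to each other.
  As the cocycle is normalised, its identity for the triple \<open>quo a b\<close>,
  \<open>quo b a\<close>, \<open>a\<close> reduces to
  \<open>\<sigma> (quo a b) b * \<sigma> (quo b a) a = 1\<close>. The values have modulus 1, so one
  factor is the conjugate of the other, and the involution becomes the adjoint matrix.\<close>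

lemma mat_invol:
  assumes "a \<in> fibre x" "b \<in> fibre x"
  shows "mat (invol G f) a b = cnj (mat f b a)"
proof -
  have *: "a \<in> arrows G" "b \<in> arrows G" "src G a = src G b" using assms by (auto simp: fibre_def)
  let ?q = "quo b a"
  have q: "?q \<in> arrows G" "ginv G ?q = quo a b" using * by (simp_all add: quo_closed ginv_quo)
  have comp: "(quo a b, ?q) \<in> composable G" "(?q, a) \<in> composable G"
    using assms by (auto simp: mul_quo_quo(1) * quo_composable2)
  have "\<sigma> (quo a b) ?q * \<sigma> (mul G (quo a b) ?q) a = \<sigma> (quo a b) (mul G ?q a) * \<sigma> ?q a"
    by (rule sigma_cocycle[OF comp])
  moreover have "mul G ?q a = b" using * by (simp add: mul_quo)
  moreover have "mul G (quo a b) ?q = rng G a" using mul_quo_quo(2)[OF assms(1,2,1)] * by (simp add: quo_self)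
  moreover have "\<sigma> (quo a b) ?q = 1"
    using sigma_ginv[of "quo a b"] * by (simp add: quo_closed ginv_quo)
  ultimately have "\<sigma> (quo a b) b * \<sigma> ?q a = 1" using * by (simp add: sigma_units)
  moreover have "cnj (\<sigma> ?q a) * \<sigma> ?q a = 1"
    using sigma_norm[OF comp(2)] by (metis complex_norm_square mult.commute of_real_1 one_power2)
  ultimately have "\<sigma> (quo a b) b = cnj (\<sigma> ?q a)"
    by (metis mult_cancel_right mult_zero_right zero_neq_one)
  then show ?thesis using * by (simp add: mat_def invol_eq quo_closed ginv_quo)
qed

text \<open>The pairs with product \<open>\<gamma>\<close> are exactly
  \<open>(quo \<gamma> \<eta>, \<eta>)\<close> with \<open>\<eta>\<close> in the fibre of
  \<open>\<gamma>\<close>. The set \<open>B\<close> is left free, so that several convolutions can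
  be summed over one common finite set.\<close>

lemma conv_eq:
  assumes \<gamma>: "\<gamma> \<in> fibre x" and B: "finite B" "B \<subseteq> fibre x"
    and zero: "\<And>\<eta>. \<eta> \<in> fibre x \<Longrightarrow> \<eta> \<notin> B \<Longrightarrow> f (quo \<gamma> \<eta>) * g \<eta> = 0"
  shows "conv G \<sigma> f g \<gamma> = (\<Sum>\<eta>\<in>B. mat f \<gamma> \<eta> * g \<eta>)"
proof -
  have g: "\<gamma> \<in> arrows G" "x = src G \<gamma>" using \<gamma> by (auto simp: fibre_def)
  let ?P = "{(\<xi>, \<eta>) \<in> composable G. mul G \<xi> \<eta> = \<gamma>}"
  let ?h = "\<lambda>\<eta>. (quo \<gamma> \<eta>, \<eta>)"
  have P: "?P = ?h ` fibre x"
  proof (intro set_eqI iffI)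
    fix p assume "p \<in> ?P"
    then obtain \<xi> \<eta> where p: "p = (\<xi>, \<eta>)" "(\<xi>, \<eta>) \<in> composable G" "mul G \<xi> \<eta> = \<gamma>" by auto
    then have "\<eta> \<in> fibre x" using src_mul[OF p(2)] g by (auto simp: fibre_def composable_iff)
    moreover have "p = ?h \<eta>" using quo_mul[OF p(2)] p by simp
    ultimately show "p \<in> ?h ` fibre x" by blast
  next
    fix p assume "p \<in> ?h ` fibre x"
    then show "p \<in> ?P" using g by (auto simp: fibre_def quo_composable2 mul_quo)
  qed
  have "conv G \<sigma> f g \<gamma> = infsum ((\<lambda>(\<xi>, \<eta>). f \<xi> * g \<eta> * \<sigma> \<xi> \<eta>) \<circ> ?h) (fibre x)"
    unfolding conv_def P by (rule infsum_reindex) (auto simp: inj_on_def)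
  also have "\<dots> = infsum (\<lambda>\<eta>. mat f \<gamma> \<eta> * g \<eta>) B"
    using B zero by (intro infsum_cong_neutral) (auto simp: mat_def)
  finally show ?thesis using B by simp
qed

lemma conv_outside: "\<gamma> \<notin> arrows G \<Longrightarrow> conv G \<sigma> f g \<gamma> = 0"
proof -
  assume "\<gamma> \<notin> arrows G"
  then have "{(\<xi>, \<eta>) \<in> composable G. mul G \<xi> \<eta> = \<gamma>} = {}" using mul_closed by auto
  then show ?thesis by (simp only: conv_def infsum_empty)
qed

lemma conv_fibre_finite:
  assumes "fibre_finite g" "\<gamma> \<in> fibre x"
  shows "conv G \<sigma> f g \<gamma> = (\<Sum>\<eta>\<in>fibre x \<inter> nonzeros g. mat f \<gamma> \<eta> * g \<eta>)"
  by (rule conv_eq[OF assms(2)]) (use assms in \<open>auto simp: fibre_finite_def nonzeros_def\<close>)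

lemma conv_diff_left:
  assumes "fibre_finite g"
  shows "conv G \<sigma> (\<lambda>\<gamma>. f \<gamma> - f' \<gamma>) g = (\<lambda>\<gamma>. conv G \<sigma> f g \<gamma> - conv G \<sigma> f' g \<gamma>)"
proof
  fix \<gamma> show "conv G \<sigma> (\<lambda>\<gamma>. f \<gamma> - f' \<gamma>) g \<gamma> = conv G \<sigma> f g \<gamma> - conv G \<sigma> f' g \<gamma>"
    by (cases "\<gamma> \<in> arrows G")
      (simp_all add: conv_fibre_finite[OF assms fibre_self] conv_outside mat_def algebra_simps sum_subtractf)
qed

lemma conv_add_left:
  assumes "fibre_finite g"
  shows "conv G \<sigma> (\<lambda>\<gamma>. f \<gamma> + f' \<gamma>) g = (\<lambda>\<gamma>. conv G \<sigma> f g \<gamma> + conv G \<sigma> f' g \<gamma>)"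
proof
  fix \<gamma> show "conv G \<sigma> (\<lambda>\<gamma>. f \<gamma> + f' \<gamma>) g \<gamma> = conv G \<sigma> f g \<gamma> + conv G \<sigma> f' g \<gamma>"
    by (cases "\<gamma> \<in> arrows G")
      (simp_all add: conv_fibre_finite[OF assms fibre_self] conv_outside mat_def algebra_simps sum.distrib)
qed

lemma conv_zero_left: "conv G \<sigma> (\<lambda>_. 0) g = (\<lambda>_. 0)"
  by (simp add: conv_def fun_eq_iff case_prod_unfold)

lemma conv_zero_right: "conv G \<sigma> f (\<lambda>_. 0) = (\<lambda>_. 0)"
  by (simp add: conv_def fun_eq_iff case_prod_unfold)

lemma conv_diff_right:
  assumes "fibre_finite g" "fibre_finite g'"
  shows "conv G \<sigma> f (\<lambda>\<gamma>. g \<gamma> - g' \<gamma>) = (\<lambda>\<gamma>. conv G \<sigma> f g \<gamma> - conv G \<sigma> f g' \<gamma>)"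
proof
  fix \<gamma>
  show "conv G \<sigma> f (\<lambda>\<gamma>. g \<gamma> - g' \<gamma>) \<gamma> = conv G \<sigma> f g \<gamma> - conv G \<sigma> f g' \<gamma>"
  proof (cases "\<gamma> \<in> arrows G")
    case True
    let ?B = "fibre (src G \<gamma>) \<inter> (nonzeros g \<union> nonzeros g')"
    have fin: "finite ?B" using assms by (simp add: fibre_finite_def Int_Un_distrib)
    have "conv G \<sigma> f k \<gamma> = (\<Sum>\<eta>\<in>?B. mat f \<gamma> \<eta> * k \<eta>)"
      if "k \<in> {g, g', \<lambda>\<gamma>. g \<gamma> - g' \<gamma>}" for k
      using that by (intro conv_eq[OF fibre_self[OF True] fin]) (auto simp: nonzeros_def)
    then show ?thesis by (simp add: algebra_simps sum_subtractf)
  qed (simp add: conv_outside)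
qed

lemma conv_scale_right: "conv G \<sigma> f (\<lambda>\<gamma>. a * g \<gamma>) = (\<lambda>\<gamma>. a * conv G \<sigma> f g \<gamma>)"
proof
  fix \<gamma>
  have "conv G \<sigma> f (\<lambda>\<gamma>. a * g \<gamma>) \<gamma> =
    infsum (\<lambda>p. a * (case p of (\<xi>, \<eta>) \<Rightarrow> f \<xi> * g \<eta> * \<sigma> \<xi> \<eta>)) {(\<xi>, \<eta>) \<in> composable G. mul G \<xi> \<eta> = \<gamma>}"
    unfolding conv_def by (rule infsum_cong) auto
  then show "conv G \<sigma> f (\<lambda>\<gamma>. a * g \<gamma>) \<gamma> = a * conv G \<sigma> f g \<gamma>"
    by (simp add: infsum_cmult_right' conv_def)
qed

lemma nonzeros_conv:
  assumes "\<gamma> \<in> nonzeros (conv G \<sigma> f g)"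
  obtains \<xi> \<eta> where "\<xi> \<in> nonzeros f" "\<eta> \<in> nonzeros g" "(\<xi>, \<eta>) \<in> composable G" "mul G \<xi> \<eta> = \<gamma>"
proof -
  have "\<exists>p\<in>{(\<xi>, \<eta>) \<in> composable G. mul G \<xi> \<eta> = \<gamma>}. (case p of (\<xi>, \<eta>) \<Rightarrow> f \<xi> * g \<eta> * \<sigma> \<xi> \<eta>) \<noteq> 0"
  proof (rule ccontr)
    assume "\<not> ?thesis"
    then have "conv G \<sigma> f g \<gamma> = 0" unfolding conv_def by (intro infsum_0) auto
    with assms show False by (simp add: nonzeros_def)
  qed
  then show thesis using that by (auto simp: nonzeros_def)
qed

lemma nonzeros_conv_subset:
  assumes "\<gamma> \<in> fibre x" "\<gamma> \<in> nonzeros (conv G \<sigma> f g)"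
  shows "\<exists>\<eta>\<in>fibre x \<inter> nonzeros g. f (quo \<gamma> \<eta>) \<noteq> 0"
proof -
  obtain \<xi> \<eta> where *: "\<xi> \<in> nonzeros f" "\<eta> \<in> nonzeros g" "(\<xi>, \<eta>) \<in> composable G" "mul G \<xi> \<eta> = \<gamma>"
    using nonzeros_conv[OF assms(2)] by blast
  then have "quo \<gamma> \<eta> = \<xi>" "\<eta> \<in> fibre x"
    using assms(1) src_mul[OF *(3)] quo_mul[OF *(3)] by (auto simp: fibre_def composable_iff)
  with * show ?thesis by (intro bexI[of _ \<eta>]) (auto simp: nonzeros_def)
qed

lemma finite_fibre_translate:
  assumes "fibre_finite f" "\<eta> \<in> fibre x"
  shows "finite {\<gamma> \<in> fibre x. f (quo \<gamma> \<eta>) \<noteq> 0}"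
proof (rule finite_imageD)
  have "(\<lambda>\<gamma>. quo \<gamma> \<eta>) ` {\<gamma> \<in> fibre x. f (quo \<gamma> \<eta>) \<noteq> 0} \<subseteq> fibre (rng G \<eta>) \<inter> nonzeros f"
    using quo_fibre assms(2) by (auto simp: nonzeros_def)
  then show "finite ((\<lambda>\<gamma>. quo \<gamma> \<eta>) ` {\<gamma> \<in> fibre x. f (quo \<gamma> \<eta>) \<noteq> 0})"
    using assms(1) unfolding fibre_finite_def by (meson finite_subset)
  show "inj_on (\<lambda>\<gamma>. quo \<gamma> \<eta>) {\<gamma> \<in> fibre x. f (quo \<gamma> \<eta>) \<noteq> 0}"
    by (rule inj_on_subset[OF inj_quo[OF assms(2)]]) auto
qed

lemma fibre_finite_conv:
  assumes "fibre_finite f" "fibre_finite g"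
  shows "fibre_finite (conv G \<sigma> f g)"
  unfolding fibre_finite_def
proof (intro conjI allI)
  show "nonzeros (conv G \<sigma> f g) \<subseteq> arrows G"
    using conv_outside by (auto simp: nonzeros_def)
  fix x
  have "fibre x \<inter> nonzeros (conv G \<sigma> f g) \<subseteq>
    (\<Union>\<eta>\<in>fibre x \<inter> nonzeros g. {\<gamma> \<in> fibre x. f (quo \<gamma> \<eta>) \<noteq> 0})"
    using nonzeros_conv_subset by blast
  then show "finite (fibre x \<inter> nonzeros (conv G \<sigma> f g))"
    using assms finite_fibre_translate[OF assms(1)]
    by (elim finite_subset) (auto simp: fibre_finite_def)
qed

text \<open>Convolution becomes the matrix product: right translation by the inverse of
  \<open>b\<close> turns the sum over the fibre of \<open>quo a b\<close> into one over the fibre of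
  \<open>a\<close>, and the cocycle identity for \<open>quo a z\<close>, \<open>quo z b\<close>,
  \<open>b\<close> redistributes the twist.\<close>

lemma mat_conv:
  assumes a: "a \<in> fibre x" and b: "b \<in> fibre x" and B: "finite B" "B \<subseteq> fibre x"
    and zero: "\<And>z. z \<in> fibre x \<Longrightarrow> z \<notin> B \<Longrightarrow> g (quo z b) = 0"
  shows "mat (conv G \<sigma> f g) a b = (\<Sum>z\<in>B. mat f a z * mat g z b)"
proof -
  have ab: "a \<in> arrows G" "b \<in> arrows G" "src G a = src G b" "src G b = x" using a b by (auto simp: fibre_def)
  have "conv G \<sigma> f g (quo a b) = (\<Sum>z\<in>(\<lambda>z. quo z b) ` B. mat f (quo a b) z * g z)"
  proof (rule conv_eq[OF quo_fibre[OF a b]])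
    show "finite ((\<lambda>z. quo z b) ` B)" using B by simp
    show "(\<lambda>z. quo z b) ` B \<subseteq> fibre (rng G b)" using quo_fibre b B by auto
    fix \<eta> assume \<eta>: "\<eta> \<in> fibre (rng G b)" "\<eta> \<notin> (\<lambda>z. quo z b) ` B"
    note m = mul_fibre[OF b \<eta>(1)]
    then have "mul G \<eta> b \<notin> B" using \<eta>(2) by (metis imageI)
    with zero[OF m(1)] m(2) show "f (quo (quo a b) \<eta>) * g \<eta> = 0" by simp
  qed
  also have "\<dots> = (\<Sum>z\<in>B. mat f (quo a b) (quo z b) * g (quo z b))"
    by (subst sum.reindex) (use inj_on_subset[OF inj_quo[OF b] B(2)] in auto)
  finally have "mat (conv G \<sigma> f g) a b =
      (\<Sum>z\<in>B. mat f (quo a b) (quo z b) * g (quo z b) * \<sigma> (quo a b) b)"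
    by (simp add: mat_def sum_distrib_right)
  also have "\<dots> = (\<Sum>z\<in>B. mat f a z * mat g z b)"
  proof (rule sum.cong[OF refl])
    fix z assume "z \<in> B"
    then have z: "z \<in> fibre x" using B by auto
    then have z': "z \<in> arrows G" "src G z = src G b" using ab by (auto simp: fibre_def)
    have "\<sigma> (quo a z) (quo z b) * \<sigma> (quo a b) b = \<sigma> (quo a z) z * \<sigma> (quo z b) b"
      using sigma_cocycle[OF mul_quo_quo(1)[OF a z b], of b] mul_quo_quo(2)[OF a z b] z' ab
      by (simp add: quo_composable2 mul_quo)
    then show "mat f (quo a b) (quo z b) * g (quo z b) * \<sigma> (quo a b) b = mat f a z * mat g z b"
      by (simp add: mat_def quo_quo[OF a z b] mult_ac)
  qed
  finally show ?thesis .
qed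

lemma conv_assoc:
  assumes "fibre_finite g" "fibre_finite h"
  shows "conv G \<sigma> (conv G \<sigma> f g) h = conv G \<sigma> f (conv G \<sigma> g h)"
proof
  fix \<gamma>
  show "conv G \<sigma> (conv G \<sigma> f g) h \<gamma> = conv G \<sigma> f (conv G \<sigma> g h) \<gamma>"
  proof (cases "\<gamma> \<in> arrows G")
    case True
    define x where "x = src G \<gamma>"
    have \<gamma>: "\<gamma> \<in> fibre x" using True by (simp add: x_def fibre_self)
    define C where "C = fibre x \<inter> nonzeros h"
    \<comment> \<open>The intermediate points that \<open>g\<close> reaches from the support of
      \<open>h\<close>. Outside of \<open>B\<close> the convolution of \<open>g\<close> and
      \<open>h\<close> vanishes, so both sides become finite double sums over \<open>B\<close> and
      \<open>C\<close>.\<close>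
    define B where "B = (\<Union>\<eta>\<in>C. {z \<in> fibre x. g (quo z \<eta>) \<noteq> 0})"
    have C: "finite C" "C \<subseteq> fibre x" using assms by (auto simp: C_def fibre_finite_def)
    have B: "finite B" "B \<subseteq> fibre x"
      using C finite_fibre_translate[OF assms(1)] by (auto simp: B_def)
    have "conv G \<sigma> (conv G \<sigma> f g) h \<gamma> = (\<Sum>\<eta>\<in>C. mat (conv G \<sigma> f g) \<gamma> \<eta> * h \<eta>)"
      using conv_fibre_finite[OF assms(2) \<gamma>] by (simp add: C_def)
    also have "\<dots> = (\<Sum>\<eta>\<in>C. \<Sum>z\<in>B. mat f \<gamma> z * mat g z \<eta> * h \<eta>)"
    proof (rule sum.cong[OF refl])
      fix \<eta> assume \<eta>: "\<eta> \<in> C"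
      have "mat (conv G \<sigma> f g) \<gamma> \<eta> = (\<Sum>z\<in>B. mat f \<gamma> z * mat g z \<eta>)"
        by (rule mat_conv[OF \<gamma> _ B]) (use \<eta> C in \<open>auto simp: B_def\<close>)
      then show "mat (conv G \<sigma> f g) \<gamma> \<eta> * h \<eta> = (\<Sum>z\<in>B. mat f \<gamma> z * mat g z \<eta> * h \<eta>)"
        by (simp add: sum_distrib_right)
    qed
    also have "\<dots> = (\<Sum>z\<in>B. \<Sum>\<eta>\<in>C. mat f \<gamma> z * mat g z \<eta> * h \<eta>)" by (rule sum.swap)
    also have "\<dots> = (\<Sum>z\<in>B. mat f \<gamma> z * conv G \<sigma> g h z)"
      using B(2) conv_fibre_finite[OF assms(2), of _ x]
      by (intro sum.cong) (auto simp: C_def sum_distrib_left mult.assoc subset_iff)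
    also have "\<dots> = conv G \<sigma> f (conv G \<sigma> g h) \<gamma>"
    proof (rule conv_eq[OF \<gamma> B, symmetric])
      fix z assume "z \<in> fibre x" "z \<notin> B"
      then have "z \<notin> nonzeros (conv G \<sigma> g h)"
        using nonzeros_conv_subset[of z x g h] by (auto simp: B_def C_def)
      then show "f (quo \<gamma> z) * conv G \<sigma> g h z = 0" by (simp add: nonzeros_def)
    qed
    finally show ?thesis .
  qed (simp add: conv_outside)
qed

text \<open>By \<open>mat_src\<close> a function is the column of its matrix at the unit
  \<open>x\<close>. The identity is the rule that the adjoint of a matrix product is the reversed
  product of the adjoints, read off in that column.\<close>

lemma invol_conv:
  assumes "fibre_finite g" "fibre_finite (invol G f)"
  shows "invol G (conv G \<sigma> f g) = conv G \<sigma> (invol G g) (invol G f)"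
proof
  fix \<gamma>
  show "invol G (conv G \<sigma> f g) \<gamma> = conv G \<sigma> (invol G g) (invol G f) \<gamma>"
  proof (cases "\<gamma> \<in> arrows G")
    case True
    define x where "x = src G \<gamma>"
    have \<gamma>: "\<gamma> \<in> fibre x" and x: "x \<in> fibre x" using True by (simp_all add: x_def fibre_self fibre_src)
    define B where "B = {z \<in> fibre x. g (quo z \<gamma>) \<noteq> 0} \<union> (fibre x \<inter> nonzeros (invol G f))"
    have B: "finite B" "B \<subseteq> fibre x"
      using assms finite_fibre_translate[OF assms(1) \<gamma>] by (auto simp: B_def fibre_finite_def)
    have "conv G \<sigma> (invol G g) (invol G f) \<gamma> = (\<Sum>z\<in>B. mat (invol G g) \<gamma> z * invol G f z)"
      by (rule conv_eq[OF \<gamma> B]) (auto simp: B_def nonzeros_def)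
    also have "\<dots> = (\<Sum>z\<in>B. cnj (mat f x z * mat g z \<gamma>))"
    proof (rule sum.cong[OF refl])
      fix z assume "z \<in> B"
      then have z: "z \<in> fibre x" using B by auto
      show "mat (invol G g) \<gamma> z * invol G f z = cnj (mat f x z * mat g z \<gamma>)"
        using mat_invol[OF \<gamma> z, of g] mat_invol[OF z x, of f] mat_src[OF z, of "invol G f"] by simp
    qed
    also have "\<dots> = cnj (mat (conv G \<sigma> f g) x \<gamma>)"
      by (subst mat_conv[OF x \<gamma> B]) (auto simp: B_def cnj_sum)
    also have "\<dots> = invol G (conv G \<sigma> f g) \<gamma>"
      using mat_invol[OF \<gamma> x, of "conv G \<sigma> f g"] mat_src[OF \<gamma>, of "invol G (conv G \<sigma> f g)"] by simp
    finally show ?thesis by simp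
  qed (simp add: conv_outside invol_def)
qed

section \<open>Operator bounds on finitely supported vectors\<close>

definition fs :: "'g set \<Rightarrow> 'g \<Rightarrow> ('g \<Rightarrow> complex) set" where
  "fs A x = {v. finite (nonzeros v) \<and> nonzeros v \<subseteq> A \<inter> fibre x \<and> range v \<subseteq> F}"

text \<open>A bound for convolution by \<open>f\<close> on all fibres at once, with arguments
  supported in \<open>A\<close>; the results may leave \<open>A\<close>. As a predicate it avoids
  suprema of sets not yet known to be bounded. If no nonzero vector is supported in
  \<open>A\<close>, negative \<open>C\<close> pass too, so comparisons with norms assume
  \<open>C \<ge> 0\<close>.\<close>

definition bnd :: "'g set \<Rightarrow> ('g \<Rightarrow> complex) \<Rightarrow> real \<Rightarrow> bool" where
  "bnd A f C \<longleftrightarrow> (\<forall>x. \<forall>v\<in>fs A x. l2norm (conv G \<sigma> f v) \<le> C * l2norm v)"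

lemma fsD:
  assumes "v \<in> fs A x"
  shows "finite (nonzeros v)" "nonzeros v \<subseteq> A" "nonzeros v \<subseteq> fibre x" "range v \<subseteq> F" "fibre_finite v"
  using assms by (auto simp: fs_def fibre_def intro!: fibre_finite_finite)

lemma range_conv:
  assumes "range f \<subseteq> F" "range g \<subseteq> F" "fibre_finite g"
  shows "range (conv G \<sigma> f g) \<subseteq> F"
proof clarify
  fix \<gamma>
  show "conv G \<sigma> f g \<gamma> \<in> F"
  proof (cases "\<gamma> \<in> arrows G")
    case True
    show ?thesis
      unfolding conv_fibre_finite[OF assms(3) fibre_self[OF True]]
      using assms fibre_self[OF True]
      by (intro scalar_field_sum[OF scalar] scalar_closed mat_mem[where x = "src G \<gamma>"]) auto
  qed (simp add: conv_outside scalar_closed)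
qed

lemma conv_supp_fibre:
  assumes "v \<in> fs A x"
  shows "nonzeros (conv G \<sigma> f v) \<subseteq> fibre x"
proof
  fix \<gamma> assume "\<gamma> \<in> nonzeros (conv G \<sigma> f v)"
  then obtain \<xi> \<eta> where "\<eta> \<in> nonzeros v" "(\<xi>, \<eta>) \<in> composable G" "mul G \<xi> \<eta> = \<gamma>"
    by (rule nonzeros_conv)
  with assms show "\<gamma> \<in> fibre x" by (auto simp: fs_def fibre_def mul_closed src_mul)
qed

lemma conv_fs:
  assumes f: "fibre_finite f" "range f \<subseteq> F" and v: "v \<in> fs A x"
  shows "conv G \<sigma> f v \<in> fs (arrows G) x"
proof -
  note v' = fsD[OF v]
  have sub: "nonzeros (conv G \<sigma> f v) \<subseteq> fibre x" by (rule conv_supp_fibre[OF v])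
  have ff: "fibre_finite (conv G \<sigma> f v)" by (rule fibre_finite_conv[OF f(1) v'(5)])
  then have "finite (fibre x \<inter> nonzeros (conv G \<sigma> f v))" by (simp add: fibre_finite_def)
  with sub have "finite (nonzeros (conv G \<sigma> f v))" by (simp add: inf.absorb2)
  with sub ff range_conv[OF f(2) v'(4,5)] show ?thesis by (auto simp: fs_def fibre_finite_def)
qed

lemma finite_nonzeros_conv:
  assumes "fibre_finite f" "v \<in> fs A x"
  shows "finite (nonzeros (conv G \<sigma> f v))"
proof -
  have "finite (fibre x \<inter> nonzeros (conv G \<sigma> f v))"
    using fibre_finite_conv[OF assms(1) fsD(5)[OF assms(2)]] by (simp add: fibre_finite_def)
  then show ?thesis using conv_supp_fibre[OF assms(2), of f] by (simp add: inf.absorb2)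
qed

lemma ip_conv:
  assumes f: "fibre_finite f" "fibre_finite (invol G f)" and v: "v \<in> fs A x" and w: "w \<in> fs A' x"
  shows "ip (conv G \<sigma> f v) w = ip v (conv G \<sigma> (invol G f) w)"
proof -
  let ?B = "nonzeros w" and ?C = "nonzeros v"
  note v' = fsD[OF v] and w' = fsD[OF w]
  have "ip (conv G \<sigma> f v) w = (\<Sum>\<gamma>\<in>?B. cnj (conv G \<sigma> f v \<gamma>) * w \<gamma>)"
    by (rule ip_eq) (use w' in auto)
  also have "\<dots> = (\<Sum>\<gamma>\<in>?B. \<Sum>\<eta>\<in>?C. cnj (mat f \<gamma> \<eta>) * cnj (v \<eta>) * w \<gamma>)"
  proof (rule sum.cong[OF refl])
    fix \<gamma> assume "\<gamma> \<in> ?B"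
    then have "conv G \<sigma> f v \<gamma> = (\<Sum>\<eta>\<in>?C. mat f \<gamma> \<eta> * v \<eta>)"
      using w' v' by (intro conv_eq[where x = x]) (auto simp: nonzeros_def)
    then show "cnj (conv G \<sigma> f v \<gamma>) * w \<gamma> = (\<Sum>\<eta>\<in>?C. cnj (mat f \<gamma> \<eta>) * cnj (v \<eta>) * w \<gamma>)"
      by (simp add: cnj_sum sum_distrib_right)
  qed
  also have "\<dots> = (\<Sum>\<eta>\<in>?C. \<Sum>\<gamma>\<in>?B. cnj (mat f \<gamma> \<eta>) * cnj (v \<eta>) * w \<gamma>)" by (rule sum.swap)
  also have "\<dots> = (\<Sum>\<eta>\<in>?C. cnj (v \<eta>) * conv G \<sigma> (invol G f) w \<eta>)"
  proof (rule sum.cong[OF refl])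
    fix \<eta> assume \<eta>: "\<eta> \<in> ?C"
    then have "conv G \<sigma> (invol G f) w \<eta> = (\<Sum>\<gamma>\<in>?B. mat (invol G f) \<eta> \<gamma> * w \<gamma>)"
      using w' v' by (intro conv_eq[where x = x]) (auto simp: nonzeros_def)
    also have "\<dots> = (\<Sum>\<gamma>\<in>?B. cnj (mat f \<gamma> \<eta>) * w \<gamma>)"
      using \<eta> v' w' by (intro sum.cong) (auto simp: mat_invol[where x = x] subset_iff)
    finally show "(\<Sum>\<gamma>\<in>?B. cnj (mat f \<gamma> \<eta>) * cnj (v \<eta>) * w \<gamma>) = cnj (v \<eta>) * conv G \<sigma> (invol G f) w \<eta>"
      by (simp add: sum_distrib_left mult_ac)
  qed
  also have "\<dots> = ip v (conv G \<sigma> (invol G f) w)"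
    by (rule ip_eq[symmetric]) (use v' in auto)
  finally show ?thesis .
qed

lemma invol_invol:
  assumes "nonzeros f \<subseteq> arrows G"
  shows "invol G (invol G f) = f"
proof
  fix \<gamma> show "invol G (invol G f) \<gamma> = f \<gamma>"
    by (cases "\<gamma> \<in> arrows G") (use assms in \<open>auto simp: invol_def ginv_closed ginv_ginv nonzeros_def\<close>)
qed

lemma conv_delta:
  assumes "\<gamma> \<in> fibre x" "\<eta> \<in> fibre x"
  shows "conv G \<sigma> f (delta \<eta>) \<gamma> = mat f \<gamma> \<eta>"
  by (subst conv_eq[OF assms(1), of "{\<eta>}"]) (use assms in \<open>auto simp: delta_def\<close>)

lemma delta_fs: "\<eta> \<in> A \<Longrightarrow> \<eta> \<in> fibre x \<Longrightarrow> delta \<eta> \<in> fs A x"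
  using scalar_closed by (auto simp: fs_def delta_def)

text \<open>Restriction to a source fibre is written as a convolution, so that associativity gives
  the restriction of a product as \<open>f\<close> applied to the restriction of the second
  factor.\<close>

lemma conv_delta_unit:
  assumes "x \<in> units G"
  shows "conv G \<sigma> f (delta x) = (\<lambda>\<gamma>. if \<gamma> \<in> fibre x then f \<gamma> else 0)"
proof
  fix \<gamma>
  have x: "x \<in> fibre x" using assms by (simp add: fibre_def units_subset src_units)
  show "conv G \<sigma> f (delta x) \<gamma> = (if \<gamma> \<in> fibre x then f \<gamma> else 0)"
    using conv_delta[OF _ x] mat_src conv_supp_fibre[OF delta_fs[OF UNIV_I x], of f]
    by (auto simp: nonzeros_def)
qed

text \<open>At \<open>mul G \<gamma> \<eta>\<close> the product takes the value of \<open>v\<close>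
  at \<open>\<gamma>\<close> times the unimodular \<open>\<sigma> \<gamma> \<eta>\<close>. Absolute
  values are merely moved, along an injective map from the fibre over the range of
  \<open>\<eta>\<close> to the fibre over its source, so both the l2 and the l1 norm are
  preserved.\<close>

lemma l2norm_conv_delta:
  assumes v: "v \<in> fs (arrows G) (rng G \<eta>)" and \<eta>: "\<eta> \<in> arrows G"
  shows "l2norm (conv G \<sigma> v (delta \<eta>)) = l2norm v"
    and "nonzeros (conv G \<sigma> v (delta \<eta>)) = (\<lambda>\<gamma>. mul G \<gamma> \<eta>) ` nonzeros v"
    and "conv G \<sigma> v (delta \<eta>) \<in> fs (arrows G) (src G \<eta>)"
    and "(\<Sum>\<gamma>\<in>nonzeros (conv G \<sigma> v (delta \<eta>)). cmod (conv G \<sigma> v (delta \<eta>) \<gamma>)) = (\<Sum>\<gamma>\<in>nonzeros v. cmod (v \<gamma>))"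
proof -
  note v' = fsD[OF v]
  let ?x = "src G \<eta>" and ?w = "conv G \<sigma> v (delta \<eta>)" and ?h = "\<lambda>\<gamma>. mul G \<gamma> \<eta>"
  have e: "\<eta> \<in> fibre ?x" using \<eta> by (rule fibre_self)
  have m: "?h \<gamma> \<in> fibre ?x" "quo (?h \<gamma>) \<eta> = \<gamma>" if "\<gamma> \<in> nonzeros v" for \<gamma>
    using mul_fibre[OF e, of \<gamma>] that v' by auto
  have wf: "?w \<in> fs (arrows G) ?x" by (rule conv_fs[OF v'(5,4) delta_fs[OF \<eta> e]])
  then show "?w \<in> fs (arrows G) ?x" .
  have val: "cmod (?w \<gamma>) = cmod (v (quo \<gamma> \<eta>))" if "\<gamma> \<in> fibre ?x" for \<gamma>
    using conv_delta[OF that e] norm_mat[OF that e] by simp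
  show nz: "nonzeros ?w = ?h ` nonzeros v"
  proof (intro set_eqI iffI)
    fix \<gamma> assume g: "\<gamma> \<in> nonzeros ?w"
    then have "\<gamma> \<in> fibre ?x" using fsD(3)[OF wf] by auto
    with val[OF this] g have "quo \<gamma> \<eta> \<in> nonzeros v" "\<gamma> = ?h (quo \<gamma> \<eta>)"
      using \<eta> by (auto simp: nonzeros_def fibre_def mul_quo)
    then show "\<gamma> \<in> ?h ` nonzeros v" by blast
  next
    fix \<gamma> assume "\<gamma> \<in> ?h ` nonzeros v"
    then obtain \<xi> where \<xi>: "\<xi> \<in> nonzeros v" "\<gamma> = ?h \<xi>" by blast
    then have "cmod (?w \<gamma>) = cmod (v \<xi>)" using m[OF \<xi>(1)] val by simp
    then show "\<gamma> \<in> nonzeros ?w" using \<xi>(1) by (auto simp: nonzeros_def)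
  qed
  have inj: "inj_on ?h (nonzeros v)" by (rule inj_on_inverseI[where g = "\<lambda>a. quo a \<eta>"]) (rule m)
  show "(\<Sum>\<gamma>\<in>nonzeros ?w. cmod (?w \<gamma>)) = (\<Sum>\<gamma>\<in>nonzeros v. cmod (v \<gamma>))"
    unfolding nz sum.reindex[OF inj] by (rule sum.cong) (simp_all add: val m)
  have "(\<Sum>\<gamma>\<in>?h ` nonzeros v. (cmod (?w \<gamma>))\<^sup>2) = (\<Sum>\<gamma>\<in>nonzeros v. (cmod (?w (?h \<gamma>)))\<^sup>2)"
    using sum.reindex[OF inj] by simp
  also have "\<dots> = (\<Sum>\<gamma>\<in>nonzeros v. (cmod (v \<gamma>))\<^sup>2)"
    by (rule sum.cong) (simp_all add: val m)
  finally show "l2norm ?w = l2norm v" by (simp add: l2norm_def L2_set_def nz)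
qed

end


section \<open>Functions supported on bisections\<close>

lemma continuous_map_mult_algebra:
  fixes f g :: "'a \<Rightarrow> 'b :: real_normed_algebra"
  shows "continuous_map X euclidean f \<Longrightarrow> continuous_map X euclidean g \<Longrightarrow>
    continuous_map X euclidean (\<lambda>x. f x * g x)"
  by (simp add: continuous_map_atin tendsto_mult)

lemma continuous_map_of_real:
  "continuous_map X euclideanreal f \<Longrightarrow>
    continuous_map X euclidean (\<lambda>x. of_real (f x) :: 'b :: real_normed_algebra_1)"
  by (simp add: continuous_map_atin tendsto_of_real)

lemma continuous_map_cnj:
  "continuous_map X euclidean f \<Longrightarrow> continuous_map X euclidean (\<lambda>x. cnj (f x))"
  by (simp add: continuous_map_atin tendsto_cnj)

lemma continuous_map_glue:
  assumes A: "openin X A" "continuous_map (subtopology X A) Y f" "\<And>x. x \<in> A \<Longrightarrow> g x = f x"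
    and B: "openin X B" "continuous_map (subtopology X B) Y f'" "\<And>x. x \<in> B \<Longrightarrow> g x = f' x"
    and AB: "topspace X \<subseteq> A \<union> B"
  shows "continuous_map X Y g"
proof (rule pasting_lemma[where I = "UNIV :: bool set" and T = "\<lambda>b. if b then A else B" and f = "\<lambda>_. g"])
  fix b :: bool
  show "openin X (if b then A else B)" using A B by simp
  show "continuous_map (subtopology X (if b then A else B)) Y g"
    using continuous_map_eq[OF A(2), of g] continuous_map_eq[OF B(2), of g] A(3) B(3) by auto
next
  fix x assume "x \<in> topspace X"
  then show "\<exists>j. j \<in> UNIV \<and> x \<in> (if j then A else B) \<and> g x = g x" using AB by (auto intro: exI[of _ True] exI[of _ False])
qed simp

lemma finite_Hausdorff_separation:
  assumes X: "Hausdorff_space X" and A: "finite A" "A \<subseteq> topspace X"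
  obtains U where "\<And>a. a \<in> A \<Longrightarrow> openin X (U a)" "\<And>a. a \<in> A \<Longrightarrow> a \<in> U a"
    "\<And>a b. a \<in> A \<Longrightarrow> b \<in> A \<Longrightarrow> a \<noteq> b \<Longrightarrow> U a \<inter> U b = {}"
proof -
  define sep where "sep a b P Q \<longleftrightarrow>
    openin X P \<and> openin X Q \<and> a \<in> P \<and> b \<in> Q \<and> P \<inter> Q = {}" for a b P Q
  have "\<exists>P Q. a \<in> A \<and> b \<in> A \<and> a \<noteq> b \<longrightarrow> sep a b P Q" for a b
  proof (cases "a \<in> A \<and> b \<in> A \<and> a \<noteq> b")
    case True
    with A(2) have "a \<in> topspace X \<and> b \<in> topspace X \<and> a \<noteq> b" by blast
    with X obtain P Q where "openin X P" "openin X Q" "a \<in> P" "b \<in> Q" "disjnt P Q"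
      unfolding Hausdorff_space_def by metis
    then have "sep a b P Q" by (simp add: sep_def disjnt_def)
    then show ?thesis by blast
  qed blast
  then obtain P Q where "\<And>a b. a \<in> A \<and> b \<in> A \<and> a \<noteq> b \<Longrightarrow> sep a b (P a b) (Q a b)"
    by metis
  then have PQ: "openin X (P a b) \<and> openin X (Q a b) \<and> a \<in> P a b \<and> b \<in> Q a b \<and> P a b \<inter> Q a b = {}"
    if "a \<in> A" "b \<in> A" "a \<noteq> b" for a b
    using that by (simp add: sep_def)
  \<comment> \<open>Both \<open>P a b\<close> and \<open>Q b a\<close> are neighbourhoods of
    \<open>a\<close>. Asking for both removes the asymmetry of the choice: \<open>U a\<close> lies
    in \<open>P a b\<close> and \<open>U b\<close> in \<open>Q a b\<close>, which are disjoint. The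
    intersection with the whole space takes care of a one-point \<open>A\<close>.\<close>
  define U where "U a = topspace X \<inter> (\<Inter>b\<in>A - {a}. P a b \<inter> Q b a)" for a
  have "openin X (U a)" if "a \<in> A" for a
    unfolding U_def
  proof (cases "A - {a} = {}")
    case False
    then have "openin X (\<Inter>b\<in>A - {a}. P a b \<inter> Q b a)"
      using A(1) PQ that by (intro openin_INT2) auto
    then show "openin X (topspace X \<inter> (\<Inter>b\<in>A - {a}. P a b \<inter> Q b a))" by auto
  next
    case True
    show "openin X (topspace X \<inter> (\<Inter>b\<in>A - {a}. P a b \<inter> Q b a))" unfolding True by simp
  qed
  moreover have "a \<in> U a" if "a \<in> A" for a
    using PQ that A(2) by (auto simp: U_def)
  moreover have "U a \<inter> U b = {}" if "a \<in> A" "b \<in> A" "a \<noteq> b" for a b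
    using PQ[OF that] that by (auto simp: U_def)
  ultimately show ?thesis by (rule that)
qed

context lch_etale_groupoid
begin

abbreviation X where "X \<equiv> gtop G"

lemma topspace_X: "topspace X = arrows G"
  by (simp add: arrows_def)

lemma units_sub: "units G \<subseteq> arrows G"
  using units_subset by auto

lemma topspace_unit_top: "topspace (unit_top G) = units G"
  using units_sub by (auto simp: unit_top_def topspace_X)

lemma continuous_map_composable:
  assumes "continuous_map Z X f" "continuous_map Z X g"
    "\<And>z. z \<in> topspace Z \<Longrightarrow> src G (f z) = rng G (g z)"
  shows "continuous_map Z (composable_top G) (\<lambda>z. (f z, g z))"
  unfolding composable_top_def
proof (rule continuous_map_into_subtopology)
  show "continuous_map Z (prod_topology X X) (\<lambda>z. (f z, g z))"
    using assms by (intro continuous_map_pairedI)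
  show "(\<lambda>z. (f z, g z)) \<in> topspace Z \<rightarrow> composable G"
    using assms continuous_map_image_subset_topspace[OF assms(1)]
      continuous_map_image_subset_topspace[OF assms(2)]
    by (auto simp: composable_iff topspace_X image_subset_iff)
qed

lemma continuous_map_mul:
  assumes "continuous_map Z X f" "continuous_map Z X g"
    "\<And>z. z \<in> topspace Z \<Longrightarrow> src G (f z) = rng G (g z)"
  shows "continuous_map Z X (\<lambda>z. mul G (f z) (g z))"
  using continuous_map_compose[OF continuous_map_composable[OF assms] continuous_mul]
  by (simp add: o_def)

lemma continuous_map_ginv:
  "continuous_map Z X f \<Longrightarrow> continuous_map Z X (\<lambda>z. ginv G (f z))"
  using continuous_map_compose[OF _ continuous_ginv] by (simp add: o_def)

lemma continuous_rng: "continuous_map X X (rng G)"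
  by (rule continuous_map_eq[where f = "\<lambda>z. mul G z (ginv G z)"])
    (auto intro!: continuous_map_mul continuous_map_ginv simp: topspace_X mul_ginv rng_ginv)

lemma continuous_src: "continuous_map X X (src G)"
  by (rule continuous_map_eq[where f = "\<lambda>z. mul G (ginv G z) z"])
    (auto intro!: continuous_map_mul continuous_map_ginv simp: topspace_X ginv_mul src_ginv)

lemma continuous_rng_unit_top: "continuous_map X (unit_top G) (rng G)"
  unfolding unit_top_def using continuous_rng
  by (intro continuous_map_into_subtopology) (auto simp: topspace_X rng_mem_units)

lemma openin_arrows: "openin X U \<Longrightarrow> U \<subseteq> arrows G"
  using openin_subset[of X U] by (simp add: topspace_X)

text \<open>Besides the injectivity of both maps, the homeomorphism given by the range is recorded:
  its inverse is the continuous local section with which convolutions are shown to be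
  continuous.\<close>

definition bisection :: "'a set \<Rightarrow> bool" where
  "bisection U \<longleftrightarrow> openin X U \<and> inj_on (rng G) U \<and> inj_on (src G) U \<and>
     openin (unit_top G) (rng G ` U) \<and>
     homeomorphic_map (subtopology X U) (subtopology (unit_top G) (rng G ` U)) (rng G)"

lemma bisection_arrows: "bisection U \<Longrightarrow> U \<subseteq> arrows G"
  by (simp add: bisection_def openin_arrows)

lemma etale_chart_restrict:
  assumes U: "openin X U" "openin (unit_top G) (rng G ` U)"
      "homeomorphic_map (subtopology X U) (subtopology (unit_top G) (rng G ` U)) (rng G)"
    and V: "openin X V" "V \<subseteq> U"
  shows "openin (unit_top G) (rng G ` V)"
    "homeomorphic_map (subtopology X V) (subtopology (unit_top G) (rng G ` V)) (rng G)"
proof -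
  have sub: "U \<subseteq> arrows G" using U openin_arrows by simp
  have "openin (subtopology X U) V" using V U(1)
    by (simp add: openin_open_subtopology)
  then have "openin (subtopology (unit_top G) (rng G ` U)) (rng G ` V)"
    using homeomorphic_imp_open_map[OF U(3)] by (simp add: open_map_def)
  then show op: "openin (unit_top G) (rng G ` V)" using U(2) openin_trans_full by blast
  have "rng G ` U \<subseteq> units G" using sub rng_mem_units by auto
  then have "homeomorphic_map (subtopology (subtopology X U) V)
      (subtopology (subtopology (unit_top G) (rng G ` U)) (rng G ` V)) (rng G)"
    using V sub rng_mem_units
    by (intro homeomorphic_map_subtopologies[OF U(3)]) (auto simp: topspace_X topspace_unit_top)
  moreover have "U \<inter> V = V" "rng G ` U \<inter> rng G ` V = rng G ` V" using V by auto
  ultimately show "homeomorphic_map (subtopology X V) (subtopology (unit_top G) (rng G ` V)) (rng G)"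
    by (simp add: subtopology_subtopology)
qed

text \<open>Etaleness speaks of the range map only. Injectivity of the source comes from a second
  chart, around the inverse of \<open>\<gamma>\<close>, pulled back along
  \<open>ginv\<close>.\<close>

lemma bisection_exists:
  assumes "openin X W" "\<gamma> \<in> W"
  obtains U where "bisection U" "\<gamma> \<in> U" "U \<subseteq> W"
proof -
  have \<gamma>: "\<gamma> \<in> arrows G" using assms openin_arrows by blast
  obtain U1 where U1: "openin X U1" "\<gamma> \<in> U1" "openin (unit_top G) (rng G ` U1)"
      "homeomorphic_map (subtopology X U1) (subtopology (unit_top G) (rng G ` U1)) (rng G)"
    using etale[OF \<gamma>] by blast
  obtain U2 where U2: "openin X U2" "ginv G \<gamma> \<in> U2"
      "homeomorphic_map (subtopology X U2) (subtopology (unit_top G) (rng G ` U2)) (rng G)"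
    using etale[OF ginv_closed[OF \<gamma>]] by blast
  have sub: "U1 \<subseteq> arrows G" "U2 \<subseteq> arrows G" using U1 U2 openin_arrows by simp_all
  have inj: "inj_on (rng G) U1" "inj_on (rng G) U2"
    using homeomorphic_imp_injective_map[OF U1(4)] homeomorphic_imp_injective_map[OF U2(3)] sub
    by (simp_all add: topspace_X inf.absorb2)
  define U where "U = U1 \<inter> W \<inter> {\<eta> \<in> topspace X. ginv G \<eta> \<in> U2}"
  have op: "openin X U" unfolding U_def
    using U1 assms openin_continuous_map_preimage[OF continuous_ginv U2(1)] by auto
  have "inj_on (src G) U"
  proof (rule inj_onI)
    fix a b assume ab: "a \<in> U" "b \<in> U" "src G a = src G b"
    then have "a \<in> arrows G" "b \<in> arrows G" "ginv G a \<in> U2" "ginv G b \<in> U2"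
      by (auto simp: U_def topspace_X)
    note ab' = this
    then have "rng G (ginv G a) = rng G (ginv G b)" using ab(3) by (simp add: rng_ginv)
    with inj(2) ab'(3,4) have "ginv G a = ginv G b" by (simp add: inj_on_eq_iff)
    then have "ginv G (ginv G a) = ginv G (ginv G b)" by (rule arg_cong)
    then show "a = b" by (simp only: ginv_ginv[OF ab'(1)] ginv_ginv[OF ab'(2)])
  qed
  moreover have "inj_on (rng G) U" using inj(1) by (rule inj_on_subset) (auto simp: U_def)
  ultimately have "bisection U"
    using op etale_chart_restrict[OF U1(1,3,4) op] by (auto simp: bisection_def U_def)
  then show thesis by (rule that) (use \<gamma> U1 U2 assms in \<open>auto simp: U_def topspace_X\<close>)
qed

text \<open>A locally compact Hausdorff space is completely regular, so a continuous function
  separates \<open>\<gamma>\<close> from the complement of a neighbourhood \<open>V\<close>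
  contained in a compact \<open>K\<close>. The value 0 outside the space matches the convention of
  \<open>Cc\<close>.\<close>

lemma bump:
  assumes "openin X U" "\<gamma> \<in> U"
  obtains p :: "'a \<Rightarrow> real" and K where "continuous_map X euclideanreal p" "compactin X K" "K \<subseteq> U"
    "\<And>\<eta>. \<eta> \<notin> K \<Longrightarrow> p \<eta> = 0" "\<And>\<eta>. 0 \<le> p \<eta>" "\<And>\<eta>. p \<eta> \<le> 1" "p \<gamma> = 1"
proof -
  have \<gamma>: "\<gamma> \<in> topspace X" using assms openin_subset by blast
  have "neighbourhood_base_of (compactin X) X"
    using Hausdorff locally_compact locally_compact_space_neighbourhood_base by blast
  then obtain V K where VK: "openin X V" "compactin X K" "\<gamma> \<in> V" "V \<subseteq> K" "K \<subseteq> U"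
    using assms unfolding neighbourhood_base_of by meson
  have cr: "completely_regular_space X"
    using completely_regular_eq_regular_space[OF locally_compact]
      locally_compact_Hausdorff_imp_regular_space[OF locally_compact Hausdorff] by blast
  have "compactin X {\<gamma>}" "closedin X (topspace X - V)" "disjnt {\<gamma>} (topspace X - V)"
    using \<gamma> VK(1,3) by (auto simp: disjnt_def)
  from Urysohn_completely_regular_compact_closed[OF zero_le_one cr this]
  obtain f :: "'a \<Rightarrow> real" where f: "continuous_map X (subtopology euclidean {0..1}) f"
      "f ` (topspace X - V) \<subseteq> {0}" "f ` {\<gamma>} \<subseteq> {1}"
    by metis
  have f01: "0 \<le> f \<eta> \<and> f \<eta> \<le> 1" if "\<eta> \<in> topspace X" for \<eta>
    using f(1) that by (auto simp: continuous_map_in_subtopology)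
  define p where "p \<eta> = (if \<eta> \<in> topspace X then f \<eta> else 0)" for \<eta>
  show thesis
  proof (rule that[of p K])
    show "continuous_map X euclideanreal p"
      using f(1) by (rule continuous_map_eq[OF continuous_map_into_fulltopology]) (simp add: p_def)
    show "0 \<le> p \<eta>" "p \<eta> \<le> 1" for \<eta>
      using f01[of \<eta>] by (auto simp: p_def)
    show "p \<gamma> = 1" using f \<gamma> by (simp add: p_def)
    fix \<eta> assume "\<eta> \<notin> K"
    then show "p \<eta> = 0" using f(2) VK by (auto simp: p_def)
  qed (use VK in auto)
qed

end

locale lch_twisted_groupoid = lch_etale_groupoid G + twisted_groupoid G F \<sigma>
  for G :: "'g groupoid" and F \<sigma>
begin

section \<open>The convolution algebra of compactly supported functions\<close>

lemma CcI:
  assumes "continuous_map X euclidean f" "\<And>\<gamma>. f \<gamma> \<in> F" "compactin X K" "\<And>\<gamma>. \<gamma> \<notin> K \<Longrightarrow> f \<gamma> = 0"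
  shows "f \<in> Cc G F"
  using assms by (auto simp: Cc_def)

lemma Cc_cont: "f \<in> Cc G F \<Longrightarrow> continuous_map X euclidean f"
  by (simp add: Cc_def)

lemma Cc_range: "f \<in> Cc G F \<Longrightarrow> range f \<subseteq> F"
  by (simp add: Cc_def)

lemma Cc_compact:
  assumes "f \<in> Cc G F"
  obtains K where "compactin X K" "nonzeros f \<subseteq> K" "K \<subseteq> arrows G"
proof -
  obtain K where "compactin X K" "\<forall>\<gamma>. \<gamma> \<notin> K \<longrightarrow> f \<gamma> = 0" using assms by (auto simp: Cc_def)
  then show thesis using that[of K] compactin_subset_topspace[of X K]
    by (auto simp: nonzeros_def topspace_X)
qed

lemma Cc_nonzeros: "f \<in> Cc G F \<Longrightarrow> nonzeros f \<subseteq> arrows G"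
  using Cc_compact by blast

lemma Cc_zero: "(\<lambda>_. 0) \<in> Cc G F"
  by (rule CcI[of _ "{}"]) (auto simp: scalar_closed)

lemma Cc_add:
  assumes "f \<in> Cc G F" "g \<in> Cc G F"
  shows "(\<lambda>\<gamma>. f \<gamma> + g \<gamma>) \<in> Cc G F"
proof -
  obtain K where K: "compactin X K" "nonzeros f \<subseteq> K" "K \<subseteq> arrows G"
    by (rule Cc_compact[OF assms(1)])
  obtain L where L: "compactin X L" "nonzeros g \<subseteq> L" "L \<subseteq> arrows G"
    by (rule Cc_compact[OF assms(2)])
  have "f \<gamma> + g \<gamma> \<in> F" for \<gamma>
    using Cc_range[OF assms(1)] Cc_range[OF assms(2)] by (intro scalar_closed(3)) auto
  moreover have "f \<gamma> + g \<gamma> = 0" if "\<gamma> \<notin> K \<union> L" for \<gamma>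
    using that K(2) L(2) by (force simp: nonzeros_def)
  ultimately show ?thesis
    by (rule CcI[OF continuous_map_add[OF assms[THEN Cc_cont]] _ compactin_Un[OF K(1) L(1)]])
qed

lemma Cc_mult:
  assumes f: "f \<in> Cc G F" and h: "continuous_map X euclidean h" "range h \<subseteq> F"
  shows "(\<lambda>\<gamma>. h \<gamma> * f \<gamma>) \<in> Cc G F"
proof -
  obtain K where K: "compactin X K" "nonzeros f \<subseteq> K" "K \<subseteq> arrows G"
    by (rule Cc_compact[OF f])
  have "h \<gamma> * f \<gamma> \<in> F" for \<gamma>
    using Cc_range[OF f] h(2) by (intro scalar_closed(5)) auto
  moreover have "h \<gamma> * f \<gamma> = 0" if "\<gamma> \<notin> K" for \<gamma>
    using that K by (auto simp: nonzeros_def)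
  ultimately show ?thesis
    by (rule CcI[OF continuous_map_mult_algebra[OF h(1) Cc_cont[OF f]] _ K(1)])
qed

lemma Cc_scale:
  assumes "f \<in> Cc G F" "a \<in> F"
  shows "(\<lambda>\<gamma>. a * f \<gamma>) \<in> Cc G F"
  using Cc_mult[OF assms(1), of "\<lambda>_. a"] assms(2) by auto

lemma Cc_diff:
  assumes "f \<in> Cc G F" "g \<in> Cc G F"
  shows "(\<lambda>\<gamma>. f \<gamma> - g \<gamma>) \<in> Cc G F"
proof -
  have "-1 \<in> F" using scalar_closed(4)[OF scalar_closed(1,2)] by simp
  from Cc_add[OF assms(1) Cc_scale[OF assms(2) this]] show ?thesis by simp
qed

lemma Cc_bounded:
  assumes "f \<in> Cc G F"
  obtains B where "B \<ge> 0" "\<And>\<gamma>. cmod (f \<gamma>) \<le> B"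
proof -
  obtain K where K: "compactin X K" "nonzeros f \<subseteq> K" "K \<subseteq> arrows G"
    by (rule Cc_compact[OF assms])
  have "compact (f ` K)" using image_compactin[OF K(1) Cc_cont[OF assms]] by simp
  then have "bounded (f ` K)" by (rule compact_imp_bounded)
  then obtain B where B: "\<forall>z\<in>f ` K. cmod z \<le> B" unfolding bounded_iff by blast
  have "cmod (f \<gamma>) \<le> max B 0" for \<gamma>
    using B K(2) by (cases "\<gamma> \<in> K") (auto simp: nonzeros_def le_max_iff_disj)
  then show thesis using that[of "max B 0"] by simp
qed

lemma Cc_invol:
  assumes "f \<in> Cc G F"
  shows "invol G f \<in> Cc G F"
proof -
  obtain K where K: "compactin X K" "nonzeros f \<subseteq> K" "K \<subseteq> arrows G" using Cc_compact[OF assms] by blast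
  have "continuous_map X euclidean (\<lambda>\<gamma>. cnj (f (ginv G \<gamma>)))"
    using continuous_map_compose[OF continuous_ginv Cc_cont[OF assms]]
    by (intro continuous_map_cnj) (simp add: o_def)
  then have "continuous_map X euclidean (invol G f)"
    by (rule continuous_map_eq) (simp add: invol_def topspace_X)
  then show ?thesis
  proof (rule CcI)
    show "compactin X (ginv G ` K)" by (rule image_compactin[OF K(1) continuous_ginv])
    show "invol G f \<gamma> \<in> F" for \<gamma>
      using Cc_range[OF assms] scalar_closed(1,6) by (auto simp: invol_def)
    fix \<gamma> assume "\<gamma> \<notin> ginv G ` K"
    then have "ginv G \<gamma> \<notin> K" if "\<gamma> \<in> arrows G" using ginv_ginv[OF that] by (metis imageI)
    then show "invol G f \<gamma> = 0" using K(2) by (auto simp: invol_def nonzeros_def)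
  qed
qed

text \<open>A partition of unity subordinate to a finite cover of the support by bisections.\<close>

lemma Cc_induct [consumes 1, case_names bisection zero add]:
  assumes f: "f \<in> Cc G F"
    and bis: "\<And>f U K. f \<in> Cc G F \<Longrightarrow> bisection U \<Longrightarrow> compactin X K \<Longrightarrow> K \<subseteq> U \<Longrightarrow> nonzeros f \<subseteq> K \<Longrightarrow> P f"
    and zero: "P (\<lambda>_. 0)"
    and add: "\<And>f g. f \<in> Cc G F \<Longrightarrow> g \<in> Cc G F \<Longrightarrow> P f \<Longrightarrow> P g \<Longrightarrow> P (\<lambda>\<gamma>. f \<gamma> + g \<gamma>)"
  shows "P f"
proof -
  obtain K where K: "compactin X K" "nonzeros f \<subseteq> K" "K \<subseteq> arrows G" using Cc_compact[OF f] by blast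
  have "\<exists>U p L. bisection U \<and> continuous_map X euclideanreal p \<and> compactin X L \<and> L \<subseteq> U \<and>
      (\<forall>\<eta>. \<eta> \<notin> L \<longrightarrow> p \<eta> = 0) \<and> (\<forall>\<eta>. 0 \<le> p \<eta>) \<and> p \<gamma> = (1::real)" if "\<gamma> \<in> K" for \<gamma>
  proof -
    have "\<gamma> \<in> topspace X" using that K by (auto simp: topspace_X)
    then obtain U where U: "bisection U" "\<gamma> \<in> U" "U \<subseteq> topspace X"
      by (rule bisection_exists[OF openin_topspace])
    then obtain p :: "'g \<Rightarrow> real" and L where "continuous_map X euclideanreal p" "compactin X L" "L \<subseteq> U"
        "\<And>\<eta>. \<eta> \<notin> L \<Longrightarrow> p \<eta> = 0" "\<And>\<eta>. 0 \<le> p \<eta>" "\<And>\<eta>. p \<eta> \<le> 1" "p \<gamma> = 1"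
      using bump[of U \<gamma>] by (auto simp: bisection_def)
    with U show ?thesis by blast
  qed
  then obtain U p L where pU: "\<And>\<gamma>. \<gamma> \<in> K \<Longrightarrow> bisection (U \<gamma>) \<and> continuous_map X euclideanreal (p \<gamma>) \<and>
      compactin X (L \<gamma>) \<and> L \<gamma> \<subseteq> U \<gamma> \<and> (\<forall>\<eta>. \<eta> \<notin> L \<gamma> \<longrightarrow> p \<gamma> \<eta> = 0) \<and> (\<forall>\<eta>. 0 \<le> p \<gamma> \<eta>) \<and> p \<gamma> \<gamma> = (1::real)"
    by metis
  define O' where "O' \<gamma> = {\<eta> \<in> topspace X. p \<gamma> \<eta> \<in> {0<..}}" for \<gamma>
  have O': "openin X (O' \<gamma>)" "\<gamma> \<in> O' \<gamma>" if "\<gamma> \<in> K" for \<gamma>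
    using pU[OF that] K that openin_continuous_map_preimage[of X euclideanreal "p \<gamma>" "{0<..}"]
    by (auto simp: O'_def topspace_X)
  then have "\<exists>\<F>. finite \<F> \<and> \<F> \<subseteq> O' ` K \<and> K \<subseteq> \<Union>\<F>"
    by (intro compactinD[OF K(1)]) auto
  then obtain D where D: "finite D" "D \<subseteq> K" "K \<subseteq> (\<Union>d\<in>D. O' d)"
    by (metis finite_subset_image)
  define \<Phi> where "\<Phi> \<eta> = (\<Sum>d\<in>D. p d \<eta>)" for \<eta>
  have \<Phi>_cont: "continuous_map X euclideanreal \<Phi>"
    unfolding \<Phi>_def using D pU by (intro continuous_map_sum) auto
  have \<Phi>_pos: "\<Phi> \<eta> > 0" if "\<eta> \<in> K" for \<eta>
  proof -
    obtain d where "d \<in> D" "p d \<eta> > 0" using D(3) \<open>\<eta> \<in> K\<close> by (auto simp: O'_def)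
    then show ?thesis unfolding \<Phi>_def using D pU by (intro sum_pos2[of D d]) auto
  qed
  define k where "k d \<eta> = of_real (p d \<eta> / \<Phi> \<eta>) * f \<eta>" for d \<eta>
  have k_mem: "k d \<in> Cc G F" and k_supp: "nonzeros (k d) \<subseteq> L d" if "d \<in> D" for d
  proof -
    have dK: "d \<in> K" using that D by auto
    \<comment> \<open>Division by \<open>\<Phi>\<close> is continuous where \<open>\<Phi>\<close> is
      positive, an open set containing \<open>K\<close>; off \<open>K\<close> the function is zero.
      These two open sets cover the space, so the pieces can be glued.\<close>
    let ?A = "{\<eta> \<in> topspace X. \<Phi> \<eta> \<in> {0<..}}"
    have A: "openin X ?A" by (rule openin_continuous_map_preimage[OF \<Phi>_cont]) auto
    have cA: "continuous_map (subtopology X ?A) euclidean (k d)"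
      unfolding k_def
      by (intro continuous_map_mult_algebra continuous_map_of_real continuous_map_real_divide
          continuous_map_from_subtopology \<Phi>_cont Cc_cont[OF f]) (use pU[OF dK] in auto)
    have B: "openin X (topspace X - K)"
      using compactin_imp_closedin[OF Hausdorff K(1)] by auto
    have "continuous_map X euclidean (k d)"
    proof (rule continuous_map_glue[OF A cA refl B])
      show "continuous_map (subtopology X (topspace X - K)) euclidean (\<lambda>_. 0 :: complex)" by simp
    qed (use K(2) in \<open>auto simp: k_def nonzeros_def intro: \<Phi>_pos\<close>)
    then show "k d \<in> Cc G F"
    proof (rule CcI[OF _ _ K(1)])
      show "k d \<eta> \<in> F" for \<eta>
        unfolding k_def using Cc_range[OF f] by (intro scalar_closed(5,7)) auto
    qed (use K(2) in \<open>auto simp: k_def nonzeros_def\<close>)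
    show "nonzeros (k d) \<subseteq> L d" using pU[OF dK] by (auto simp: nonzeros_def k_def)
  qed
  have "(\<lambda>\<eta>. \<Sum>d\<in>D'. k d \<eta>) \<in> Cc G F \<and> P (\<lambda>\<eta>. \<Sum>d\<in>D'. k d \<eta>)" if "D' \<subseteq> D" for D'
  proof -
    have "finite D'" using that D finite_subset by blast
    then show ?thesis using that
    proof (induction D')
      case empty
      show ?case using zero Cc_zero by simp
    next
      case (insert d D')
      then have "d \<in> D" by simp
      have "P (k d)"
        using pU[of d] D \<open>d \<in> D\<close> by (intro bis[OF k_mem _ _ _ k_supp, of d "U d"]) auto
      with insert add[OF k_mem[OF \<open>d \<in> D\<close>]] Cc_add[OF k_mem[OF \<open>d \<in> D\<close>]] show ?case by simp
    qed
  qed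
  moreover have "(\<lambda>\<eta>. \<Sum>d\<in>D. k d \<eta>) = f"
  proof
    fix \<eta>
    have "(\<Sum>d\<in>D. k d \<eta>) = of_real (\<Phi> \<eta> / \<Phi> \<eta>) * f \<eta>"
      by (simp only: k_def sum_distrib_right[symmetric] of_real_sum[symmetric] sum_divide_distrib[symmetric] \<Phi>_def)
    also have "\<dots> = f \<eta>" using \<Phi>_pos[of \<eta>] K(2) by (cases "\<eta> \<in> K") (auto simp: nonzeros_def)
    finally show "(\<Sum>d\<in>D. k d \<eta>) = f \<eta>" .
  qed
  ultimately show ?thesis using order.refl[of D] by metis
qed

text \<open>A bisection meets every source fibre in at most one point.\<close>

lemma fibre_finite_Cc:
  assumes "f \<in> Cc G F"
  shows "fibre_finite f"
  using assms
proof (induction f rule: Cc_induct)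
  case (bisection f U K)
  have "finite (fibre x \<inter> nonzeros f)" for x
  proof -
    have "inj_on (src G) U" using bisection by (simp add: bisection_def)
    then have "inj_on (src G) (fibre x \<inter> nonzeros f)"
      by (rule inj_on_subset) (use bisection in auto)
    moreover have "finite (src G ` (fibre x \<inter> nonzeros f))"
      by (rule finite_subset[of _ "{x}"]) (auto simp: fibre_def)
    ultimately show ?thesis using finite_imageD by blast
  qed
  then show ?case using Cc_nonzeros[OF bisection(1)] by (simp add: fibre_finite_def)
next
  case zero
  show ?case by (simp add: fibre_finite_def nonzeros_def)
qed (rule fibre_finite_add)

lemma fibre_finite_invol: "f \<in> Cc G F \<Longrightarrow> fibre_finite (invol G f)"
  by (intro fibre_finite_Cc Cc_invol)

text \<open>At most one \<open>\<xi>\<close> in \<open>U\<close> has the same range as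
  \<open>\<gamma>\<close>, and the second factor is then forced to be the inverse of
  \<open>\<xi>\<close> times \<open>\<gamma>\<close>: the convolution sum has a single term.\<close>

lemma conv_bisection:
  assumes U: "inj_on (rng G) U" "U \<subseteq> arrows G" "nonzeros f \<subseteq> U"
  shows "\<xi> \<in> U \<Longrightarrow> rng G \<xi> = rng G \<gamma> \<Longrightarrow> \<gamma> \<in> arrows G \<Longrightarrow>
      conv G \<sigma> f g \<gamma> = f \<xi> * g (mul G (ginv G \<xi>) \<gamma>) * \<sigma> \<xi> (mul G (ginv G \<xi>) \<gamma>)"
    and "rng G \<gamma> \<notin> rng G ` nonzeros f \<Longrightarrow> conv G \<sigma> f g \<gamma> = 0"
proof -
  let ?P = "{(\<xi>, \<eta>) \<in> composable G. mul G \<xi> \<eta> = \<gamma>}"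
  {
    assume \<xi>: "\<xi> \<in> U" "rng G \<xi> = rng G \<gamma>" "\<gamma> \<in> arrows G"
    let ?\<eta> = "mul G (ginv G \<xi>) \<gamma>"
    have \<xi>': "\<xi> \<in> arrows G" using U \<xi> by auto
    have c: "(ginv G \<xi>, \<gamma>) \<in> composable G" using \<xi> \<xi>' by (simp add: composable_iff ginv_closed src_ginv)
    have c2: "(\<xi>, ?\<eta>) \<in> composable G" using \<xi>' c by (simp add: composable_iff[of \<xi>] mul_closed rng_mul rng_ginv)
    have "mul G \<xi> ?\<eta> = mul G (mul G \<xi> (ginv G \<xi>)) \<gamma>"
      using c \<xi>' by (intro mul_assoc[symmetric]) (auto simp: composable_iff rng_ginv)
    then have m: "mul G \<xi> ?\<eta> = \<gamma>" using \<xi> \<xi>' by (simp add: mul_ginv rng_mul_self)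
    have "conv G \<sigma> f g \<gamma> = infsum (\<lambda>(\<xi>, \<eta>). f \<xi> * g \<eta> * \<sigma> \<xi> \<eta>) {(\<xi>, ?\<eta>)}"
      unfolding conv_def
    proof (rule infsum_cong_neutral)
      fix p assume p: "p \<in> ?P - {(\<xi>, ?\<eta>)}"
      obtain a b where ab: "p = (a, b)" "(a, b) \<in> composable G" "mul G a b = \<gamma>" using p by auto
      have "f a = 0"
      proof (rule ccontr)
        assume "f a \<noteq> 0"
        then have "a \<in> U" using U by (auto simp: nonzeros_def)
        then have "a = \<xi>" using inj_onD[OF U(1), of a \<xi>] rng_mul[OF ab(2)] ab(3) \<xi> by auto
        have ab': "a \<in> arrows G" "b \<in> arrows G" "src G a = rng G b" using ab(2) by (auto simp: composable_iff)
        have "?\<eta> = mul G (mul G (ginv G a) a) b"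
          using ab ab' \<open>a = \<xi>\<close> by (subst mul_assoc) (auto simp: composable_iff ginv_closed src_ginv)
        then have "?\<eta> = b" using ab' by (simp add: ginv_mul rng_mul_self)
        with \<open>a = \<xi>\<close> ab p show False by simp
      qed
      then show "(case p of (\<xi>, \<eta>) \<Rightarrow> f \<xi> * g \<eta> * \<sigma> \<xi> \<eta>) = 0" using ab by simp
    qed (use c2 m in auto)
    then show "conv G \<sigma> f g \<gamma> = f \<xi> * g ?\<eta> * \<sigma> \<xi> ?\<eta>" by simp
  }
  assume no: "rng G \<gamma> \<notin> rng G ` nonzeros f"
  show "conv G \<sigma> f g \<gamma> = 0"
  proof (rule ccontr)
    assume "conv G \<sigma> f g \<gamma> \<noteq> 0"
    then have "\<gamma> \<in> nonzeros (conv G \<sigma> f g)" by (simp add: nonzeros_def)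
    then obtain a b where "a \<in> nonzeros f" "(a, b) \<in> composable G" "mul G a b = \<gamma>"
      by (rule nonzeros_conv)
    with no rng_mul[of a b] show False by auto
  qed
qed

text \<open>The support lies in the image under multiplication of the composable pairs in
  \<open>K \<times> L\<close>. These form a compact set, because composability is a closed condition
  when the topology is Hausdorff.\<close>

lemma Cc_conv_compact:
  assumes "f \<in> Cc G F" "g \<in> Cc G F"
  obtains K where "compactin X K" "nonzeros (conv G \<sigma> f g) \<subseteq> K"
proof -
  obtain K where K: "compactin X K" "nonzeros f \<subseteq> K" "K \<subseteq> arrows G" using Cc_compact[OF assms(1)] by blast
  obtain L where L: "compactin X L" "nonzeros g \<subseteq> L" "L \<subseteq> arrows G" using Cc_compact[OF assms(2)] by blast
  let ?PT = "prod_topology X X"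
  have cl: "closedin ?PT (composable G)"
  proof -
    have "closedin ?PT {p \<in> topspace ?PT. (src G \<circ> fst) p = (rng G \<circ> snd) p}"
      by (intro closedin_continuous_maps_eq[OF Hausdorff] continuous_map_compose[OF continuous_map_fst continuous_src]
          continuous_map_compose[OF continuous_map_snd continuous_rng])
    moreover have "{p \<in> topspace ?PT. (src G \<circ> fst) p = (rng G \<circ> snd) p} = composable G"
      by (auto simp: composable_def topspace_X)
    ultimately show ?thesis by simp
  qed
  have "compactin ?PT (K \<times> L)" using K L by (simp add: compactin_Times)
  then have "compactin ?PT ((K \<times> L) \<inter> composable G)"
    using closed_Int_compactin[OF cl] by (subst Int_commute)
  then have "compactin (composable_top G) ((K \<times> L) \<inter> composable G)"
    by (simp add: composable_top_def compactin_subtopology)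
  then have "compactin X ((\<lambda>(\<xi>, \<eta>). mul G \<xi> \<eta>) ` ((K \<times> L) \<inter> composable G))"
    by (rule image_compactin[OF _ continuous_mul])
  moreover have "nonzeros (conv G \<sigma> f g) \<subseteq> (\<lambda>(\<xi>, \<eta>). mul G \<xi> \<eta>) ` ((K \<times> L) \<inter> composable G)"
  proof
    fix \<gamma> assume "\<gamma> \<in> nonzeros (conv G \<sigma> f g)"
    then obtain a b where "a \<in> nonzeros f" "b \<in> nonzeros g" "(a, b) \<in> composable G" "mul G a b = \<gamma>"
      by (rule nonzeros_conv)
    with K L show "\<gamma> \<in> (\<lambda>(\<xi>, \<eta>). mul G \<xi> \<eta>) ` ((K \<times> L) \<inter> composable G)"
      by (intro image_eqI[of _ _ "(a, b)"]) auto
  qed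
  ultimately show thesis by (rule that)
qed

text \<open>By additivity \<open>f\<close> may be supported on a bisection. There the convolution is
  a single product with first argument \<open>\<rho> (rng G \<gamma>)\<close>, where
  \<open>\<rho>\<close> is the continuous inverse of the range map; it vanishes on the open set
  where the range avoids the image of \<open>K\<close>.\<close>

lemma Cc_conv:
  assumes f: "f \<in> Cc G F" and g: "g \<in> Cc G F"
  shows "conv G \<sigma> f g \<in> Cc G F"
proof -
  have "continuous_map X euclidean (conv G \<sigma> f g)"
    using f
  proof (induction f rule: Cc_induct)
    case (bisection f U K)
    note U = bisection(2)
    have inj: "inj_on (rng G) U" "U \<subseteq> arrows G" "nonzeros f \<subseteq> U"
      using U bisection bisection_arrows by (auto simp: bisection_def)
    let ?R = "rng G ` U"
    obtain \<rho> where \<rho>: "homeomorphic_maps (subtopology X U) (subtopology (unit_top G) ?R) (rng G) \<rho>"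
      using U by (auto simp: bisection_def homeomorphic_map_maps)
    have Rsub: "?R \<subseteq> units G" using inj rng_mem_units by auto
    have \<rho>_cont: "continuous_map (subtopology (unit_top G) ?R) (subtopology X U) \<rho>"
      and \<rho>_inv: "\<And>y. y \<in> ?R \<Longrightarrow> rng G (\<rho> y) = y"
      using \<rho> Rsub by (auto simp: homeomorphic_maps_def topspace_unit_top)
    let ?A = "{\<gamma> \<in> topspace X. rng G \<gamma> \<in> ?R}"
    have A: "openin X ?A"
      using U by (intro openin_continuous_map_preimage[OF continuous_rng_unit_top]) (auto simp: bisection_def)
    let ?Z = "subtopology X ?A"
    have "continuous_map ?Z (subtopology (unit_top G) ?R) (rng G)"
      using continuous_rng_unit_top
      by (intro continuous_map_into_subtopology continuous_map_from_subtopology) auto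
    from continuous_map_compose[OF this \<rho>_cont]
    have \<xi>U: "continuous_map ?Z (subtopology X U) (\<lambda>\<gamma>. \<rho> (rng G \<gamma>))" by (simp add: o_def)
    then have \<xi>: "continuous_map ?Z X (\<lambda>\<gamma>. \<rho> (rng G \<gamma>))" by (rule continuous_map_into_fulltopology)
    have \<xi>_mem: "\<rho> (rng G \<gamma>) \<in> U" if "\<gamma> \<in> ?A" for \<gamma>
      using continuous_map_image_subset_topspace[OF \<xi>U] that by auto
    have id: "continuous_map ?Z X (\<lambda>\<gamma>. \<gamma>)"
      by (rule continuous_map_from_subtopology) simp
    have \<xi>_arrows: "\<rho> (rng G \<gamma>) \<in> arrows G" if "\<gamma> \<in> ?A" for \<gamma> using \<xi>_mem[OF that] inj by auto
    let ?\<eta> = "\<lambda>\<gamma>. mul G (ginv G (\<rho> (rng G \<gamma>))) \<gamma>"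
    have comp: "src G (ginv G (\<rho> (rng G \<gamma>))) = rng G \<gamma>" if "\<gamma> \<in> ?A" for \<gamma>
      using that \<xi>_arrows[OF that] \<rho>_inv by (simp add: src_ginv)
    have \<eta>: "continuous_map ?Z X ?\<eta>"
      using comp by (intro continuous_map_mul continuous_map_ginv \<xi> id) auto
    have \<eta>_rng: "rng G (?\<eta> \<gamma>) = src G (\<rho> (rng G \<gamma>))" if "\<gamma> \<in> ?A" for \<gamma>
      using that comp[OF that] \<xi>_arrows[OF that]
      by (subst rng_mul) (auto simp: composable_iff ginv_closed topspace_X rng_ginv)
    have "continuous_map ?Z (composable_top G) (\<lambda>\<gamma>. (\<rho> (rng G \<gamma>), ?\<eta> \<gamma>))"
      using \<eta>_rng by (intro continuous_map_composable \<xi> \<eta>) auto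
    from continuous_map_compose[OF this, of euclidean "\<lambda>(\<xi>, \<eta>). \<sigma> \<xi> \<eta>"]
    have sig: "continuous_map ?Z euclidean (\<lambda>\<gamma>. \<sigma> (\<rho> (rng G \<gamma>)) (?\<eta> \<gamma>))"
      using cocycle by (simp add: o_def normalised_two_cocycle_def two_cocycle_def)
    have contA: "continuous_map ?Z euclidean (\<lambda>\<gamma>. f (\<rho> (rng G \<gamma>)) * g (?\<eta> \<gamma>) * \<sigma> (\<rho> (rng G \<gamma>)) (?\<eta> \<gamma>))"
      using continuous_map_compose[OF \<xi> Cc_cont[OF bisection(1)]] continuous_map_compose[OF \<eta> Cc_cont[OF g]] sig
      by (intro continuous_map_mult_algebra) (simp_all add: o_def)
    have "compactin X (rng G ` K)" by (rule image_compactin[OF bisection(3) continuous_rng])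
    then have B: "openin X {\<gamma> \<in> topspace X. rng G \<gamma> \<in> topspace X - rng G ` K}"
      by (intro openin_continuous_map_preimage[OF continuous_rng] openin_diff compactin_imp_closedin Hausdorff) auto
    show ?case
    proof (rule continuous_map_glue[OF A contA _ B])
      show "continuous_map (subtopology X {\<gamma> \<in> topspace X. rng G \<gamma> \<in> topspace X - rng G ` K})
        euclidean (\<lambda>_. 0 :: complex)" by simp
    next
      fix \<gamma> assume \<gamma>: "\<gamma> \<in> ?A"
      show "conv G \<sigma> f g \<gamma> = f (\<rho> (rng G \<gamma>)) * g (?\<eta> \<gamma>) * \<sigma> (\<rho> (rng G \<gamma>)) (?\<eta> \<gamma>)"
        using \<gamma> \<rho>_inv by (intro conv_bisection(1)[OF inj \<xi>_mem[OF \<gamma>]]) (auto simp: topspace_X)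
    next
      fix \<gamma> assume "\<gamma> \<in> {\<gamma> \<in> topspace X. rng G \<gamma> \<in> topspace X - rng G ` K}"
      then show "conv G \<sigma> f g \<gamma> = 0"
        using bisection(5) by (intro conv_bisection(2)[OF inj]) auto
    next
      show "topspace X \<subseteq> ?A \<union> {\<gamma> \<in> topspace X. rng G \<gamma> \<in> topspace X - rng G ` K}"
        using bisection(4) rng_closed by (auto simp: topspace_X)
    qed
  next
    case zero
    show ?case by (simp add: conv_zero_left)
  next
    case (add f f')
    then show ?case by (simp add: conv_add_left[OF fibre_finite_Cc[OF g]] continuous_map_add)
  qed
  moreover obtain K where "compactin X K" "nonzeros (conv G \<sigma> f g) \<subseteq> K"
    using Cc_conv_compact[OF f g] by blast
  ultimately show ?thesis
    using range_conv[OF Cc_range[OF f] Cc_range[OF g] fibre_finite_Cc[OF g]]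
    by (intro CcI[of _ K]) (auto simp: nonzeros_def)
qed

end


section \<open>Operator norms on the fibres\<close>

context twisted_groupoid
begin

lemma bndD: "bnd A f C \<Longrightarrow> v \<in> fs A x \<Longrightarrow> l2norm (conv G \<sigma> f v) \<le> C * l2norm v"
  by (auto simp: bnd_def)

lemma bnd_zero: "C \<ge> 0 \<Longrightarrow> bnd A (\<lambda>_. 0) C"
  by (simp add: bnd_def conv_zero_left)

lemma bnd_add:
  assumes "bnd A f C" "bnd A g D" "fibre_finite f" "fibre_finite g"
  shows "bnd A (\<lambda>\<gamma>. f \<gamma> + g \<gamma>) (C + D)"
  unfolding bnd_def
proof (intro allI ballI)
  fix x v assume v: "v \<in> fs A x"
  have "l2norm (conv G \<sigma> (\<lambda>\<gamma>. f \<gamma> + g \<gamma>) v) \<le> l2norm (conv G \<sigma> f v) + l2norm (conv G \<sigma> g v)"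
    unfolding conv_add_left[OF fsD(5)[OF v]]
    by (rule l2norm_add[OF finite_nonzeros_conv[OF assms(3) v] finite_nonzeros_conv[OF assms(4) v]])
  also have "\<dots> \<le> C * l2norm v + D * l2norm v"
    by (intro add_mono bndD[OF assms(1) v] bndD[OF assms(2) v])
  finally show "l2norm (conv G \<sigma> (\<lambda>\<gamma>. f \<gamma> + g \<gamma>) v) \<le> (C + D) * l2norm v"
    by (simp add: algebra_simps)
qed

lemma bnd_diff:
  assumes "bnd A f C" "bnd A g D" "fibre_finite f" "fibre_finite g"
  shows "bnd A (\<lambda>\<gamma>. f \<gamma> - g \<gamma>) (C + D)"
  unfolding bnd_def
proof (intro allI ballI)
  fix x v assume v: "v \<in> fs A x"
  have "l2norm (conv G \<sigma> (\<lambda>\<gamma>. f \<gamma> - g \<gamma>) v) \<le> l2norm (conv G \<sigma> f v) + l2norm (conv G \<sigma> g v)"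
    unfolding conv_diff_left[OF fsD(5)[OF v]]
    by (rule l2norm_diff[OF finite_nonzeros_conv[OF assms(3) v] finite_nonzeros_conv[OF assms(4) v]])
  also have "\<dots> \<le> C * l2norm v + D * l2norm v"
    by (intro add_mono bndD[OF assms(1) v] bndD[OF assms(2) v])
  finally show "l2norm (conv G \<sigma> (\<lambda>\<gamma>. f \<gamma> - g \<gamma>) v) \<le> (C + D) * l2norm v"
    by (simp add: algebra_simps)
qed

text \<open>On each fibre the matrix of \<open>f\<close> has at most one nonzero entry in each row,
  since the range is injective on \<open>U\<close>, and in each column, since the source is. The
  norm of such a weighted partial permutation is at most any bound for the weights.\<close>

lemma bnd_bisection:
  assumes U: "inj_on (rng G) U" "inj_on (src G) U" and f: "nonzeros f \<subseteq> U" "U \<subseteq> arrows G"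
    and B: "\<And>\<gamma>. cmod (f \<gamma>) \<le> B"
  shows "bnd A f B"
  unfolding bnd_def
proof (intro allI ballI)
  fix x v assume v: "v \<in> fs A x"
  note v' = fsD[OF v]
  let ?w = "conv G \<sigma> f v"
  have B0: "B \<ge> 0" using B[of undefined] norm_ge_zero order.trans by blast
  have "\<forall>\<gamma>\<in>nonzeros ?w. \<exists>\<eta>. \<eta> \<in> nonzeros v \<and> quo \<gamma> \<eta> \<in> U \<and> \<gamma> \<in> fibre x"
  proof
    fix \<gamma> assume g: "\<gamma> \<in> nonzeros ?w"
    then have "\<gamma> \<in> fibre x" using conv_supp_fibre[OF v] by auto
    with nonzeros_conv_subset[OF this g] f show "\<exists>\<eta>. \<eta> \<in> nonzeros v \<and> quo \<gamma> \<eta> \<in> U \<and> \<gamma> \<in> fibre x"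
      by (auto simp: nonzeros_def)
  qed
  then obtain h where h: "\<And>\<gamma>. \<gamma> \<in> nonzeros ?w \<Longrightarrow> h \<gamma> \<in> nonzeros v \<and> quo \<gamma> (h \<gamma>) \<in> U \<and> \<gamma> \<in> fibre x"
    by metis
  have hx: "h \<gamma> \<in> fibre x" if "\<gamma> \<in> nonzeros ?w" for \<gamma>
    using h[OF that] v' by auto
  have val: "cmod (?w \<gamma>) \<le> B * cmod (v (h \<gamma>))" if g: "\<gamma> \<in> nonzeros ?w" for \<gamma>
  proof -
    have \<gamma>: "\<gamma> \<in> fibre x" using h[OF g] by simp
    have "?w \<gamma> = (\<Sum>\<eta>\<in>{h \<gamma>}. mat f \<gamma> \<eta> * v \<eta>)"
    proof (rule conv_eq[OF \<gamma>])
      fix \<eta> assume \<eta>: "\<eta> \<in> fibre x" "\<eta> \<notin> {h \<gamma>}"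
      have "f (quo \<gamma> \<eta>) = 0"
      proof (rule ccontr)
        assume "f (quo \<gamma> \<eta>) \<noteq> 0"
        then have "quo \<gamma> \<eta> \<in> U" using f by (auto simp: nonzeros_def)
        moreover have "rng G (quo \<gamma> \<eta>) = rng G (quo \<gamma> (h \<gamma>))"
          using \<gamma> \<eta> hx[OF g] by (auto simp: fibre_def rng_quo)
        ultimately have "quo \<gamma> \<eta> = quo \<gamma> (h \<gamma>)" using h[OF g] U(1) by (simp add: inj_on_eq_iff)
        then show False using inj_quo2[OF \<gamma>] \<eta> hx[OF g] by (auto simp: inj_on_eq_iff)
      qed
      then show "f (quo \<gamma> \<eta>) * v \<eta> = 0" by simp
    qed (use hx[OF g] in auto)
    then have "cmod (?w \<gamma>) = cmod (f (quo \<gamma> (h \<gamma>))) * cmod (v (h \<gamma>))"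
      by (simp add: norm_mult norm_mat[OF \<gamma> hx[OF g]])
    then show ?thesis using B by (simp add: mult_right_mono)
  qed
  have inj: "inj_on h (nonzeros ?w)"
  proof (rule inj_onI)
    fix a b assume ab: "a \<in> nonzeros ?w" "b \<in> nonzeros ?w" "h a = h b"
    have "src G (quo a (h a)) = src G (quo b (h a))"
      using h[OF ab(1)] h[OF ab(2)] hx[OF ab(1)] by (auto simp: fibre_def src_quo)
    then have "quo a (h a) = quo b (h a)"
      using h[OF ab(1)] h[OF ab(2)] U(2) ab(3) by (simp add: inj_on_eq_iff)
    then have "quo a (h a) = quo b (h a)" using ab(3) by simp
    then show "a = b" using inj_on_eq_iff[OF inj_quo[OF hx[OF ab(1)]], of a b] h[OF ab(1)] h[OF ab(2)] by simp
  qed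
  have fin: "finite (nonzeros ?w)"
    using finite_imageD[OF finite_subset[OF _ v'(1)] inj] h by auto
  have "(l2norm ?w)\<^sup>2 = (\<Sum>\<gamma>\<in>nonzeros ?w. (cmod (?w \<gamma>))\<^sup>2)" by (rule l2norm_power2[OF fin]) simp
  also have "\<dots> \<le> (\<Sum>\<gamma>\<in>nonzeros ?w. (B * cmod (v (h \<gamma>)))\<^sup>2)"
    by (intro sum_mono power_mono val) auto
  also have "\<dots> = (\<Sum>\<eta>\<in>h ` nonzeros ?w. (B * cmod (v \<eta>))\<^sup>2)"
    by (simp add: sum.reindex[OF inj])
  also have "\<dots> \<le> (\<Sum>\<eta>\<in>nonzeros v. (B * cmod (v \<eta>))\<^sup>2)"
    using h v' by (intro sum_mono2) auto
  also have "\<dots> = (B * l2norm v)\<^sup>2"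
    by (simp add: power_mult_distrib l2norm_power2[OF v'(1) order.refl] sum_distrib_left)
  finally show "l2norm ?w \<le> B * l2norm v"
    by (rule power2_le_imp_le) (simp add: B0)
qed

text \<open>The usual duality: the square of the norm of \<open>?w\<close> is the inner product of
  \<open>v\<close> with \<open>f\<close> applied to \<open>?w\<close>, hence at most
  \<open>C\<close> times the norms of \<open>v\<close> and \<open>?w\<close>. Here \<open>f\<close>
  acts on \<open>?w\<close>, whose support is arbitrary, so the bound for \<open>f\<close> has to
  hold on all arrows.\<close>

lemma bnd_invol:
  assumes f: "bnd (arrows G) f C" "fibre_finite f" "fibre_finite (invol G f)" "range f \<subseteq> F"
  shows "bnd (arrows G) (invol G f) C"
  unfolding bnd_def
proof (intro allI ballI)
  fix x v assume v: "v \<in> fs (arrows G) x"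
  let ?w = "conv G \<sigma> (invol G f) v"
  have rf: "range (invol G f) \<subseteq> F" using f(4) scalar_closed(1,6) by (auto simp: invol_def)
  have w: "?w \<in> fs (arrows G) x" by (rule conv_fs[OF f(3) rf v])
  have fw: "conv G \<sigma> f ?w \<in> fs (arrows G) x" by (rule conv_fs[OF f(2,4) w])
  have ii: "invol G (invol G f) = f" using f(2) by (simp add: invol_invol fibre_finite_def)
  have "(l2norm ?w)\<^sup>2 = cmod (ip ?w ?w)" by (simp add: ip_self[OF fsD(1)[OF w]] norm_power)
  also have "ip ?w ?w = ip v (conv G \<sigma> f ?w)"
    using ip_conv[OF f(3) _ v w] f(2) by (simp add: ii)
  also have "cmod \<dots> \<le> l2norm v * l2norm (conv G \<sigma> f ?w)"
    by (rule ip_le[OF fsD(1)[OF v] fsD(1)[OF fw]])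
  also have "\<dots> \<le> l2norm v * (C * l2norm ?w)"
    by (intro mult_left_mono bndD[OF f(1) w]) simp
  finally have *: "l2norm ?w * l2norm ?w \<le> (C * l2norm v) * l2norm ?w"
    by (simp add: power2_eq_square mult_ac)
  show "l2norm ?w \<le> C * l2norm v"
  proof (cases "l2norm ?w = 0")
    case True
    have "0 \<le> C * l2norm v" using order.trans[OF l2norm_nonneg bndD[OF f(1) v]] .
    with True show ?thesis by simp
  next
    case False
    then have "l2norm ?w > 0" using l2norm_nonneg[of ?w] by linarith
    with * show ?thesis by (rule mult_right_le_imp_le)
  qed
qed

lemma fibre_units: "\<gamma> \<in> fibre x \<Longrightarrow> x \<in> units G"
  by (auto simp: fibre_def src_mem_units)

lemma unit_fibre: "x \<in> units G \<Longrightarrow> x \<in> fibre x"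
  by (simp add: fibre_def units_subset src_units)

lemma delta_unit_fs: "x \<in> units G \<Longrightarrow> delta x \<in> fs (arrows G) x"
  by (intro delta_fs units_subset unit_fibre)

text \<open>Row \<open>x\<close> of the adjoint matrix is the conjugate of column \<open>x\<close>,
  that is, of \<open>f\<close> on the fibre. The norm over the unit space is therefore determined by
  the point masses at units.\<close>

lemma conv_invol_self:
  assumes "fibre_finite f" "x \<in> units G"
  shows "conv G \<sigma> (invol G f) f x = of_real ((l2norm (conv G \<sigma> f (delta x)))\<^sup>2)"
proof -
  let ?B = "fibre x \<inter> nonzeros f"
  have fin: "finite ?B" using assms by (simp add: fibre_finite_def)
  have "conv G \<sigma> (invol G f) f x = (\<Sum>\<eta>\<in>?B. mat (invol G f) x \<eta> * f \<eta>)"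
    by (rule conv_fibre_finite[OF assms(1) unit_fibre[OF assms(2)]])
  also have "\<dots> = (\<Sum>\<eta>\<in>?B. of_real ((cmod (f \<eta>))\<^sup>2))"
  proof (rule sum.cong[OF refl])
    fix \<eta> assume "\<eta> \<in> ?B"
    then have "mat (invol G f) x \<eta> = cnj (f \<eta>)"
      using mat_invol[OF unit_fibre[OF assms(2)], of \<eta> f] mat_src[of \<eta> x f] by simp
    then show "mat (invol G f) x \<eta> * f \<eta> = of_real ((cmod (f \<eta>))\<^sup>2)"
      by (simp only: complex_norm_square mult.commute)
  qed
  also have "\<dots> = of_real ((l2norm (conv G \<sigma> f (delta x)))\<^sup>2)"
  proof -
    have "nonzeros (conv G \<sigma> f (delta x)) \<subseteq> ?B"
      by (auto simp: conv_delta_unit[OF assms(2)] nonzeros_def)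
    from l2norm_power2[OF fin this] show ?thesis
      by (simp add: conv_delta_unit[OF assms(2)])
  qed
  finally show ?thesis .
qed

end

context lch_twisted_groupoid
begin

section \<open>Lifting vectors from a fibre, and the reduced norm as a supremum over the
  fibres\<close>

lemma bnd_exists:
  assumes "f \<in> Cc G F"
  shows "\<exists>C\<ge>0. bnd (arrows G) f C"
  using assms
proof (induction f rule: Cc_induct)
  case (bisection f U K)
  obtain B where "B \<ge> 0" "\<And>\<gamma>. cmod (f \<gamma>) \<le> B" using Cc_bounded[OF bisection(1)] by blast
  moreover have "nonzeros f \<subseteq> U" using bisection by auto
  ultimately show ?case
    using bisection(2) bisection_arrows[OF bisection(2)] unfolding bisection_def
    by (intro exI[of _ B] conjI bnd_bisection[of U]) auto
next
  case zero
  show ?case using bnd_zero by blast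
next
  case (add f g)
  then obtain C D where "C \<ge> 0" "D \<ge> 0" "bnd (arrows G) f C" "bnd (arrows G) g D" by blast
  then show ?case
    using add(1,2) by (intro exI[of _ "C + D"] conjI bnd_add fibre_finite_Cc) auto
qed

text \<open>Bumps on disjoint bisections extend a finitely supported function on one fibre to all
  fibres without increasing its norm.\<close>

lemma lift_fs:
  assumes v: "v \<in> fs (arrows G) x" and W: "openin X W" "nonzeros v \<subseteq> W"
  obtains g where "g \<in> Cc G F" "nonzeros g \<subseteq> W" "\<And>\<gamma>. \<gamma> \<in> fibre x \<Longrightarrow> g \<gamma> = v \<gamma>"
    "\<And>y. y \<in> units G \<Longrightarrow> l2norm (conv G \<sigma> g (delta y)) \<le> l2norm v"
    "\<And>A. bnd A g (\<Sum>\<gamma>\<in>nonzeros v. cmod (v \<gamma>))"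
proof -
  note v' = fsD[OF v]
  let ?A = "nonzeros v"
  have "?A \<subseteq> topspace X" using v' by (simp add: topspace_X)
  from finite_Hausdorff_separation[OF Hausdorff v'(1) this]
  obtain S where S: "\<And>a. a \<in> ?A \<Longrightarrow> openin X (S a)" "\<And>a. a \<in> ?A \<Longrightarrow> a \<in> S a"
      "\<And>a b. a \<in> ?A \<Longrightarrow> b \<in> ?A \<Longrightarrow> a \<noteq> b \<Longrightarrow> S a \<inter> S b = {}"
    by blast
  have "\<exists>U p. bisection U \<and> U \<subseteq> S a \<inter> W \<and> a \<in> U \<and> (\<lambda>\<gamma>. v a * of_real (p \<gamma>)) \<in> Cc G F \<and>
      (\<forall>\<gamma>. \<gamma> \<notin> U \<longrightarrow> p \<gamma> = 0) \<and> (\<forall>\<gamma>. \<bar>p \<gamma>\<bar> \<le> 1) \<and> p a = (1::real)" if a: "a \<in> ?A" for a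
  proof -
    have "openin X (S a \<inter> W)" "a \<in> S a \<inter> W" using S(1,2)[OF a] W a by auto
    then obtain U where U: "bisection U" "a \<in> U" "U \<subseteq> S a \<inter> W" by (rule bisection_exists)
    then have "openin X U" by (simp add: bisection_def)
    then obtain p :: "'g \<Rightarrow> real" and L where p: "continuous_map X euclideanreal p" "compactin X L" "L \<subseteq> U"
        "\<And>\<eta>. \<eta> \<notin> L \<Longrightarrow> p \<eta> = 0" "\<And>\<eta>. 0 \<le> p \<eta>" "\<And>\<eta>. p \<eta> \<le> 1" "p a = 1"
      using bump[OF _ U(2)] by blast
    have "(\<lambda>\<gamma>. of_real (p \<gamma>)) \<in> Cc G F"
      using scalar_closed(7) p(4) by (intro CcI[OF continuous_map_of_real[OF p(1)] _ p(2)]) auto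
    then have "(\<lambda>\<gamma>. v a * of_real (p \<gamma>)) \<in> Cc G F"
      using v'(4) by (intro Cc_scale) auto
    moreover have "\<forall>\<gamma>. \<gamma> \<notin> U \<longrightarrow> p \<gamma> = 0" using p(3,4) by blast
    moreover have "\<forall>\<gamma>. \<bar>p \<gamma>\<bar> \<le> 1" using p(5,6) by (simp add: abs_le_iff order.trans[of _ 0])
    ultimately show ?thesis using U p(7) by blast
  qed
  then obtain U p where Up: "\<And>a. a \<in> ?A \<Longrightarrow> bisection (U a) \<and> U a \<subseteq> S a \<inter> W \<and> a \<in> U a \<and>
      (\<lambda>\<gamma>. v a * of_real (p a \<gamma>)) \<in> Cc G F \<and>
      (\<forall>\<gamma>. \<gamma> \<notin> U a \<longrightarrow> p a \<gamma> = 0) \<and> (\<forall>\<gamma>. \<bar>p a \<gamma>\<bar> \<le> 1) \<and> p a a = (1::real)"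
    by metis
  define \<phi> where "\<phi> a \<gamma> = v a * of_real (p a \<gamma>)" for a \<gamma>
  define g where "g \<gamma> = (\<Sum>a\<in>?A. \<phi> a \<gamma>)" for \<gamma>
  have \<phi>_le: "cmod (\<phi> a \<gamma>) \<le> cmod (v a)" if "a \<in> ?A" for a \<gamma>
    using Up[OF that] by (simp add: \<phi>_def norm_mult mult_left_le)
  have \<phi>_zero: "\<phi> a \<gamma> = 0" if "a \<in> ?A" "\<gamma> \<notin> U a" for a \<gamma>
    using Up[OF that(1)] that by (simp add: \<phi>_def)
  have disj: "a = b" if "a \<in> ?A" "b \<in> ?A" "\<gamma> \<in> U a" "\<gamma> \<in> U b" for a b \<gamma>
    using S(3)[OF that(1,2)] Up[OF that(1)] Up[OF that(2)] that(3,4) by blast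
  have g_eq: "g \<gamma> = \<phi> a \<gamma>" if "a \<in> ?A" "\<gamma> \<in> U a" for a \<gamma>
  proof -
    have "\<phi> b \<gamma> = 0" if "b \<in> ?A - {a}" for b
      using disj[of a b \<gamma>] that \<open>a \<in> ?A\<close> \<open>\<gamma> \<in> U a\<close> by (intro \<phi>_zero) auto
    then show ?thesis unfolding g_def using that(1) v'(1) by (simp add: sum.remove)
  qed
  have g_supp: "\<exists>a\<in>?A. \<gamma> \<in> U a" if "g \<gamma> \<noteq> 0" for \<gamma>
    using that \<phi>_zero unfolding g_def by (meson sum.neutral)
  \<comment> \<open>Each bump acts with norm at most \<open>cmod (v a)\<close>, so the l1 norm of
    \<open>v\<close> bounds the sum on every fibre and for every set \<open>A\<close>.\<close>
  have part: "(\<lambda>\<gamma>. \<Sum>a\<in>A'. \<phi> a \<gamma>) \<in> Cc G F \<and> bnd A (\<lambda>\<gamma>. \<Sum>a\<in>A'. \<phi> a \<gamma>) (\<Sum>a\<in>A'. cmod (v a))"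
    if "A' \<subseteq> ?A" for A' A
  proof -
    have "finite A'" using that v'(1) finite_subset by blast
    then show ?thesis using that
    proof (induction A')
      case empty
      show ?case using Cc_zero bnd_zero by simp
    next
      case (insert a A')
      then have a: "a \<in> ?A" by simp
      have mem: "\<phi> a \<in> Cc G F" using Up[OF a] by (simp add: \<phi>_def[abs_def])
      have "bnd A (\<phi> a) (cmod (v a))"
      proof (rule bnd_bisection)
        show "inj_on (rng G) (U a)" "inj_on (src G) (U a)" "U a \<subseteq> arrows G"
          using Up[OF a] bisection_arrows[of "U a"] by (auto simp: bisection_def)
        show "nonzeros (\<phi> a) \<subseteq> U a" using \<phi>_zero[OF a] by (auto simp: nonzeros_def)
      qed (rule \<phi>_le[OF a])
      then show ?case using insert mem Cc_add[OF mem] bnd_add fibre_finite_Cc by simp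
    qed
  qed
  have g_Cc: "g \<in> Cc G F" using part[OF order.refl] by (simp add: g_def[abs_def])
  show thesis
  proof (rule that[OF g_Cc])
    show "nonzeros g \<subseteq> W" using g_supp Up by (fastforce simp: nonzeros_def)
    show "bnd A g (\<Sum>\<gamma>\<in>?A. cmod (v \<gamma>))" for A
      using part[OF order.refl] by (simp add: g_def[abs_def])
    fix \<gamma> assume \<gamma>: "\<gamma> \<in> fibre x"
    show "g \<gamma> = v \<gamma>"
    proof (cases "\<gamma> \<in> ?A")
      case True
      then show ?thesis using g_eq[of \<gamma> \<gamma>] Up[OF True] by (simp add: \<phi>_def)
    next
      case False
      \<comment> \<open>The source is injective on \<open>U a\<close>, so \<open>a\<close> is the
        only point of this bisection in the fibre over \<open>x\<close>.\<close>
      have "g \<gamma> = 0"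
      proof (rule ccontr)
        assume "g \<gamma> \<noteq> 0"
        then obtain a where a: "a \<in> ?A" "\<gamma> \<in> U a" using g_supp by blast
        have "src G a = src G \<gamma>" using a v' \<gamma> by (auto simp: fibre_def)
        moreover have "inj_on (src G) (U a)" "a \<in> U a" using Up[OF a(1)] by (auto simp: bisection_def)
        ultimately have "a = \<gamma>" using a(2) by (simp add: inj_on_eq_iff)
        with False a show False by simp
      qed
      with False show ?thesis by (simp add: nonzeros_def)
    qed
  next
    fix y assume y: "y \<in> units G"
    let ?w = "conv G \<sigma> g (delta y)"
    let ?B = "fibre y \<inter> nonzeros g"
    have fin: "finite ?B" using fibre_finite_Cc[OF g_Cc] by (simp add: fibre_finite_def)
    \<comment> \<open>\<open>h\<close> sends a point of the support to the centre of the bump under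
      which it lies. It is injective on one fibre, as the source is injective on each bisection; so
      the values of \<open>g\<close> there are dominated by values of \<open>v\<close> at distinct
      points.\<close>
    obtain h where h: "\<And>\<gamma>. \<gamma> \<in> ?B \<Longrightarrow> h \<gamma> \<in> ?A \<and> \<gamma> \<in> U (h \<gamma>)"
      using g_supp by (simp add: nonzeros_def) metis
    have inj: "inj_on h ?B"
    proof (rule inj_onI)
      fix a b assume ab: "a \<in> ?B" "b \<in> ?B" "h a = h b"
      then have "src G a = src G b" "a \<in> U (h a)" "b \<in> U (h a)" "bisection (U (h a))"
        using h[of a] h[of b] Up by (auto simp: fibre_def)
      moreover from this have "inj_on (src G) (U (h a))" by (simp add: bisection_def)
      ultimately show "a = b" by (simp add: inj_on_eq_iff)
    qed
    have "(l2norm ?w)\<^sup>2 = (\<Sum>\<gamma>\<in>?B. (cmod (?w \<gamma>))\<^sup>2)"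
      by (rule l2norm_power2[OF fin]) (auto simp: conv_delta_unit[OF y] nonzeros_def)
    also have "\<dots> \<le> (\<Sum>\<gamma>\<in>?B. (cmod (v (h \<gamma>)))\<^sup>2)"
    proof (intro sum_mono power_mono)
      fix \<gamma> assume "\<gamma> \<in> ?B"
      then show "cmod (?w \<gamma>) \<le> cmod (v (h \<gamma>))"
        using h[of \<gamma>] g_eq[of "h \<gamma>" \<gamma>] \<phi>_le[of "h \<gamma>" \<gamma>] by (simp add: conv_delta_unit[OF y])
    qed simp
    also have "\<dots> = (\<Sum>a\<in>h ` ?B. (cmod (v a))\<^sup>2)" by (simp add: sum.reindex[OF inj])
    also have "\<dots> \<le> (\<Sum>a\<in>?A. (cmod (v a))\<^sup>2)" using h v'(1) by (intro sum_mono2) auto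
    also have "\<dots> = (l2norm v)\<^sup>2" by (simp add: l2norm_power2[OF v'(1) order.refl])
    finally show "l2norm ?w \<le> l2norm v" by (rule power2_le_imp_le) simp
  qed
qed

text \<open>The supremum is unfolded once; afterwards the norm is only compared with bounds.
  \<open>bnd_exists\<close> makes the set bounded above, without which its real supremum would carry
  no information.\<close>

lemma unit_module_norm_le_iff:
  assumes f: "f \<in> Cc G F"
  shows "C \<ge> 0 \<Longrightarrow> unit_module_norm G \<sigma> f \<le> C \<longleftrightarrow> (\<forall>x\<in>units G. l2norm (conv G \<sigma> f (delta x)) \<le> C)"
    and "0 \<le> unit_module_norm G \<sigma> f"
proof -
  let ?S = "insert 0 ((\<lambda>x. cmod (conv G \<sigma> (invol G f) f x)) ` units G)"
  obtain D where D: "D \<ge> 0" "bnd (arrows G) f D" using bnd_exists[OF f] by blast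
  have val: "cmod (conv G \<sigma> (invol G f) f x) = (l2norm (conv G \<sigma> f (delta x)))\<^sup>2" if "x \<in> units G" for x
    by (simp add: conv_invol_self[OF fibre_finite_Cc[OF f] that] norm_power)
  have "bdd_above ?S"
  proof (rule bdd_aboveI[of _ "D\<^sup>2"])
    fix s assume "s \<in> ?S"
    then show "s \<le> D\<^sup>2"
      using bndD[OF D(2) delta_unit_fs] by (auto simp: val intro!: power_mono)
  qed
  then show *: "0 \<le> unit_module_norm G \<sigma> f"
    unfolding unit_module_norm_def by (simp add: cSup_upper)
  assume C: "C \<ge> 0"
  have "unit_module_norm G \<sigma> f \<le> C \<longleftrightarrow> Sup ?S \<le> C\<^sup>2"
    using C unfolding unit_module_norm_def
    by (metis real_sqrt_le_iff real_sqrt_unique)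
  also have "\<dots> \<longleftrightarrow> (\<forall>s\<in>?S. s \<le> C\<^sup>2)" using \<open>bdd_above ?S\<close> by (intro cSup_le_iff) auto
  also have "\<dots> \<longleftrightarrow> (\<forall>x\<in>units G. (l2norm (conv G \<sigma> f (delta x)))\<^sup>2 \<le> C\<^sup>2)" by (auto simp: val)
  also have "\<dots> \<longleftrightarrow> (\<forall>x\<in>units G. l2norm (conv G \<sigma> f (delta x)) \<le> C)"
    using C by (simp add: power_mono_iff)
  finally show "unit_module_norm G \<sigma> f \<le> C \<longleftrightarrow> (\<forall>x\<in>units G. l2norm (conv G \<sigma> f (delta x)) \<le> C)" .
qed

text \<open>If convolution by \<open>f\<close> is bounded on the fibres, associativity applies this
  bound to the restriction of \<open>g\<close> to a fibre. Conversely, \<open>lift_fs\<close>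
  extends a unit vector on one fibre to some \<open>g\<close> in the unit ball of the module over
  the unit space.\<close>

lemma reduced_norm_le_iff:
  assumes f: "f \<in> Cc G F"
  shows "C \<ge> 0 \<Longrightarrow> reduced_norm G F \<sigma> f \<le> C \<longleftrightarrow> bnd (arrows G) f C"
    and "0 \<le> reduced_norm G F \<sigma> f"
proof -
  define S where "S = {unit_module_norm G \<sigma> (conv G \<sigma> f g) | g. g \<in> Cc G F \<and> unit_module_norm G \<sigma> g \<le> 1}"
  have S_le: "s \<le> D" if D: "D \<ge> 0" "bnd (arrows G) f D" and s: "s \<in> S" for s D
  proof -
    obtain g where g: "s = unit_module_norm G \<sigma> (conv G \<sigma> f g)" "g \<in> Cc G F" "unit_module_norm G \<sigma> g \<le> 1"
      using s by (auto simp: S_def)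
    have "l2norm (conv G \<sigma> (conv G \<sigma> f g) (delta x)) \<le> D" if x: "x \<in> units G" for x
    proof -
      have gx: "conv G \<sigma> g (delta x) \<in> fs (arrows G) x"
        by (rule conv_fs[OF fibre_finite_Cc[OF g(2)] Cc_range[OF g(2)] delta_unit_fs[OF x]])
      have "l2norm (conv G \<sigma> g (delta x)) \<le> 1"
        using unit_module_norm_le_iff(1)[OF g(2), of 1] g(3) x by simp
      then have "l2norm (conv G \<sigma> f (conv G \<sigma> g (delta x))) \<le> D"
        using bndD[OF D(2) gx] D(1) mult_left_le by (meson order.trans)
      then show ?thesis
        by (simp add: conv_assoc[OF fibre_finite_Cc[OF g(2)] fsD(5)[OF delta_unit_fs[OF x]]])
    qed
    then show "s \<le> D" using unit_module_norm_le_iff(1)[OF Cc_conv[OF f g(2)] D(1)] g(1) by simp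
  qed
  have umn0: "unit_module_norm G \<sigma> (\<lambda>_. 0) = 0"
    using unit_module_norm_le_iff(1)[OF Cc_zero, of 0] unit_module_norm_le_iff(2)[OF Cc_zero]
    by (simp add: conv_zero_left)
  then have S0: "0 \<in> S"
    using Cc_zero by (force simp: S_def conv_zero_right)
  obtain D where D: "D \<ge> 0" "bnd (arrows G) f D" using bnd_exists[OF f] by blast
  have bdd: "bdd_above S" using S_le[OF D] by (intro bdd_aboveI[of _ D])
  have rn: "reduced_norm G F \<sigma> f = Sup S" by (simp add: reduced_norm_def S_def)
  show "0 \<le> reduced_norm G F \<sigma> f" unfolding rn by (rule cSup_upper[OF S0 bdd])
  assume C: "C \<ge> 0"
  show "reduced_norm G F \<sigma> f \<le> C \<longleftrightarrow> bnd (arrows G) f C"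
  proof
    assume "bnd (arrows G) f C"
    then show "reduced_norm G F \<sigma> f \<le> C" unfolding rn using S0 S_le[OF C] by (intro cSup_least) auto
  next
    assume le: "reduced_norm G F \<sigma> f \<le> C"
    show "bnd (arrows G) f C"
      unfolding bnd_def
    proof (intro allI ballI)
      fix x v assume v: "v \<in> fs (arrows G) x"
      note v' = fsD[OF v]
      show "l2norm (conv G \<sigma> f v) \<le> C * l2norm v"
      proof (cases "l2norm v = 0")
        case True
        then have "v = (\<lambda>_. 0)" using l2norm_eq_0D[OF v'(1)] by blast
        then show ?thesis by (simp add: conv_zero_right)
      next
        case False
        define t where "t = l2norm v"
        have t: "t > 0" using False l2norm_nonneg[of v] unfolding t_def by linarith
        define v1 where "v1 \<gamma> = of_real (1 / t) * v \<gamma>" for \<gamma>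
        have nz: "nonzeros v1 = nonzeros v" using t by (auto simp: v1_def nonzeros_def)
        have "of_real (1 / t) * v \<gamma> \<in> F" for \<gamma>
          using v'(4) by (intro scalar_closed(5,7)) auto
        then have v1: "v1 \<in> fs (arrows G) x" using v' nz by (auto simp: fs_def v1_def)
        have l2v1: "l2norm v1 = 1"
          using t l2norm_scale[of "of_real (1 / t)" v] by (simp add: v1_def[abs_def] t_def[symmetric] norm_divide)
        have "nonzeros v \<noteq> {}" using False by (auto simp: l2norm_def)
        then obtain \<gamma> where "\<gamma> \<in> nonzeros v" by blast
        then have x: "x \<in> units G" using v'(3) fibre_units by blast
        obtain g where g: "g \<in> Cc G F" "\<And>\<gamma>. \<gamma> \<in> fibre x \<Longrightarrow> g \<gamma> = v1 \<gamma>"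
          "\<And>y. y \<in> units G \<Longrightarrow> l2norm (conv G \<sigma> g (delta y)) \<le> l2norm v1"
          using lift_fs[OF v1 openin_topspace] fsD(2)[OF v1] unfolding topspace_X by metis
        have "unit_module_norm G \<sigma> g \<le> 1"
          using unit_module_norm_le_iff(1)[OF g(1), of 1] g(3) l2v1 by simp
        then have "unit_module_norm G \<sigma> (conv G \<sigma> f g) \<in> S" using g(1) by (auto simp: S_def)
        then have "unit_module_norm G \<sigma> (conv G \<sigma> f g) \<le> C"
          using cSup_upper[OF _ bdd] le rn by fastforce
        then have "l2norm (conv G \<sigma> (conv G \<sigma> f g) (delta x)) \<le> C"
          using unit_module_norm_le_iff(1)[OF Cc_conv[OF f g(1)] C] x by simp
        moreover have "conv G \<sigma> g (delta x) = v1"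
          using g(2) fsD(3)[OF v1] by (auto simp: conv_delta_unit[OF x] nonzeros_def fun_eq_iff)
        ultimately have "l2norm (conv G \<sigma> f v1) \<le> C"
          by (simp add: conv_assoc[OF fibre_finite_Cc[OF g(1)] fsD(5)[OF delta_unit_fs[OF x]]])
        moreover have "l2norm (conv G \<sigma> f v1) = (1 / t) * l2norm (conv G \<sigma> f v)"
          using t l2norm_scale[of "of_real (1 / t)" "conv G \<sigma> f v"]
          by (simp only: v1_def[abs_def] conv_scale_right) (simp add: norm_divide)
        ultimately show ?thesis using t by (simp add: t_def[symmetric] field_simps)
      qed
    qed
  qed
qed

end


section \<open>The kernel of a cocycle\<close>

lemma openin_Pow: "{U. openin X U} \<subseteq> Pow (topspace X)"
  using openin_subset by blast

text \<open>\<open>U\<close> is covered by open null sets, possibly uncountably many. A compact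
  subset needs only finitely many of them, and inner regularity passes from compact subsets to
  \<open>U\<close>.\<close>

lemma radon_measure_outside_support:
  assumes M: "radon_measure X M" and U: "openin X U" "U \<inter> measure_support X M = {}"
  shows "emeasure M U = 0"
proof -
  have "emeasure M C = 0" if C: "compactin X C" "C \<in> sets M" "C \<subseteq> U" for C
  proof -
    let ?N = "{V. openin X V \<and> emeasure M V = 0}"
    have "C \<subseteq> \<Union>?N"
    proof
      fix x assume "x \<in> C"
      then have "x \<in> topspace X" "x \<notin> measure_support X M"
        using C U compactin_subset_topspace[OF C(1)] by blast+
      then show "x \<in> \<Union>?N" unfolding measure_support_def by (auto simp: zero_less_iff_neq_zero)
    qed
    then obtain \<F> where \<F>: "finite \<F>" "\<F> \<subseteq> ?N" "C \<subseteq> \<Union>\<F>"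
      using compactinD[OF C(1), of ?N] by blast
    have sets: "V \<in> sets M" if "openin X V" for V
    proof -
      have "V \<in> sets (sigma (topspace X) {U. openin X U})"
        using that by (intro in_measure_of[OF openin_Pow]) simp
      with M show ?thesis by (simp add: radon_measure_def)
    qed
    have "emeasure M C \<le> emeasure M (\<Union>\<F>)"
      using \<F> sets by (intro emeasure_mono sets.finite_Union) auto
    also have "\<dots> \<le> (\<Sum>V\<in>\<F>. emeasure M V)"
      using emeasure_subadditive_finite[of \<F> "\<lambda>V. V" M] \<F> sets by auto
    also have "\<dots> = 0" using \<F> by (auto intro: sum.neutral)
    finally show ?thesis by simp
  qed
  then have "(SUP C\<in>{C. compactin X C \<and> C \<in> sets M \<and> C \<subseteq> U}. emeasure M C) \<le> 0"
    by (intro SUP_least) auto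
  with M U(1) show ?thesis by (simp add: radon_measure_def)
qed

context lch_etale_groupoid
begin

context
  fixes c :: "'a \<Rightarrow> real"
  assumes c: "continuous_cocycle G c"
begin

definition kernel_arrows where "kernel_arrows = {\<gamma> \<in> arrows G. c \<gamma> = 0}"

lemma cocycle_mul: "(a, b) \<in> composable G \<Longrightarrow> c (mul G a b) = c a + c b"
  using c by (auto simp: continuous_cocycle_def)

lemma cocycle_rng: "a \<in> arrows G \<Longrightarrow> c (rng G a) = 0"
  using cocycle_mul[of "rng G a" a] by (simp add: composable_iff rng_closed src_rng rng_mul_self)

lemma cocycle_ginv: "a \<in> arrows G \<Longrightarrow> c (ginv G a) = - c a"
  using cocycle_mul[of a "ginv G a"] cocycle_rng[of a]
  by (simp add: composable_iff ginv_closed rng_ginv mul_ginv)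

lemma cocycle_src: "a \<in> arrows G \<Longrightarrow> c (src G a) = 0"
  using cocycle_rng[OF ginv_closed, of a] by (simp add: rng_ginv)

lemma cocycle_quo: "a \<in> fibre x \<Longrightarrow> b \<in> fibre x \<Longrightarrow> c (quo a b) = c a - c b"
  unfolding quo_def
  by (subst cocycle_mul) (auto simp: fibre_def composable_iff ginv_closed rng_ginv cocycle_ginv)

lemma kernel_simps [simp]:
  "rng (kernel G c) = rng G" "src (kernel G c) = src G" "mul (kernel G c) = mul G"
  "ginv (kernel G c) = ginv G" "gtop (kernel G c) = subtopology X kernel_arrows" "arrows (kernel G c) = kernel_arrows"
  by (auto simp: kernel_def restrict_groupoid_def arrows_def kernel_arrows_def)

lemma units_kernel [simp]: "units (kernel G c) = units G"
proof -
  have "x \<in> rng G ` kernel_arrows" if "x \<in> units G" for x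
    using that cocycle_rng rng_units[OF that] units_subset[OF that]
    by (intro image_eqI[of _ _ x]) (auto simp: kernel_arrows_def units_def)
  then show ?thesis by (auto simp: units_def kernel_arrows_def)
qed

lemma units_S: "units G \<subseteq> kernel_arrows"
  using cocycle_rng units_subset by (auto simp: kernel_arrows_def units_def rng_closed)

lemma unit_top_kernel [simp]: "unit_top (kernel G c) = unit_top G"
  using units_S by (simp add: unit_top_def subtopology_subtopology inf.absorb2)

lemma composable_kernel: "composable (kernel G c) = composable G \<inter> kernel_arrows \<times> kernel_arrows"
  by (auto simp: composable_def kernel_arrows_def)

lemma closedin_S: "closedin X kernel_arrows"
proof -
  have "continuous_map X euclideanreal c" using c by (simp add: continuous_cocycle_def)
  from closedin_continuous_map_preimage[OF this, of "{0}"] show ?thesis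
    by (simp add: kernel_arrows_def topspace_X)
qed

text \<open>Integrating a bump function against the Haar system detects which fibres its support meets,
  so that the range map of the kernel is open.\<close>

lemma rng_kernel_open:
  assumes haar: "haar_system (kernel G c) \<mu>" and W: "openin (subtopology X kernel_arrows) W"
  shows "openin (unit_top G) (rng G ` W)"
proof (subst openin_subopen, intro ballI)
  fix x assume "x \<in> rng G ` W"
  then obtain \<gamma> where \<gamma>: "\<gamma> \<in> W" "x = rng G \<gamma>" by blast
  obtain W' where W': "openin X W'" "W = W' \<inter> kernel_arrows" using W by (auto simp: openin_subtopology)
  then have \<gamma>': "\<gamma> \<in> W'" "\<gamma> \<in> kernel_arrows" "\<gamma> \<in> arrows G" using \<gamma> by (auto simp: kernel_arrows_def)
  obtain p :: "'a \<Rightarrow> real" and L where p: "continuous_map X euclideanreal p" "compactin X L" "L \<subseteq> W'"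
      "\<And>\<eta>. \<eta> \<notin> L \<Longrightarrow> p \<eta> = 0" "\<And>\<eta>. 0 \<le> p \<eta>" "\<And>\<eta>. p \<eta> \<le> 1" "p \<gamma> = 1"
    using bump[OF W'(1) \<gamma>'(1)] by blast
  let ?H = "subtopology X kernel_arrows"
  have topH: "topspace ?H = kernel_arrows" "topspace X \<inter> kernel_arrows = kernel_arrows"
      "\<And>\<eta>. \<eta> \<in> kernel_arrows \<Longrightarrow> \<eta> \<in> topspace X"
    by (auto simp: topspace_X kernel_arrows_def)
  define g where "g \<eta> = (if \<eta> \<in> kernel_arrows then p \<eta> else 0)" for \<eta>
  have g_cont: "continuous_map ?H euclideanreal g"
    by (rule continuous_map_eq[OF continuous_map_from_subtopology[OF p(1)]]) (simp add: g_def)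
  have C: "compactin ?H (L \<inter> kernel_arrows)"
    using closed_Int_compactin[OF closedin_S p(2)] by (simp add: compactin_subtopology Int_commute)
  have g_C: "g \<eta> = 0" if "\<eta> \<notin> L \<inter> kernel_arrows" for \<eta> using that p(4) by (auto simp: g_def)
  have "(\<lambda>\<eta>. complex_of_real (g \<eta>)) \<in> Cc (kernel G c) UNIV"
    using continuous_map_of_real[OF g_cont] C g_C by (auto simp: Cc_def)
  then have I_cont: "continuous_map (unit_top G) euclidean (\<lambda>x. \<integral>\<eta>. complex_of_real (g \<eta>) \<partial>\<mu> x)"
  proof -
    have "\<forall>f\<in>Cc (kernel G c) UNIV. continuous_map (unit_top (kernel G c)) euclidean (\<lambda>x. \<integral>\<eta>. f \<eta> \<partial>\<mu> x)"
      using haar unfolding haar_system_def by blast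
    from bspec[OF this \<open>_ \<in> Cc _ _\<close>] show ?thesis by (simp only: unit_top_kernel)
  qed
  \<comment> \<open>\<open>T\<close> is open by the continuity axiom of the Haar system. It contains
    \<open>x\<close>, because the integral of \<open>g\<close> against a measure with
    \<open>\<gamma>\<close> in its support is positive, and its elements are ranges of elements of
    \<open>W\<close>, because \<open>g\<close> vanishes off \<open>W\<close>.\<close>
  define T where "T = {x \<in> units G. (\<integral>\<eta>. g \<eta> \<partial>\<mu> x) \<noteq> 0}"
  have "openin (unit_top G) {x \<in> topspace (unit_top G). (\<integral>\<eta>. complex_of_real (g \<eta>) \<partial>\<mu> x) \<in> - {0}}"
    by (rule openin_continuous_map_preimage[OF I_cont]) auto
  then have T_open: "openin (unit_top G) T"
    by (simp add: T_def topspace_unit_top)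
  have radon: "radon_measure ?H (\<mu> y)" and supp: "measure_support ?H (\<mu> y) = {\<eta> \<in> kernel_arrows. rng G \<eta> = y}"
    if "y \<in> units G" for y
    using haar that by (auto simp: haar_system_def)
  have space: "space (\<mu> y) = kernel_arrows" if "y \<in> units G" for y
  proof -
    have "sets (\<mu> y) = sets (sigma (topspace ?H) {U. openin ?H U})"
      using radon[OF that] by (simp add: radon_measure_def)
    then have "space (\<mu> y) = space (sigma (topspace ?H) {U. openin ?H U})" by (rule sets_eq_imp_space_eq)
    also have "\<dots> = topspace ?H" by (rule space_measure_of[OF openin_Pow])
    finally show ?thesis by (simp add: topH)
  qed
  have open_sets: "V \<in> sets (\<mu> y)" if "y \<in> units G" "openin ?H V" for y V
  proof -
    have "V \<in> sets (sigma (topspace ?H) {U. openin ?H U})"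
      using that by (intro in_measure_of[OF openin_Pow]) simp
    then show ?thesis using radon[OF that(1)] by (simp add: radon_measure_def)
  qed
  have meas: "g \<in> borel_measurable (\<mu> y)" if "y \<in> units G" for y
  proof (rule borel_measurableI)
    fix B :: "real set" assume "open B"
    then have "openin ?H {\<eta> \<in> topspace ?H. g \<eta> \<in> B}"
      by (intro openin_continuous_map_preimage[OF g_cont]) auto
    moreover have "{\<eta> \<in> topspace ?H. g \<eta> \<in> B} = g -` B \<inter> space (\<mu> y)"
      by (auto simp: topH space[OF that])
    ultimately show "g -` B \<inter> space (\<mu> y) \<in> sets (\<mu> y)" using open_sets[OF that] by simp
  qed
  have g_pos: "0 \<le> g \<eta>" "g \<eta> \<le> 1" for \<eta> using p(5,6) by (auto simp: g_def)
  show "\<exists>T. openin (unit_top G) T \<and> x \<in> T \<and> T \<subseteq> rng G ` W"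
  proof (intro exI conjI)
    show "openin (unit_top G) T" by (rule T_open)
    have x: "x \<in> units G" using \<gamma>' \<gamma>(2) by (simp add: rng_mem_units)
    show "x \<in> T"
    proof (rule ccontr)
      assume "x \<notin> T"
      then have zero: "(\<integral>\<eta>. g \<eta> \<partial>\<mu> x) = 0" using x by (simp add: T_def)
      have CS: "L \<inter> kernel_arrows \<in> sets (\<mu> x)"
      proof -
        have "closedin ?H (L \<inter> kernel_arrows)"
          by (rule compactin_imp_closedin[OF Hausdorff_space_subtopology[OF Hausdorff] C])
        then have "openin ?H (kernel_arrows - (L \<inter> kernel_arrows))"
          unfolding closedin_def topH(1) by simp
        then have "kernel_arrows - (L \<inter> kernel_arrows) \<in> sets (\<mu> x)" by (rule open_sets[OF x])
        then have "space (\<mu> x) - (kernel_arrows - (L \<inter> kernel_arrows)) \<in> sets (\<mu> x)" by blast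
        moreover have "space (\<mu> x) - (kernel_arrows - (L \<inter> kernel_arrows)) = L \<inter> kernel_arrows" by (auto simp: space[OF x])
        ultimately show ?thesis by simp
      qed
      \<comment> \<open>A function that is not integrable has integral 0 as well. Before the
        vanishing integral may be read as \<open>g = 0\<close> almost everywhere, \<open>g\<close>
        is therefore dominated by the indicator of a compact set, which has finite measure.\<close>
      have "emeasure (\<mu> x) (L \<inter> kernel_arrows) < \<infinity>"
        using radon[OF x] C CS unfolding radon_measure_def by blast
      then have ind: "integrable (\<mu> x) (\<lambda>\<eta>. indicator (L \<inter> kernel_arrows) \<eta> :: real)"
        using CS by (intro integrable_real_indicator)
      have int: "integrable (\<mu> x) g"
      proof (rule Bochner_Integration.integrable_bound[OF ind meas[OF x]], rule AE_I2)
        show "norm (g \<eta>) \<le> norm (indicator (L \<inter> kernel_arrows) \<eta> :: real)" for \<eta>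
          using g_C[of \<eta>] g_pos[of \<eta>] by (cases "\<eta> \<in> L \<inter> kernel_arrows") simp_all
      qed
      then have "AE \<eta> in \<mu> x. g \<eta> = 0"
        using zero integral_nonneg_eq_0_iff_AE[OF int] g_pos by simp
      then have null: "emeasure (\<mu> x) {\<eta> \<in> space (\<mu> x). g \<eta> \<noteq> 0} = 0"
        using meas[OF x] by (subst (asm) AE_iff_measurable[OF _ refl]) auto
      let ?O = "{\<eta> \<in> topspace ?H. g \<eta> \<in> - {0}}"
      have "openin ?H ?O" by (rule openin_continuous_map_preimage[OF g_cont]) auto
      moreover have "\<gamma> \<in> ?O" using \<gamma>'(2) p(7) unfolding topH g_def by simp
      moreover have "\<gamma> \<in> measure_support ?H (\<mu> x)" using supp[OF x] \<gamma> \<gamma>'(2) by simp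
      ultimately have "emeasure (\<mu> x) ?O > 0" by (auto simp: measure_support_def)
      moreover have "?O = {\<eta> \<in> space (\<mu> x). g \<eta> \<noteq> 0}" by (auto simp: topH space[OF x])
      ultimately show False using null by simp
    qed
    show "T \<subseteq> rng G ` W"
    proof
      fix y assume y: "y \<in> T"
      then have yu: "y \<in> units G" and nz: "(\<integral>\<eta>. g \<eta> \<partial>\<mu> y) \<noteq> 0" by (auto simp: T_def)
      show "y \<in> rng G ` W"
      proof (rule ccontr)
        assume no: "y \<notin> rng G ` W"
        let ?O = "{\<eta> \<in> topspace ?H. g \<eta> \<in> - {0}}"
        have op: "openin ?H ?O" by (rule openin_continuous_map_preimage[OF g_cont]) auto
        have "?O \<inter> measure_support ?H (\<mu> y) = {}"
          using no g_C p(3) by (auto simp: supp[OF yu] W'(2))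
        then have "emeasure (\<mu> y) ?O = 0"
          by (rule radon_measure_outside_support[OF radon[OF yu] op])
        moreover have "?O = {\<eta> \<in> space (\<mu> y). g \<eta> \<noteq> 0}" by (auto simp: topH space[OF yu])
        ultimately have "AE \<eta> in \<mu> y. g \<eta> = 0"
          using op open_sets[OF yu] by (intro AE_I[where N = ?O]) auto
        then have "(\<integral>\<eta>. g \<eta> \<partial>\<mu> y) = 0" by (rule integral_eq_zero_AE)
        with nz show False by simp
      qed
    qed
  qed
qed

text \<open>In a bisection \<open>U\<close> around \<open>\<gamma>\<close>, the arrows whose range
  is also the range of a kernel arrow of \<open>U\<close> form an open set. As the range is
  injective on \<open>U\<close>, they are that kernel arrow themselves.\<close>

lemma openin_S:
  assumes haar: "haar_system (kernel G c) \<mu>"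
  shows "openin X kernel_arrows"
proof (subst openin_subopen, intro ballI)
  fix \<gamma> assume \<gamma>: "\<gamma> \<in> kernel_arrows"
  then have "\<gamma> \<in> topspace X" by (simp add: kernel_arrows_def topspace_X)
  then obtain U where U: "bisection U" "\<gamma> \<in> U" by (rule bisection_exists[OF openin_topspace])
  then have U': "openin X U" "inj_on (rng G) U" "U \<subseteq> arrows G"
    using bisection_arrows by (auto simp: bisection_def)
  have "openin (subtopology X kernel_arrows) (U \<inter> kernel_arrows)" using U'(1) by (auto simp: openin_subtopology)
  then have op: "openin (unit_top G) (rng G ` (U \<inter> kernel_arrows))" by (rule rng_kernel_open[OF haar])
  show "\<exists>T. openin X T \<and> \<gamma> \<in> T \<and> T \<subseteq> kernel_arrows"
  proof (intro exI conjI)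
    show "openin X (U \<inter> {\<eta> \<in> topspace X. rng G \<eta> \<in> rng G ` (U \<inter> kernel_arrows)})"
      using U'(1) openin_continuous_map_preimage[OF continuous_rng_unit_top op] by (rule openin_Int)
    show "\<gamma> \<in> U \<inter> {\<eta> \<in> topspace X. rng G \<eta> \<in> rng G ` (U \<inter> kernel_arrows)}"
      using U \<gamma> \<open>\<gamma> \<in> topspace X\<close> by blast
    show "U \<inter> {\<eta> \<in> topspace X. rng G \<eta> \<in> rng G ` (U \<inter> kernel_arrows)} \<subseteq> kernel_arrows"
      using U'(2) by (auto simp: inj_on_eq_iff)
  qed
qed

text \<open>The kernel is closed, hence locally compact, and it is open, so that bisections of
  \<open>G\<close> inside it serve as charts. All units lie in the kernel, so the unit space does
  not change.\<close>

lemma kernel_groupoid: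
  assumes haar: "haar_system (kernel G c) \<mu>"
  shows "lch_etale_groupoid (kernel G c)"
proof -
  note op = openin_S[OF haar]
  have SA: "\<gamma> \<in> arrows G" if "\<gamma> \<in> kernel_arrows" for \<gamma> using that by (simp add: kernel_arrows_def)
  have comp: "(a, b) \<in> composable (kernel G c) \<Longrightarrow> (a, b) \<in> composable G" for a b
    by (simp add: composable_kernel)
  have ct: "composable_top (kernel G c) = subtopology (prod_topology X X) (composable (kernel G c))"
  proof -
    have "kernel_arrows \<times> kernel_arrows \<inter> composable (kernel G c) = composable (kernel G c)"
      by (auto simp: composable_kernel)
    then show ?thesis
      by (simp only: composable_top_def kernel_simps subtopology_Times[symmetric] subtopology_subtopology)
  qed
  show ?thesis
  proof unfold_locales
    show "continuous_map (composable_top (kernel G c)) (gtop (kernel G c)) (\<lambda>(\<xi>, \<eta>). mul (kernel G c) \<xi> \<eta>)"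
      unfolding kernel_simps
    proof (rule continuous_map_into_subtopology)
      show "continuous_map (composable_top (kernel G c)) X (\<lambda>(\<xi>, \<eta>). mul G \<xi> \<eta>)"
        unfolding ct using continuous_mul unfolding composable_top_def
        by (rule continuous_map_from_subtopology_mono) (simp add: composable_kernel)
      show "(\<lambda>(\<xi>, \<eta>). mul G \<xi> \<eta>) \<in> topspace (composable_top (kernel G c)) \<rightarrow> kernel_arrows"
        using mul_closed cocycle_mul by (auto simp: ct composable_kernel kernel_arrows_def)
    qed
    show "continuous_map (gtop (kernel G c)) (gtop (kernel G c)) (ginv (kernel G c))"
      unfolding kernel_simps using continuous_ginv
      by (intro continuous_map_into_subtopology continuous_map_from_subtopology)
        (auto simp: kernel_arrows_def ginv_closed cocycle_ginv)
    show "Hausdorff_space (gtop (kernel G c))"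
      unfolding kernel_simps by (rule Hausdorff_space_subtopology[OF Hausdorff])
    show "locally_compact_space (gtop (kernel G c))"
      unfolding kernel_simps by (rule locally_compact_space_closed_subset[OF locally_compact closedin_S])
    fix \<gamma> assume "\<gamma> \<in> arrows (kernel G c)"
    then have \<gamma>: "\<gamma> \<in> kernel_arrows" "\<gamma> \<in> arrows G" by (auto simp: kernel_arrows_def)
    obtain U where U: "bisection U" "\<gamma> \<in> U" "U \<subseteq> kernel_arrows" by (rule bisection_exists[OF op \<gamma>(1)])
    have "openin (subtopology X kernel_arrows) U" using U(1,3) op by (simp add: bisection_def openin_open_subtopology)
    moreover have "subtopology (subtopology X kernel_arrows) U = subtopology X U"
      using U(3) by (simp add: subtopology_subtopology inf.absorb2)
    ultimately show "\<exists>U. openin (gtop (kernel G c)) U \<and> \<gamma> \<in> U \<and>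
        openin (unit_top (kernel G c)) (rng (kernel G c) ` U) \<and>
        homeomorphic_map (subtopology (gtop (kernel G c)) U)
          (subtopology (unit_top (kernel G c)) (rng (kernel G c) ` U)) (rng (kernel G c))"
      using U(1,2) unfolding kernel_simps unit_top_kernel bisection_def by (intro exI[of _ U]) simp
  qed (auto simp: kernel_arrows_def rng_closed src_closed cocycle_rng cocycle_src rng_rng src_rng rng_src src_src
      rng_mul_self mul_src_self ginv_closed cocycle_ginv rng_ginv src_ginv mul_ginv ginv_mul
      mul_closed cocycle_mul rng_mul src_mul mul_assoc composable_kernel)
qed

end

end

locale kernel_cocycle = lch_twisted_groupoid G F \<sigma>
  for G :: "'g groupoid" and F \<sigma> +
  fixes c :: "'g \<Rightarrow> real" and \<mu> :: "'g \<Rightarrow> 'g measure"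
  assumes c: "continuous_cocycle G c"
    and haar: "haar_system (kernel G c) \<mu>"
begin

abbreviation H where "H \<equiv> kernel G c"
abbreviation S where "S \<equiv> kernel_arrows c"

lemmas c_mul = cocycle_mul[OF c] and c_ginv = cocycle_ginv[OF c]
  and c_quo = cocycle_quo[OF c] and S_def = kernel_arrows_def[OF c]
  and units_S = units_S[OF c] and closedin_S = closedin_S[OF c] and openin_S = openin_S[OF c haar]
  and composable_H = composable_kernel[OF c]

lemmas H_simps [simp] = kernel_simps[OF c] units_kernel[OF c] unit_top_kernel[OF c]

text \<open>The norm of the coefficient algebra is thereby governed by
  \<open>reduced_norm_le_iff\<close>, applied to the kernel.\<close>

sublocale H: lch_twisted_groupoid H F \<sigma>
proof (intro lch_twisted_groupoid.intro twisted_groupoid.intro twisted_groupoid_axioms.intro)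
  show et: "lch_etale_groupoid H" by (rule kernel_groupoid[OF c haar])
  then show "topological_groupoid H" by (simp add: lch_etale_groupoid_def)
  show "scalar_field F" by (rule scalar)
  have "composable_top H = subtopology (composable_top G) (S \<times> S)"
  proof -
    have "S \<times> S \<inter> composable H = composable G \<inter> S \<times> S" by (auto simp: composable_H)
    then show ?thesis
      by (simp only: composable_top_def H_simps subtopology_Times[symmetric] subtopology_subtopology)
  qed
  moreover have "S \<subseteq> arrows G" by (auto simp: S_def)
  ultimately show "normalised_two_cocycle H F \<sigma>"
    using cocycle continuous_map_from_subtopology[of "composable_top G" euclidean "\<lambda>(\<xi>, \<eta>). \<sigma> \<xi> \<eta>" "S \<times> S"]
    unfolding normalised_two_cocycle_def two_cocycle_def H_simps composable_H by fastforce
qed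

end


section \<open>The norms of the Hilbert module\<close>

lemma bounded_op2_bilinear:
  assumes "function_seminorm V1 N1" "function_seminorm V2 N2" "function_seminorm V N"
    and mem: "\<And>f g. f \<in> V1 \<Longrightarrow> g \<in> V2 \<Longrightarrow> op f g \<in> V"
    and left: "\<And>f f' g. f \<in> V1 \<Longrightarrow> f' \<in> V1 \<Longrightarrow> g \<in> V2 \<Longrightarrow>
      op (\<lambda>\<gamma>. f \<gamma> - f' \<gamma>) g = (\<lambda>\<gamma>. op f g \<gamma> - op f' g \<gamma>)"
    and right: "\<And>f g g'. f \<in> V1 \<Longrightarrow> g \<in> V2 \<Longrightarrow> g' \<in> V2 \<Longrightarrow>
      op f (\<lambda>\<gamma>. g \<gamma> - g' \<gamma>) = (\<lambda>\<gamma>. op f g \<gamma> - op f g' \<gamma>)"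
    and bound: "\<And>f g. f \<in> V1 \<Longrightarrow> g \<in> V2 \<Longrightarrow> N (op f g) \<le> N1 f * N2 g"
  shows "bounded_op2 V1 V2 V N1 N2 N op"
proof -
  interpret V1: function_seminorm V1 N1 by fact
  interpret V2: function_seminorm V2 N2 by fact
  interpret V: function_seminorm V N by fact
  show ?thesis
  proof unfold_locales
    fix f f' g g' assume f: "f \<in> V1" "f' \<in> V1" and g: "g \<in> V2" "g' \<in> V2"
    have "N (\<lambda>\<gamma>. op f g \<gamma> - op f' g' \<gamma>) \<le>
        N (\<lambda>\<gamma>. op f g \<gamma> - op f' g \<gamma>) + N (\<lambda>\<gamma>. op f' g \<gamma> - op f' g' \<gamma>)"
      by (intro V.triangle mem f g)
    also have "\<dots> \<le> N1 (\<lambda>\<gamma>. f \<gamma> - f' \<gamma>) * N2 g + N1 f' * N2 (\<lambda>\<gamma>. g \<gamma> - g' \<gamma>)"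
      unfolding left[OF f g(1), symmetric] right[OF f(2) g, symmetric]
      by (intro add_mono bound V1.diff_mem V2.diff_mem f g)
    also have "\<dots> \<le> N1 (\<lambda>\<gamma>. f \<gamma> - f' \<gamma>) * (1 + N2 g) + (1 + N1 f') * N2 (\<lambda>\<gamma>. g \<gamma> - g' \<gamma>)"
      by (intro add_mono mult_left_mono mult_right_mono) (simp_all add: V1.nonneg V2.nonneg V1.diff_mem V2.diff_mem f g)
    finally show "N (\<lambda>\<gamma>. op f g \<gamma> - op f' g' \<gamma>) \<le>
        N1 (\<lambda>\<gamma>. f \<gamma> - f' \<gamma>) * (1 + N2 g) + (1 + N1 f') * N2 (\<lambda>\<gamma>. g \<gamma> - g' \<gamma>)" .
  qed (rule mem)
qed

context function_seminorm
begin

lemma bounded_op2_add_diff: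
  "bounded_op2 V V V N N N (\<lambda>f g \<gamma>. f \<gamma> + g \<gamma>)"
  "bounded_op2 V V V N N N (\<lambda>f g \<gamma>. f \<gamma> - g \<gamma>)"
proof -
  have le: "a + b \<le> a * (1 + x) + (1 + y) * b" if "0 \<le> a" "0 \<le> b" "0 \<le> x" "0 \<le> y" for a b x y :: real
    using mult_nonneg_nonneg[OF that(1,3)] mult_nonneg_nonneg[OF that(4,2)] by (simp add: algebra_simps)
  show "bounded_op2 V V V N N N (\<lambda>f g \<gamma>. f \<gamma> + g \<gamma>)"
  proof unfold_locales
    fix f f' g g' assume f: "f \<in> V" "f' \<in> V" and g: "g \<in> V" "g' \<in> V"
    have "N (\<lambda>\<gamma>. f \<gamma> + g \<gamma> - (f' \<gamma> + g' \<gamma>)) \<le> N (\<lambda>\<gamma>. f \<gamma> - f' \<gamma>) + N (\<lambda>\<gamma>. g \<gamma> - g' \<gamma>)"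
      using add_le[OF diff_mem[OF f] diff_mem[OF g]] by (simp add: algebra_simps)
    also have "\<dots> \<le> N (\<lambda>\<gamma>. f \<gamma> - f' \<gamma>) * (1 + N g) + (1 + N f') * N (\<lambda>\<gamma>. g \<gamma> - g' \<gamma>)"
      by (intro le nonneg diff_mem f g)
    finally show "N (\<lambda>\<gamma>. f \<gamma> + g \<gamma> - (f' \<gamma> + g' \<gamma>)) \<le>
      N (\<lambda>\<gamma>. f \<gamma> - f' \<gamma>) * (1 + N g) + (1 + N f') * N (\<lambda>\<gamma>. g \<gamma> - g' \<gamma>)" .
  qed (rule add_mem)
  show "bounded_op2 V V V N N N (\<lambda>f g \<gamma>. f \<gamma> - g \<gamma>)"
  proof unfold_locales
    fix f f' g g' assume f: "f \<in> V" "f' \<in> V" and g: "g \<in> V" "g' \<in> V"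
    have "N (\<lambda>\<gamma>. f \<gamma> - g \<gamma> - (f' \<gamma> - g' \<gamma>)) \<le> N (\<lambda>\<gamma>. f \<gamma> - f' \<gamma>) + N (\<lambda>\<gamma>. g \<gamma> - g' \<gamma>)"
      using diff_le[OF diff_mem[OF f] diff_mem[OF g]] by (simp add: algebra_simps)
    also have "\<dots> \<le> N (\<lambda>\<gamma>. f \<gamma> - f' \<gamma>) * (1 + N g) + (1 + N f') * N (\<lambda>\<gamma>. g \<gamma> - g' \<gamma>)"
      by (intro le nonneg diff_mem f g)
    finally show "N (\<lambda>\<gamma>. f \<gamma> - g \<gamma> - (f' \<gamma> - g' \<gamma>)) \<le>
      N (\<lambda>\<gamma>. f \<gamma> - f' \<gamma>) * (1 + N g) + (1 + N f') * N (\<lambda>\<gamma>. g \<gamma> - g' \<gamma>)" .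
  qed (rule diff_mem)
qed

end

context lch_twisted_groupoid
begin

lemma seminorm_of_bnd:
  assumes nonneg: "\<And>f. f \<in> Cc G F \<Longrightarrow> 0 \<le> N f"
    and iff: "\<And>f C. f \<in> Cc G F \<Longrightarrow> 0 \<le> C \<Longrightarrow> N f \<le> C \<longleftrightarrow> bnd A f C"
  shows "function_seminorm (Cc G F) N"
proof
  show "N (\<lambda>_. 0) = 0"
    using iff[OF Cc_zero, of 0] bnd_zero[of 0 A] nonneg[OF Cc_zero] by simp
  fix f g assume f: "f \<in> Cc G F" and g: "g \<in> Cc G F"
  have "bnd A f (N f)" "bnd A g (N g)"
    using iff[OF f, of "N f"] iff[OF g, of "N g"] nonneg f g by auto
  then have "bnd A (\<lambda>\<gamma>. f \<gamma> - g \<gamma>) (N f + N g)"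
    by (intro bnd_diff fibre_finite_Cc f g)
  then show "N (\<lambda>\<gamma>. f \<gamma> - g \<gamma>) \<le> N f + N g"
    using iff[OF Cc_diff[OF f g], of "N f + N g"] nonneg f g by simp
qed (use Cc_zero Cc_diff nonneg in auto)

abbreviation R where "R \<equiv> reduced_norm G F \<sigma>"

lemma R_seminorm: "function_seminorm (Cc G F) R"
  by (rule seminorm_of_bnd[OF reduced_norm_le_iff(2) reduced_norm_le_iff(1)])

lemma R_bnd: "f \<in> Cc G F \<Longrightarrow> bnd (arrows G) f (R f)"
  using reduced_norm_le_iff[of f] by blast

lemma R_invol_le:
  assumes "f \<in> Cc G F"
  shows "R (invol G f) \<le> R f"
  using bnd_invol[OF R_bnd[OF assms] fibre_finite_Cc[OF assms] fibre_finite_invol[OF assms] Cc_range[OF assms]]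
    reduced_norm_le_iff(1)[OF Cc_invol[OF assms], of "R f"] reduced_norm_le_iff(2)[OF assms] by simp

end

lemma invol_diff: "invol G (\<lambda>\<gamma>. f \<gamma> - g \<gamma>) = (\<lambda>\<gamma>. invol G f \<gamma> - invol G g \<gamma>)"
  by (auto simp: invol_def)

context kernel_cocycle
begin

section \<open>Passing between the groupoid and the kernel\<close>

lemma S_arrows: "\<gamma> \<in> S \<Longrightarrow> \<gamma> \<in> arrows G"
  by (simp add: S_def)

lemma c_cont: "continuous_map X euclideanreal c"
  using c by (simp add: continuous_cocycle_def)

lemma H_fibre: "H.fibre x = S \<inter> fibre x"
  by (auto simp: H.fibre_def fibre_def S_def)

lemma H_fs: "H.fs S x = fs S x"
  unfolding H.fs_def fs_def H_fibre by auto

lemma H_conv: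
  assumes "nonzeros f \<subseteq> S" "nonzeros g \<subseteq> S"
  shows "conv H \<sigma> f g = conv G \<sigma> f g"
proof
  fix \<gamma>
  show "conv H \<sigma> f g \<gamma> = conv G \<sigma> f g \<gamma>"
    unfolding conv_def by (rule infsum_cong_neutral) (use assms in \<open>auto simp: composable_H nonzeros_def\<close>)
qed

lemma H_bnd: "nonzeros w \<subseteq> S \<Longrightarrow> H.bnd S w C \<longleftrightarrow> bnd S w C"
  using H_conv fsD(2) unfolding H.bnd_def bnd_def H_fs by metis

lemma Cc_H_nonzeros: "w \<in> Cc H F \<Longrightarrow> nonzeros w \<subseteq> S"
  using H.Cc_nonzeros by simp

text \<open>The kernel is open and closed, so extension by zero stays continuous; coefficient
  functions can thus be convolved over \<open>G\<close>.\<close>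

lemma Cc_H_Cc:
  assumes w: "w \<in> Cc H F"
  shows "w \<in> Cc G F"
proof -
  obtain K where K: "compactin H.X K" "nonzeros w \<subseteq> K" "K \<subseteq> arrows H" by (rule H.Cc_compact[OF w])
  have cl: "openin X (topspace X - S)" using closedin_S by blast
  have "continuous_map X euclidean w"
  proof (rule continuous_map_glue[OF openin_S _ refl cl])
    show "continuous_map (subtopology X S) euclidean w" using H.Cc_cont[OF w] by simp
    show "continuous_map (subtopology X (topspace X - S)) euclidean (\<lambda>_. 0 :: complex)" by simp
    show "w x = 0" if "x \<in> topspace X - S" for x
      using Cc_H_nonzeros[OF w] that by (auto simp: nonzeros_def)
  qed auto
  then show ?thesis
    by (rule CcI[of _ K]) (use K H.Cc_range[OF w] in \<open>auto simp: compactin_subtopology nonzeros_def\<close>)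
qed

lemma Cc_restrict:
  assumes f: "f \<in> Cc G F"
  shows "(\<lambda>\<gamma>. if \<gamma> \<in> S then f \<gamma> else 0) \<in> Cc H F"
proof -
  obtain K where K: "compactin X K" "nonzeros f \<subseteq> K" "K \<subseteq> arrows G" by (rule Cc_compact[OF f])
  have "compactin X (S \<inter> K)" by (rule closed_Int_compactin[OF closedin_S K(1)])
  then have "compactin H.X (S \<inter> K)" by (simp add: compactin_subtopology)
  moreover have "continuous_map H.X euclidean (\<lambda>\<gamma>. if \<gamma> \<in> S then f \<gamma> else 0)"
    unfolding H_simps
    by (rule continuous_map_eq[OF continuous_map_from_subtopology[OF Cc_cont[OF f]]]) simp
  ultimately show ?thesis
    using Cc_range[OF f] scalar_closed(1) K(2) by (intro H.CcI) (auto simp: nonzeros_def)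
qed

abbreviation M where "M \<equiv> reduced_norm H F \<sigma>"
abbreviation N where "N \<equiv> kernel_module_norm G F \<sigma> c"
abbreviation kin where "kin \<equiv> kernel_inner G \<sigma> c"

lemma M_le_iff: "w \<in> Cc H F \<Longrightarrow> C \<ge> 0 \<Longrightarrow> M w \<le> C \<longleftrightarrow> bnd S w C"
  using H.reduced_norm_le_iff(1) H_bnd Cc_H_nonzeros by simp

lemma M_nonneg: "w \<in> Cc H F \<Longrightarrow> 0 \<le> M w"
  by (rule H.reduced_norm_le_iff(2))

lemma M_bnd: "w \<in> Cc H F \<Longrightarrow> bnd S w (M w)"
  using M_le_iff M_nonneg by blast

lemma kin_mem:
  assumes "f \<in> Cc G F" "g \<in> Cc G F"
  shows "kin f g \<in> Cc H F"
  using Cc_restrict[OF Cc_conv[OF Cc_invol[OF assms(1)] assms(2)]]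
  by (simp add: kernel_inner_def[abs_def])

lemma kin_eq:
  assumes "fibre_finite g" "\<gamma> \<in> S" "\<gamma> \<in> fibre x"
  shows "kin f g \<gamma> = (\<Sum>\<eta>\<in>fibre x \<inter> nonzeros g. cnj (mat f \<eta> \<gamma>) * g \<eta>)"
  using assms conv_fibre_finite[OF assms(1,3), of "invol G f"]
  by (simp add: kernel_inner_def mat_invol)

lemma kin_outside: "\<gamma> \<notin> S \<Longrightarrow> kin f g \<gamma> = 0"
  by (simp add: kernel_inner_def)

text \<open>For \<open>\<eta>\<close> in the kernel, \<open>quo \<gamma> \<eta>\<close> is in the
  kernel exactly if \<open>\<gamma>\<close> is. Cutting the convolution of \<open>invol G f\<close>
  and \<open>g\<close> down to the kernel therefore keeps just the kernel rows of its
  matrix.\<close>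

lemma kin_conv_fs:
  assumes "v \<in> fs S x"
  shows "conv G \<sigma> (kin f g) v = (\<lambda>\<gamma>. if \<gamma> \<in> S then conv G \<sigma> (conv G \<sigma> (invol G f) g) v \<gamma> else 0)"
proof
  fix \<gamma>
  let ?k = "conv G \<sigma> (invol G f) g"
  show "conv G \<sigma> (kin f g) v \<gamma> = (if \<gamma> \<in> S then conv G \<sigma> ?k v \<gamma> else 0)"
  proof (cases "\<gamma> \<in> fibre x")
    case True
    have eq: "conv G \<sigma> h v \<gamma> = (\<Sum>\<eta>\<in>nonzeros v. mat h \<gamma> \<eta> * v \<eta>)" for h
      using fsD[OF assms] by (intro conv_eq[OF True]) (auto simp: nonzeros_def)
    have "mat (kin f g) \<gamma> \<eta> = (if \<gamma> \<in> S then mat ?k \<gamma> \<eta> else 0)" if "\<eta> \<in> nonzeros v" for \<eta>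
    proof -
      have \<eta>: "\<eta> \<in> S" "\<eta> \<in> fibre x" using that fsD[OF assms] by auto
      have "quo \<gamma> \<eta> \<in> S \<longleftrightarrow> \<gamma> \<in> S"
        using \<eta> True c_quo[OF True \<eta>(2)] quo_fibre[OF True \<eta>(2)] by (auto simp: S_def fibre_def)
      then show ?thesis by (simp add: mat_def kernel_inner_def)
    qed
    then show ?thesis unfolding eq by auto
  next
    case False
    then have "conv G \<sigma> (kin f g) v \<gamma> = 0" "conv G \<sigma> ?k v \<gamma> = 0"
      using conv_supp_fibre[OF assms, of "kin f g"] conv_supp_fibre[OF assms, of ?k]
      by (auto simp: nonzeros_def)
    then show ?thesis by simp
  qed
qed

text \<open>The compression in \<open>kin_conv_fs\<close> is invisible to \<open>w\<close>, which is
  supported on the kernel. So, tested on such vectors, \<open>kin f g\<close> is the operator of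
  \<open>g\<close> followed by the adjoint of that of \<open>f\<close>.\<close>

lemma ip_kin:
  assumes f: "f \<in> Cc G F" and g: "g \<in> Cc G F" and v: "v \<in> fs S x" and w: "w \<in> fs S x"
  shows "ip w (conv G \<sigma> (kin f g) v) = ip (conv G \<sigma> f w) (conv G \<sigma> g v)"
proof -
  have gv: "conv G \<sigma> g v \<in> fs (arrows G) x"
    by (rule conv_fs[OF fibre_finite_Cc[OF g] Cc_range[OF g] v])
  have "ip w (conv G \<sigma> (kin f g) v) = (\<Sum>\<gamma>\<in>nonzeros w. cnj (w \<gamma>) * conv G \<sigma> (kin f g) v \<gamma>)"
    by (rule ip_eq) (use fsD[OF w] in auto)
  also have "\<dots> = (\<Sum>\<gamma>\<in>nonzeros w. cnj (w \<gamma>) * conv G \<sigma> (conv G \<sigma> (invol G f) g) v \<gamma>)"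
    by (rule sum.cong) (use fsD(2)[OF w] in \<open>auto simp: kin_conv_fs[OF v]\<close>)
  also have "\<dots> = ip w (conv G \<sigma> (conv G \<sigma> (invol G f) g) v)"
    by (rule ip_eq[symmetric]) (use fsD[OF w] in auto)
  also have "conv G \<sigma> (conv G \<sigma> (invol G f) g) v = conv G \<sigma> (invol G f) (conv G \<sigma> g v)"
    by (rule conv_assoc[OF fibre_finite_Cc[OF g] fsD(5)[OF v]])
  also have "ip w \<dots> = ip (conv G \<sigma> f w) (conv G \<sigma> g v)"
    by (rule ip_conv[symmetric, OF fibre_finite_Cc[OF f] fibre_finite_invol[OF f] w gv])
  finally show ?thesis .
qed

text \<open>Cauchy-Schwarz in \<open>ip_kin\<close>, tested against \<open>?w\<close> itself, after
  which one factor cancels. The signs of \<open>C\<close> and \<open>D\<close> are not given, but a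
  nonzero \<open>v\<close> forces both to be nonnegative.\<close>

lemma bnd_kin:
  assumes f: "f \<in> Cc G F" "bnd S f C" and g: "g \<in> Cc G F" "bnd S g D"
  shows "bnd S (kin f g) (C * D)"
  unfolding bnd_def
proof (intro allI ballI)
  fix x v assume v: "v \<in> fs S x"
  let ?w = "conv G \<sigma> (kin f g) v"
  note k = kin_mem[OF f(1) g(1)]
  have "?w \<in> H.fs S x"
    using H.conv_fs[OF H.fibre_finite_Cc[OF k] H.Cc_range[OF k], of v S x] v
    by (simp add: H_fs H_conv[OF Cc_H_nonzeros[OF k] fsD(2)[OF v]])
  then have w: "?w \<in> fs S x" by (simp add: H_fs)
  note fw = finite_nonzeros_conv[OF fibre_finite_Cc[OF f(1)] w]
  note gv = finite_nonzeros_conv[OF fibre_finite_Cc[OF g(1)] v]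
  have le: "0 \<le> C * l2norm ?w" using order.trans[OF l2norm_nonneg bndD[OF f(2) w]] .
  have "(l2norm ?w)\<^sup>2 = cmod (ip ?w ?w)" by (simp add: ip_self[OF fsD(1)[OF w]] norm_power)
  also have "ip ?w ?w = ip (conv G \<sigma> f ?w) (conv G \<sigma> g v)" by (rule ip_kin[OF f(1) g(1) v w])
  also have "cmod \<dots> \<le> l2norm (conv G \<sigma> f ?w) * l2norm (conv G \<sigma> g v)" by (rule ip_le[OF fw gv])
  also have "\<dots> \<le> (C * l2norm ?w) * (D * l2norm v)"
    using le by (intro mult_mono bndD[OF f(2) w] bndD[OF g(2) v]) simp_all
  finally have *: "l2norm ?w * l2norm ?w \<le> (C * D * l2norm v) * l2norm ?w"
    by (simp add: power2_eq_square mult_ac)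
  show "l2norm ?w \<le> C * D * l2norm v"
  proof (cases "l2norm ?w > 0")
    case True
    with * show ?thesis by (rule mult_right_le_imp_le)
  next
    case False
    then have zero: "l2norm ?w = 0" using l2norm_nonneg[of ?w] by linarith
    have C: "0 \<le> C * l2norm v" using order.trans[OF l2norm_nonneg bndD[OF f(2) v]] .
    have D: "0 \<le> D * l2norm v" using order.trans[OF l2norm_nonneg bndD[OF g(2) v]] .
    have "0 \<le> C * D * l2norm v"
    proof (cases "l2norm v = 0")
      case False
      then have "l2norm v > 0" using l2norm_nonneg[of v] by linarith
      then have "0 \<le> C" "0 \<le> D" using C D by (simp_all add: zero_le_mult_iff)
      then show ?thesis by simp
    qed simp
    with zero show ?thesis by simp
  qed
qed

lemma N_nonneg: "f \<in> Cc G F \<Longrightarrow> 0 \<le> N f"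
  by (simp add: kernel_module_norm_def M_nonneg kin_mem)

lemma N_power2: "f \<in> Cc G F \<Longrightarrow> M (kin f f) = (N f)\<^sup>2"
  by (simp add: kernel_module_norm_def M_nonneg kin_mem)

text \<open>The C*-identity on the fibres: the square of the norm of \<open>f\<close> applied to
  \<open>v\<close> is the inner product of \<open>v\<close> with \<open>kin f f\<close> applied to
  \<open>v\<close>.\<close>

lemma N_le_iff:
  assumes f: "f \<in> Cc G F" and C: "C \<ge> 0"
  shows "N f \<le> C \<longleftrightarrow> bnd S f C"
proof -
  have "N f \<le> C \<longleftrightarrow> M (kin f f) \<le> C\<^sup>2"
    unfolding N_power2[OF f] using C N_nonneg[OF f] by (simp add: power_mono_iff)
  also have "\<dots> \<longleftrightarrow> bnd S (kin f f) (C\<^sup>2)" by (rule M_le_iff[OF kin_mem[OF f f]]) simp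
  also have "\<dots> \<longleftrightarrow> bnd S f C"
  proof
    assume k: "bnd S (kin f f) (C\<^sup>2)"
    show "bnd S f C"
      unfolding bnd_def
    proof (intro allI ballI)
      fix x v assume v: "v \<in> fs S x"
      note fv = finite_nonzeros_conv[OF fibre_finite_Cc[OF f] v]
      have kv: "finite (nonzeros (conv G \<sigma> (kin f f) v))"
        by (rule finite_nonzeros_conv[OF fibre_finite_Cc[OF Cc_H_Cc[OF kin_mem[OF f f]]] v])
      have "(l2norm (conv G \<sigma> f v))\<^sup>2 = cmod (ip v (conv G \<sigma> (kin f f) v))"
        by (simp add: ip_kin[OF f f v v] ip_self[OF fv] norm_power)
      also have "\<dots> \<le> l2norm v * l2norm (conv G \<sigma> (kin f f) v)" by (rule ip_le[OF fsD(1)[OF v] kv])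
      also have "\<dots> \<le> l2norm v * (C\<^sup>2 * l2norm v)" by (intro mult_left_mono bndD[OF k v]) simp
      also have "\<dots> = (C * l2norm v)\<^sup>2" by (simp add: power2_eq_square)
      finally show "l2norm (conv G \<sigma> f v) \<le> C * l2norm v"
        by (rule power2_le_imp_le) (simp add: C)
    qed
  next
    assume "bnd S f C"
    then show "bnd S (kin f f) (C\<^sup>2)" using bnd_kin[OF f _ f] by (simp add: power2_eq_square)
  qed
  finally show ?thesis .
qed

lemma N_bnd: "f \<in> Cc G F \<Longrightarrow> bnd S f (N f)"
  using N_le_iff N_nonneg by blast

text \<open>Applied to \<open>v\<close>, the function \<open>h\<close> may leave the kernel, so
  \<open>f\<close> has to be bounded by its norm over all arrows.\<close>

lemma N_conv_left:
  assumes f: "f \<in> Cc G F" and h: "h \<in> Cc G F"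
  shows "N (conv G \<sigma> f h) \<le> R f * N h"
proof -
  have "bnd S (conv G \<sigma> f h) (R f * N h)"
    unfolding bnd_def
  proof (intro allI ballI)
    fix x v assume v: "v \<in> fs S x"
    have "l2norm (conv G \<sigma> (conv G \<sigma> f h) v) = l2norm (conv G \<sigma> f (conv G \<sigma> h v))"
      by (simp add: conv_assoc[OF fibre_finite_Cc[OF h] fsD(5)[OF v]])
    also have "\<dots> \<le> R f * l2norm (conv G \<sigma> h v)"
      by (rule bndD[OF R_bnd[OF f] conv_fs[OF fibre_finite_Cc[OF h] Cc_range[OF h] v]])
    also have "\<dots> \<le> R f * (N h * l2norm v)"
      by (intro mult_left_mono bndD[OF N_bnd[OF h] v] reduced_norm_le_iff(2)[OF f])
    finally show "l2norm (conv G \<sigma> (conv G \<sigma> f h) v) \<le> R f * N h * l2norm v" by (simp add: mult.assoc)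
  qed
  then show ?thesis
    using N_le_iff[OF Cc_conv[OF f h], of "R f * N h"] reduced_norm_le_iff(2)[OF f] N_nonneg[OF h] by simp
qed

text \<open>Here \<open>w\<close> keeps \<open>v\<close> inside the kernel, so the module norm of
  \<open>f\<close> is enough.\<close>

lemma N_conv_right:
  assumes f: "f \<in> Cc G F" and w: "w \<in> Cc H F"
  shows "N (conv G \<sigma> f w) \<le> N f * M w"
proof -
  note w' = Cc_H_Cc[OF w]
  have "bnd S (conv G \<sigma> f w) (N f * M w)"
    unfolding bnd_def
  proof (intro allI ballI)
    fix x v assume v: "v \<in> fs S x"
    have "conv G \<sigma> w v \<in> H.fs S x"
      using H.conv_fs[OF H.fibre_finite_Cc[OF w] H.Cc_range[OF w], of v S x] v
      by (simp add: H_fs H_conv[OF Cc_H_nonzeros[OF w] fsD(2)[OF v]])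
    then have wv: "conv G \<sigma> w v \<in> fs S x" by (simp add: H_fs)
    have "l2norm (conv G \<sigma> (conv G \<sigma> f w) v) = l2norm (conv G \<sigma> f (conv G \<sigma> w v))"
      by (simp add: conv_assoc[OF fibre_finite_Cc[OF w'] fsD(5)[OF v]])
    also have "\<dots> \<le> N f * l2norm (conv G \<sigma> w v)" by (rule bndD[OF N_bnd[OF f] wv])
    also have "\<dots> \<le> N f * (M w * l2norm v)"
      by (intro mult_left_mono bndD[OF M_bnd[OF w] v] N_nonneg[OF f])
    finally show "l2norm (conv G \<sigma> (conv G \<sigma> f w) v) \<le> N f * M w * l2norm v" by (simp add: mult.assoc)
  qed
  then show ?thesis
    using N_le_iff[OF Cc_conv[OF f w'], of "N f * M w"] N_nonneg[OF f] M_nonneg[OF w] by simp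
qed

lemma M_kin_le:
  assumes f: "f \<in> Cc G F" and g: "g \<in> Cc G F"
  shows "M (kin f g) \<le> N f * N g"
  using M_le_iff[OF kin_mem[OF f g], of "N f * N g"] bnd_kin[OF f N_bnd[OF f] g N_bnd[OF g]]
    N_nonneg[OF f] N_nonneg[OF g] by simp

lemma kin_diff_left:
  assumes "g \<in> Cc G F"
  shows "kin (\<lambda>\<gamma>. f \<gamma> - f' \<gamma>) g = (\<lambda>\<gamma>. kin f g \<gamma> - kin f' g \<gamma>)"
  by (auto simp: kernel_inner_def invol_diff conv_diff_left[OF fibre_finite_Cc[OF assms]])

lemma kin_diff_right:
  assumes "g \<in> Cc G F" "g' \<in> Cc G F"
  shows "kin f (\<lambda>\<gamma>. g \<gamma> - g' \<gamma>) = (\<lambda>\<gamma>. kin f g \<gamma> - kin f g' \<gamma>)"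
  by (auto simp: kernel_inner_def conv_diff_right[OF assms[THEN fibre_finite_Cc]])

lemma kin_zero: "kin f (\<lambda>_. 0) = (\<lambda>_. 0)" "kin (\<lambda>_. 0) g = (\<lambda>_. 0)"
proof -
  have "invol G (\<lambda>_. 0) = (\<lambda>_. 0)" by (auto simp: invol_def)
  then show "kin f (\<lambda>_. 0) = (\<lambda>_. 0)" "kin (\<lambda>_. 0) g = (\<lambda>_. 0)"
    by (auto simp: kernel_inner_def conv_zero_right conv_zero_left)
qed

lemma kin_conv:
  assumes "f \<in> Cc G F" "h \<in> Cc G F" "k \<in> Cc G F"
  shows "kin (conv G \<sigma> f h) k = kin h (conv G \<sigma> (invol G f) k)"
proof -
  have "conv G \<sigma> (invol G (conv G \<sigma> f h)) k = conv G \<sigma> (invol G h) (conv G \<sigma> (invol G f) k)"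
    using assms by (simp add: invol_conv fibre_finite_Cc fibre_finite_invol conv_assoc)
  then show ?thesis by (simp only: kernel_inner_def[abs_def])
qed

text \<open>Rank one operators vanish on functions supported far out in the direction of the cocycle.\<close>

lemma kin_separated:
  assumes "\<And>\<gamma>. \<gamma> \<in> nonzeros f \<Longrightarrow> c \<gamma> \<le> m" "\<And>\<gamma>. \<gamma> \<in> nonzeros g \<Longrightarrow> m < c \<gamma>"
  shows "kin f g = (\<lambda>_. 0)"
proof (rule ext, rule ccontr)
  fix \<gamma> assume ne: "kin f g \<gamma> \<noteq> 0"
  then have S: "\<gamma> \<in> S" using kin_outside by blast
  with ne have "\<gamma> \<in> nonzeros (conv G \<sigma> (invol G f) g)" by (simp add: kernel_inner_def nonzeros_def)
  then obtain \<xi> \<eta> where *: "\<xi> \<in> nonzeros (invol G f)" "\<eta> \<in> nonzeros g" "(\<xi>, \<eta>) \<in> composable G" "mul G \<xi> \<eta> = \<gamma>"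
    by (rule nonzeros_conv)
  have \<xi>: "\<xi> \<in> arrows G" "ginv G \<xi> \<in> nonzeros f"
    using *(1) by (auto simp: nonzeros_def invol_def split: if_splits)
  have "c \<xi> + c \<eta> = 0" using c_mul[OF *(3)] *(4) S by (simp add: S_def)
  then have "c (ginv G \<xi>) = c \<eta>" using c_ginv[OF \<xi>(1)] by simp
  with assms(1)[OF \<xi>(2)] assms(2)[OF *(2)] show False by simp
qed

lemma N_seminorm: "function_seminorm (Cc G F) N"
  by (rule seminorm_of_bnd[OF N_nonneg N_le_iff])

lemma M_seminorm: "function_seminorm (Cc H F) M"
  by (rule H.R_seminorm)

lemma act_bounded: "bounded_op2 (Cc G F) (Cc H F) (Cc G F) N M N (conv G \<sigma>)"
  by (rule bounded_op2_bilinear[OF N_seminorm M_seminorm N_seminorm])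
    (simp_all add: Cc_conv Cc_H_Cc conv_diff_left conv_diff_right fibre_finite_Cc N_conv_right)

lemma left_bounded: "bounded_op2 (Cc G F) (Cc G F) (Cc G F) R N N (conv G \<sigma>)"
  by (rule bounded_op2_bilinear[OF R_seminorm N_seminorm N_seminorm])
    (simp_all add: Cc_conv conv_diff_left conv_diff_right fibre_finite_Cc N_conv_left)

lemma inner_bounded: "bounded_op2 (Cc G F) (Cc G F) (Cc H F) N N M kin"
  by (rule bounded_op2_bilinear[OF N_seminorm N_seminorm M_seminorm])
    (simp_all add: kin_mem kin_diff_left kin_diff_right M_kin_le)

lemma cocycle_bounded:
  assumes "f \<in> Cc G F"
  obtains B where "B \<ge> 0" "\<And>\<gamma>. \<gamma> \<in> nonzeros f \<Longrightarrow> \<bar>c \<gamma>\<bar> \<le> B"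
proof -
  obtain K where K: "compactin X K" "nonzeros f \<subseteq> K" "K \<subseteq> arrows G" by (rule Cc_compact[OF assms])
  have "compact (c ` K)" using image_compactin[OF K(1) c_cont] by simp
  then have "bounded (c ` K)" by (rule compact_imp_bounded)
  then obtain B where B: "\<forall>z\<in>c ` K. \<bar>z\<bar> \<le> B" unfolding bounded_iff real_norm_def by blast
  have "\<bar>c \<gamma>\<bar> \<le> max B 0" if "\<gamma> \<in> nonzeros f" for \<gamma>
    using that B K(2) by (auto simp: le_max_iff_disj)
  then show thesis using that[of "max B 0"] by simp
qed

lemma l2norm_unit_le_N:
  assumes f: "f \<in> Cc G F" and x: "x \<in> units G"
  shows "l2norm (conv G \<sigma> f (delta x)) \<le> N f"
proof -
  have "delta x \<in> fs S x" using x units_S by (intro delta_fs unit_fibre) auto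
  from bndD[OF N_bnd[OF f] this] show ?thesis by simp
qed

end

locale cutoff = kernel_cocycle G F \<sigma> c \<mu>
  for G :: "'g groupoid" and F \<sigma> c \<mu> +
  fixes chi :: "real \<Rightarrow> real" and \<epsilon> :: real
  assumes chi_cont: "continuous_on UNIV chi"
    and chi_mono: "mono chi"
    and chi_neg: "\<And>x. x \<le> - \<epsilon> \<Longrightarrow> chi x = 0"
    and chi_pos: "\<And>x. x \<ge> 0 \<Longrightarrow> chi x = 1"
begin

section \<open>The cutoff as a multiplication operator\<close>

lemma chi_bounds: "0 \<le> chi x" "chi x \<le> 1"
proof -
  have "chi (min x (- \<epsilon>)) \<le> chi x" "chi x \<le> chi (max x 0)"
    using chi_mono by (auto intro: monoD)
  then show "0 \<le> chi x" "chi x \<le> 1" by (simp_all add: chi_neg chi_pos)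
qed

definition cut :: "('g \<Rightarrow> complex) \<Rightarrow> 'g \<Rightarrow> complex" where
  "cut f \<eta> = complex_of_real (chi (c \<eta>)) * f \<eta>"

lemma cut_mem:
  assumes "f \<in> Cc G F"
  shows "cut f \<in> Cc G F"
proof -
  have "continuous_map X euclideanreal (chi \<circ> c)"
    by (rule continuous_map_compose[OF c_cont]) (simp add: chi_cont)
  from continuous_map_of_real[OF this]
  have "continuous_map X euclidean (\<lambda>\<eta>. complex_of_real (chi (c \<eta>)))" by (simp add: o_def)
  from Cc_mult[OF assms this] scalar_closed(7) show ?thesis by (auto simp: cut_def[abs_def])
qed

lemma cut_diff: "cut (\<lambda>\<gamma>. f \<gamma> - g \<gamma>) = (\<lambda>\<gamma>. cut f \<gamma> - cut g \<gamma>)"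
  by (simp add: cut_def[abs_def] algebra_simps)

lemma norm_cut_le: "cmod (cut f \<gamma>) \<le> cmod (f \<gamma>)"
  by (simp add: cut_def norm_mult chi_bounds mult_left_le_one_le)

lemma cut_id: "(\<And>\<gamma>. \<gamma> \<in> nonzeros f \<Longrightarrow> 0 \<le> c \<gamma>) \<Longrightarrow> cut f = f"
proof
  fix \<gamma> assume "\<And>\<gamma>. \<gamma> \<in> nonzeros f \<Longrightarrow> 0 \<le> c \<gamma>"
  then show "cut f \<gamma> = f \<gamma>" by (cases "f \<gamma> = 0") (simp_all add: cut_def nonzeros_def chi_pos)
qed

text \<open>When \<open>b\<close> is in the kernel, \<open>c\<close> has the same value at
  \<open>quo a b\<close> as at \<open>a\<close>. The cutoff thus multiplies the rows by
  \<open>chi (c a)\<close>, a real diagonal matrix with entries between 0 and 1; contractivity and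
  self-adjointness both come from this.\<close>

lemma mat_cut:
  assumes "a \<in> fibre x" "b \<in> fibre x" "b \<in> S"
  shows "mat (cut f) a b = complex_of_real (chi (c a)) * mat f a b"
  using c_quo[OF assms(1,2)] assms(3) by (simp add: mat_def cut_def S_def)

lemma N_cut_le:
  assumes f: "f \<in> Cc G F"
  shows "N (cut f) \<le> N f"
proof -
  have "bnd S (cut f) (N f)"
    unfolding bnd_def
  proof (intro allI ballI)
    fix x v assume v: "v \<in> fs S x"
    note v' = fsD[OF v]
    have "cmod (conv G \<sigma> (cut f) v \<gamma>) \<le> cmod (conv G \<sigma> f v \<gamma>)" for \<gamma>
    proof (cases "\<gamma> \<in> fibre x")
      case True
      have eq: "conv G \<sigma> h v \<gamma> = (\<Sum>\<eta>\<in>nonzeros v. mat h \<gamma> \<eta> * v \<eta>)" for h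
        using v' by (intro conv_eq[OF True]) (auto simp: nonzeros_def)
      have "conv G \<sigma> (cut f) v \<gamma> = (\<Sum>\<eta>\<in>nonzeros v. complex_of_real (chi (c \<gamma>)) * (mat f \<gamma> \<eta> * v \<eta>))"
        unfolding eq
      proof (rule sum.cong[OF refl])
        fix \<eta> assume "\<eta> \<in> nonzeros v"
        then have "\<eta> \<in> fibre x" "\<eta> \<in> S" using v'(2,3) by auto
        then show "mat (cut f) \<gamma> \<eta> * v \<eta> = complex_of_real (chi (c \<gamma>)) * (mat f \<gamma> \<eta> * v \<eta>)"
          by (simp add: mat_cut[OF True])
      qed
      then have "conv G \<sigma> (cut f) v \<gamma> = cut (conv G \<sigma> f v) \<gamma>"
        by (simp add: eq cut_def sum_distrib_left)
      then show ?thesis by (simp add: norm_cut_le)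
    next
      case False
      then have "conv G \<sigma> (cut f) v \<gamma> = 0"
        using conv_supp_fibre[OF v, of "cut f"] by (auto simp: nonzeros_def)
      then show ?thesis by simp
    qed
    then have "l2norm (conv G \<sigma> (cut f) v) \<le> l2norm (conv G \<sigma> f v)"
      by (rule l2norm_mono[OF finite_nonzeros_conv[OF fibre_finite_Cc[OF f] v]])
    also have "\<dots> \<le> N f * l2norm v" by (rule bndD[OF N_bnd[OF f] v])
    finally show "l2norm (conv G \<sigma> (cut f) v) \<le> N f * l2norm v" .
  qed
  then show ?thesis using N_le_iff[OF cut_mem[OF f] N_nonneg[OF f]] by simp
qed

lemma kin_cut:
  assumes f: "f \<in> Cc G F" and g: "g \<in> Cc G F"
  shows "kin (cut f) g = kin f (cut g)"
proof
  fix \<gamma>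
  show "kin (cut f) g \<gamma> = kin f (cut g) \<gamma>"
  proof (cases "\<gamma> \<in> S")
    case True
    define x where "x = src G \<gamma>"
    have \<gamma>: "\<gamma> \<in> fibre x" using True S_arrows by (simp add: x_def fibre_self)
    let ?B = "fibre x \<inter> nonzeros g"
    have fin: "finite ?B" using fibre_finite_Cc[OF g] by (simp add: fibre_finite_def)
    have "kin (cut f) g \<gamma> = (\<Sum>\<eta>\<in>?B. cnj (mat (cut f) \<eta> \<gamma>) * g \<eta>)"
      by (rule kin_eq[OF fibre_finite_Cc[OF g] True \<gamma>])
    also have "\<dots> = (\<Sum>\<eta>\<in>?B. mat (invol G f) \<gamma> \<eta> * cut g \<eta>)"
      by (rule sum.cong) (auto simp: mat_cut[OF _ \<gamma> True] cut_def mat_invol[OF \<gamma>])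
    also have "\<dots> = conv G \<sigma> (invol G f) (cut g) \<gamma>"
      by (rule conv_eq[OF \<gamma> fin, symmetric]) (auto simp: cut_def nonzeros_def)
    finally show ?thesis using True by (simp add: kernel_inner_def)
  qed (simp add: kin_outside)
qed

end


section \<open>Operators on the Hilbert module\<close>

context cutoff
begin

abbreviation E where "E \<equiv> kernel_module G F \<sigma> c"
abbreviation CV where "CV \<equiv> cauchy_seqs (Cc G F) N"
abbreviation cls where "cls \<equiv> seq_class (Cc G F) N"
abbreviation RV where "RV \<equiv> cauchy_seqs (Cc G F) R"
abbreviation Rcls where "Rcls \<equiv> seq_class (Cc G F) R"

interpretation N: function_seminorm "Cc G F" N by (rule N_seminorm)
interpretation R: function_seminorm "Cc G F" R by (rule R_seminorm)
interpretation M: function_seminorm "Cc H F" M by (rule M_seminorm)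
interpretation act: bounded_op2 "Cc G F" "Cc H F" "Cc G F" N M N "conv G \<sigma>" by (rule act_bounded)
interpretation left: bounded_op2 "Cc G F" "Cc G F" "Cc G F" R N N "conv G \<sigma>" by (rule left_bounded)
interpretation inner: bounded_op2 "Cc G F" "Cc G F" "Cc H F" N N M kin by (rule inner_bounded)
interpretation plus: bounded_op2 "Cc G F" "Cc G F" "Cc G F" N N N "\<lambda>f g \<gamma>. f \<gamma> + g \<gamma>"
  by (rule N.bounded_op2_add_diff(1))
interpretation minus: bounded_op2 "Cc G F" "Cc G F" "Cc G F" N N N "\<lambda>f g \<gamma>. f \<gamma> - g \<gamma>"
  by (rule N.bounded_op2_add_diff(2))
interpretation Rminus: bounded_op2 "Cc G F" "Cc G F" "Cc G F" R R R "\<lambda>f g \<gamma>. f \<gamma> - g \<gamma>"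
  by (rule R.bounded_op2_add_diff(2))

lemma carrier_E: "hcarrier E = completion (Cc G F) N"
  by (simp add: kernel_module_def Let_def)

lemma cls_mem: "u \<in> CV \<Longrightarrow> cls u \<in> hcarrier E"
  by (simp add: carrier_E N.seq_class_mem)

lemma carrier_cases:
  assumes "z \<in> hcarrier E"
  obtains u where "u \<in> CV" "z = cls u"
  using assms unfolding carrier_E by (rule N.completion_cases)

lemma E_add: "u \<in> CV \<Longrightarrow> v \<in> CV \<Longrightarrow> hadd E (cls u) (cls v) = cls (\<lambda>n \<gamma>. u n \<gamma> + v n \<gamma>)"
  by (simp add: kernel_module_def Let_def plus.extend2_seq_class)

lemma E_minus: "u \<in> CV \<Longrightarrow> v \<in> CV \<Longrightarrow> hminus E (cls u) (cls v) = cls (\<lambda>n \<gamma>. u n \<gamma> - v n \<gamma>)"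
  by (simp add: kernel_module_def Let_def minus.extend2_seq_class)

lemma E_inner: "u \<in> CV \<Longrightarrow> v \<in> CV \<Longrightarrow>
    hinner E (cls u) (cls v) = seq_class (Cc H F) M (\<lambda>n. kin (u n) (v n))"
  by (simp add: kernel_module_def Let_def inner.extend2_seq_class)

lemma E_rank_one:
  assumes "u \<in> CV" "w \<in> CV" "z \<in> CV"
  shows "rank_one E (cls u) (cls w) (cls z) = cls (\<lambda>n. conv G \<sigma> (u n) (kin (w n) (z n)))"
proof -
  have "hact E = extend2 (Cc G F) N (conv G \<sigma>)" by (simp add: kernel_module_def Let_def)
  then show ?thesis
    using assms by (simp add: rank_one_def cls_mem E_inner act.extend2_seq_class inner.op_cauchy)
qed

text \<open>The square of \<open>N (u n)\<close> is the coefficient norm of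
  \<open>kin (u n) (u n)\<close>, so the limits in the two completions match.\<close>

lemma hnorm_tendsto:
  assumes "u \<in> CV"
  shows "(\<lambda>n. N (u n)) \<longlonglongrightarrow> hnorm E (cls u)"
proof -
  obtain l where l: "(\<lambda>n. N (u n)) \<longlonglongrightarrow> l"
    using N.cauchy_norm[OF assms] by (auto simp: Cauchy_convergent_iff convergent_def)
  have "l \<ge> 0"
    by (rule LIMSEQ_le_const[OF l]) (auto simp: N_nonneg N.cauchy_seqsD[OF assms])
  have "(\<lambda>n. M (kin (u n) (u n))) \<longlonglongrightarrow> l\<^sup>2"
    using tendsto_power[OF l, of 2] by (simp add: N_power2 N.cauchy_seqsD[OF assms])
  from M.completion_norm_seq_class[OF inner.op_cauchy[OF assms assms] this]
  have "hcoeff_norm E (hinner E (cls u) (cls u)) = l\<^sup>2"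
    unfolding E_inner[OF assms assms] by (simp add: kernel_module_def Let_def)
  with \<open>l \<ge> 0\<close> l show ?thesis by (simp add: hnorm_def)
qed

lemma hnorm_const: "f \<in> Cc G F \<Longrightarrow> hnorm E (cls (\<lambda>_. f)) = N f"
  using LIMSEQ_unique[OF hnorm_tendsto[OF N.const_cauchy] tendsto_const] by blast

lemma hnorm_mono:
  assumes "u \<in> CV" "v \<in> CV" "\<And>n. n \<ge> n0 \<Longrightarrow> N (u n) \<le> C * N (v n)"
  shows "hnorm E (cls u) \<le> C * hnorm E (cls v)"
  by (rule LIMSEQ_le[OF hnorm_tendsto[OF assms(1)] tendsto_mult_left[OF hnorm_tendsto[OF assms(2)]]])
    (use assms(3) in blast)

lemma E_closed:
  assumes "x \<in> hcarrier E" "y \<in> hcarrier E"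
  shows "hadd E x y \<in> hcarrier E" "hminus E x y \<in> hcarrier E"
    and "hnorm E (hadd E x y) \<le> hnorm E x + hnorm E y"
    and "hnorm E (hminus E x y) \<le> hnorm E x + hnorm E y"
    and "hnorm E x \<le> hnorm E (hminus E x y) + hnorm E y"
proof -
  obtain u v where u: "u \<in> CV" "x = cls u" and v: "v \<in> CV" "y = cls v"
    using assms by (metis carrier_cases)
  note mem = N.cauchy_seqsD[OF u(1)] N.cauchy_seqsD[OF v(1)]
  note p = plus.op_cauchy[OF u(1) v(1)] and m = minus.op_cauchy[OF u(1) v(1)]
  note lims = hnorm_tendsto[OF u(1)] hnorm_tendsto[OF v(1)]
  show "hadd E x y \<in> hcarrier E" "hminus E x y \<in> hcarrier E"
    using u v p m by (simp_all add: E_add E_minus cls_mem)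
  show "hnorm E (hadd E x y) \<le> hnorm E x + hnorm E y"
    unfolding u(2) v(2) E_add[OF u(1) v(1)]
    by (rule LIMSEQ_le[OF hnorm_tendsto[OF p] tendsto_add[OF lims]]) (auto simp: N.add_le mem)
  show "hnorm E (hminus E x y) \<le> hnorm E x + hnorm E y"
    unfolding u(2) v(2) E_minus[OF u(1) v(1)]
    by (rule LIMSEQ_le[OF hnorm_tendsto[OF m] tendsto_add[OF lims]]) (auto simp: N.diff_le mem)
  have "N (u n) \<le> N (\<lambda>\<gamma>. u n \<gamma> - v n \<gamma>) + N (v n)" for n
    using N.reverse_triangle[OF mem(1)[of n] mem(2)[of n]] by (simp add: abs_le_iff)
  then show "hnorm E x \<le> hnorm E (hminus E x y) + hnorm E y"
    unfolding u(2) v(2) E_minus[OF u(1) v(1)]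
    by (intro LIMSEQ_le[OF lims(1) tendsto_add[OF hnorm_tendsto[OF m] lims(2)]]) auto
qed

text \<open>\<open>op_norm\<close> is a supremum of reals and says nothing unless its set is
  bounded; the explicit bound carried here is what \<open>le_op_norm\<close> relies on.\<close>

definition bounded_op :: "('g completed \<Rightarrow> 'g completed) \<Rightarrow> bool" where
  "bounded_op T \<longleftrightarrow> (\<forall>z\<in>hcarrier E. T z \<in> hcarrier E) \<and>
     (\<exists>C\<ge>0. \<forall>z\<in>hcarrier E. hnorm E (T z) \<le> C * hnorm E z)"

lemma bounded_op_minus:
  assumes "bounded_op T" "bounded_op T'"
  shows "bounded_op (op_minus E T T')"
proof -
  obtain C D where CD: "C \<ge> 0" "D \<ge> 0" "\<And>z. z \<in> hcarrier E \<Longrightarrow> hnorm E (T z) \<le> C * hnorm E z"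
      "\<And>z. z \<in> hcarrier E \<Longrightarrow> hnorm E (T' z) \<le> D * hnorm E z"
    and mem: "\<And>z. z \<in> hcarrier E \<Longrightarrow> T z \<in> hcarrier E" "\<And>z. z \<in> hcarrier E \<Longrightarrow> T' z \<in> hcarrier E"
    using assms unfolding bounded_op_def by auto
  have "hnorm E (op_minus E T T' z) \<le> (C + D) * hnorm E z" if "z \<in> hcarrier E" for z
    using E_closed(4)[OF mem(1)[OF that] mem(2)[OF that]] CD(3)[OF that] CD(4)[OF that] that
    by (simp add: op_minus_def algebra_simps)
  then show ?thesis
    unfolding bounded_op_def using CD(1,2) mem E_closed(2)
    by (intro conjI exI[of _ "C + D"]) (auto simp: op_minus_def)
qed

lemma le_op_norm:
  assumes T: "bounded_op T" and z: "z \<in> hcarrier E" "hnorm E z \<le> 1"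
  shows "hnorm E (T z) \<le> op_norm E T"
proof -
  obtain C where C: "C \<ge> 0" "\<And>z. z \<in> hcarrier E \<Longrightarrow> hnorm E (T z) \<le> C * hnorm E z"
    using T by (auto simp: bounded_op_def)
  have "bdd_above {hnorm E (T z) | z. z \<in> hcarrier E \<and> hnorm E z \<le> 1}"
  proof (rule bdd_aboveI[of _ C])
    fix r assume "r \<in> {hnorm E (T z) | z. z \<in> hcarrier E \<and> hnorm E z \<le> 1}"
    then obtain z where "r = hnorm E (T z)" "z \<in> hcarrier E" "hnorm E z \<le> 1" by blast
    then show "r \<le> C" using C(2)[of z] mult_left_le[of "hnorm E z" C] C(1) by linarith
  qed
  then show ?thesis unfolding op_norm_def using z by (intro cSup_upper) blast+
qed

text \<open>The threshold \<open>m\<close> depends on the error only and not on \<open>h\<close>.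
  This uniformity allows the test function to be chosen after the finite rank operator.\<close>

definition vanishes_far :: "('g completed \<Rightarrow> 'g completed) \<Rightarrow> bool" where
  "vanishes_far T \<longleftrightarrow> (\<forall>e>0. \<exists>m. \<forall>h\<in>Cc G F. (\<forall>\<gamma>\<in>nonzeros h. m < c \<gamma>) \<longrightarrow>
     hnorm E (T (cls (\<lambda>_. h))) \<le> e * N h)"

text \<open>The second vector is a limit and has no bounded support of its own. It is replaced by a
  nearby member \<open>w n0\<close> of its sequence, on whose support \<open>c\<close> is at most
  \<open>m\<close>; this one pairs to zero with functions beyond \<open>m\<close>, and the remainder
  is small in norm.\<close>

lemma rank_one_far:
  assumes u: "u \<in> CV" and w: "w \<in> CV"
  shows "bounded_op (rank_one E (cls u) (cls w))" "vanishes_far (rank_one E (cls u) (cls w))"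
proof -
  let ?T = "rank_one E (cls u) (cls w)"
  obtain A where A: "A > 0" "\<And>n. N (u n) \<le> A" using N.cauchy_bounded[OF u] by blast
  obtain B where B: "B > 0" "\<And>n. N (w n) \<le> B" using N.cauchy_bounded[OF w] by blast
  note mem = N.cauchy_seqsD[OF u] N.cauchy_seqsD[OF w]
  have cau: "(\<lambda>n. conv G \<sigma> (u n) (kin (w n) (z n))) \<in> CV" if "z \<in> CV" for z
    by (rule act.op_cauchy[OF u inner.op_cauchy[OF w that]])
  have le: "N (conv G \<sigma> (u n) (kin g h)) \<le> A * (N g * N h)"
    if "g \<in> Cc G F" "h \<in> Cc G F" for n g h
  proof -
    have "N (conv G \<sigma> (u n) (kin g h)) \<le> N (u n) * M (kin g h)"
      by (rule N_conv_right[OF mem(1) kin_mem[OF that]])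
    also have "\<dots> \<le> A * (N g * N h)"
      using A by (intro mult_mono M_kin_le that) (auto simp: M_nonneg kin_mem that)
    finally show ?thesis .
  qed
  show "bounded_op ?T"
    unfolding bounded_op_def
  proof (intro conjI ballI exI)
    fix z assume "z \<in> hcarrier E"
    then obtain v where v: "v \<in> CV" "z = cls v" by (rule carrier_cases)
    show "?T z \<in> hcarrier E" using v cau by (simp add: E_rank_one[OF u w] cls_mem)
    have "N (conv G \<sigma> (u n) (kin (w n) (v n))) \<le> (A * B) * N (v n)" for n
    proof -
      have "A * (N (w n) * N (v n)) \<le> A * (B * N (v n))"
        using A B N_nonneg[OF N.cauchy_seqsD[OF v(1)]] by (intro mult_left_mono mult_right_mono) auto
      with le[OF mem(2)[of n] N.cauchy_seqsD[OF v(1), of n], of n] show ?thesis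
        by (simp add: mult.assoc)
    qed
    then show "hnorm E (?T z) \<le> (A * B) * hnorm E z"
      unfolding v(2) E_rank_one[OF u w v(1)] by (intro hnorm_mono[OF cau[OF v(1)] v(1)])
  qed (use A B in simp)
  show "vanishes_far ?T"
    unfolding vanishes_far_def
  proof (intro allI impI)
    fix e :: real assume e: "e > 0"
    \<comment> \<open>\<open>A\<close> bounds the first vector, by which the error in the second one
      gets multiplied.\<close>
    then have "e / A > 0" using A by simp
    then obtain n0 where n0: "\<And>m n. m \<ge> n0 \<Longrightarrow> n \<ge> n0 \<Longrightarrow> N (\<lambda>\<gamma>. w m \<gamma> - w n \<gamma>) < e / A"
      by (rule N.cauchy_seqsD2[OF w]) blast
    obtain m where m: "\<And>\<gamma>. \<gamma> \<in> nonzeros (w n0) \<Longrightarrow> \<bar>c \<gamma>\<bar> \<le> m"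
      using cocycle_bounded[OF mem(2)[of n0]] by blast
    show "\<exists>m. \<forall>h\<in>Cc G F. (\<forall>\<gamma>\<in>nonzeros h. m < c \<gamma>) \<longrightarrow> hnorm E (?T (cls (\<lambda>_. h))) \<le> e * N h"
    proof (intro exI ballI impI)
      fix h assume h: "h \<in> Cc G F" "\<forall>\<gamma>\<in>nonzeros h. m < c \<gamma>"
      have zero: "kin (w n0) h = (\<lambda>_. 0)"
        by (rule kin_separated[of _ m]) (use m h(2) in \<open>auto simp: abs_le_iff\<close>)
      have "N (conv G \<sigma> (u n) (kin (w n) h)) \<le> e * N h" if "n \<ge> n0" for n
      proof -
        have "kin (w n) h = kin (\<lambda>\<gamma>. w n \<gamma> - w n0 \<gamma>) h" by (simp add: kin_diff_left[OF h(1)] zero)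
        then have "N (conv G \<sigma> (u n) (kin (w n) h)) \<le> A * (N (\<lambda>\<gamma>. w n \<gamma> - w n0 \<gamma>) * N h)"
          using le[OF N.diff_mem[OF mem(2) mem(2)] h(1)] by simp
        also have "\<dots> \<le> A * ((e / A) * N h)"
          using A n0[of n n0] that N_nonneg[OF h(1)] by (intro mult_left_mono mult_right_mono) auto
        finally show ?thesis using A by simp
      qed
      then have "hnorm E (cls (\<lambda>n. conv G \<sigma> (u n) (kin (w n) h))) \<le> e * hnorm E (cls (\<lambda>_. h))"
        by (intro hnorm_mono[OF cau[OF N.const_cauchy[OF h(1)]] N.const_cauchy[OF h(1)]])
      then show "hnorm E (?T (cls (\<lambda>_. h))) \<le> e * N h"
        by (simp add: E_rank_one[OF u w N.const_cauchy[OF h(1)]] hnorm_const[OF h(1)])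
    qed
  qed
qed

lemma finite_rank_far:
  assumes "T \<in> finite_rank E"
  shows "bounded_op T \<and> vanishes_far T"
  using assms
proof induction
  case (rank_one x y)
  then obtain u w where "u \<in> CV" "x = cls u" "w \<in> CV" "y = cls w" by (metis carrier_cases)
  then show ?case using rank_one_far by simp
next
  case (add T T')
  let ?T = "\<lambda>z\<in>hcarrier E. hadd E (T z) (T' z)"
  have mem: "\<And>z. z \<in> hcarrier E \<Longrightarrow> T z \<in> hcarrier E" "\<And>z. z \<in> hcarrier E \<Longrightarrow> T' z \<in> hcarrier E"
    using add unfolding bounded_op_def by auto
  have tri: "hnorm E (?T z) \<le> hnorm E (T z) + hnorm E (T' z)" if "z \<in> hcarrier E" for z
    using E_closed(3)[OF mem(1)[OF that] mem(2)[OF that]] that by simp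
  obtain C D where CD: "C \<ge> 0" "D \<ge> 0" "\<And>z. z \<in> hcarrier E \<Longrightarrow> hnorm E (T z) \<le> C * hnorm E z"
      "\<And>z. z \<in> hcarrier E \<Longrightarrow> hnorm E (T' z) \<le> D * hnorm E z"
    using add unfolding bounded_op_def by auto
  show ?case
  proof
    show "bounded_op ?T"
      unfolding bounded_op_def
    proof (intro conjI ballI exI)
      fix z assume z: "z \<in> hcarrier E"
      show "?T z \<in> hcarrier E" using z mem E_closed(1) by simp
      show "hnorm E (?T z) \<le> (C + D) * hnorm E z"
        using tri[OF z] CD(3)[OF z] CD(4)[OF z] by (simp add: algebra_simps)
    qed (use CD in simp)
    show "vanishes_far ?T"
      unfolding vanishes_far_def
    proof (intro allI impI)
      fix e :: real assume "e > 0"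
      then have "e / 2 > 0" by simp
      obtain m where m: "\<And>h. h \<in> Cc G F \<Longrightarrow> \<forall>\<gamma>\<in>nonzeros h. m < c \<gamma> \<Longrightarrow>
          hnorm E (T (cls (\<lambda>_. h))) \<le> e / 2 * N h"
        using add.IH(1) \<open>e / 2 > 0\<close> unfolding vanishes_far_def by blast
      obtain m' where m': "\<And>h. h \<in> Cc G F \<Longrightarrow> \<forall>\<gamma>\<in>nonzeros h. m' < c \<gamma> \<Longrightarrow>
          hnorm E (T' (cls (\<lambda>_. h))) \<le> e / 2 * N h"
        using add.IH(2) \<open>e / 2 > 0\<close> unfolding vanishes_far_def by blast
      show "\<exists>m. \<forall>h\<in>Cc G F. (\<forall>\<gamma>\<in>nonzeros h. m < c \<gamma>) \<longrightarrow> hnorm E (?T (cls (\<lambda>_. h))) \<le> e * N h"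
      proof (intro exI ballI impI)
        fix h assume h: "h \<in> Cc G F" "\<forall>\<gamma>\<in>nonzeros h. max m m' < c \<gamma>"
        have far: "\<forall>\<gamma>\<in>nonzeros h. m < c \<gamma>" "\<forall>\<gamma>\<in>nonzeros h. m' < c \<gamma>" using h(2) by auto
        note m[OF h(1) far(1)] m'[OF h(1) far(2)]
        with tri[OF cls_mem[OF N.const_cauchy[OF h(1)]]]
        show "hnorm E (?T (cls (\<lambda>_. h))) \<le> e * N h" by simp
      qed
    qed
  qed
qed

section \<open>The compressed operators and their classes in the Calkin algebra\<close>

abbreviation P where "P \<equiv> cutoff_op G F \<sigma> c chi"

definition T where
  "T a = compose (hcarrier E) P (compose (hcarrier E) (left_mult G F \<sigma> c a) P)"

lemma calkin_map_eq: "calkin_map G F \<sigma> c chi a = calkin_quot E (T a)"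
  by (simp add: calkin_map_def T_def Let_def)

lemma cut_cauchy:
  assumes "u \<in> CV"
  shows "(\<lambda>n. cut (u n)) \<in> CV" "P (cls u) = cls (\<lambda>n. cut (u n))"
proof -
  have le: "N (\<lambda>\<gamma>. cut f \<gamma> - cut g \<gamma>) \<le> N (\<lambda>\<gamma>. f \<gamma> - g \<gamma>)" if "f \<in> Cc G F" "g \<in> Cc G F" for f g
    unfolding cut_diff[symmetric] by (rule N_cut_le[OF N.diff_mem[OF that]])
  show "(\<lambda>n. cut (u n)) \<in> CV" by (rule N.extend1_seq_class(1)[OF cut_mem le assms])
  have "P (cls u) = extend1 (Cc G F) N cut (cls u)"
    using cls_mem[OF assms] by (simp add: cutoff_op_def cut_def[abs_def])
  then show "P (cls u) = cls (\<lambda>n. cut (u n))" by (simp add: N.extend1_seq_class(2)[OF cut_mem le assms])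
qed

lemma T_cls:
  assumes a: "a \<in> RV" and u: "u \<in> CV"
  shows "(\<lambda>n. cut (conv G \<sigma> (a n) (cut (u n)))) \<in> CV"
    "T (Rcls a) (cls u) = cls (\<lambda>n. cut (conv G \<sigma> (a n) (cut (u n))))"
proof -
  note cu = cut_cauchy[OF u]
  note lc = left.op_cauchy[OF a cu(1)]
  show "(\<lambda>n. cut (conv G \<sigma> (a n) (cut (u n)))) \<in> CV" by (rule cut_cauchy(1)[OF lc])
  show "T (Rcls a) (cls u) = cls (\<lambda>n. cut (conv G \<sigma> (a n) (cut (u n))))"
    using cls_mem[OF u] cls_mem[OF cu(1)]
    by (simp add: T_def compose_def cu(2) left_mult_def left.extend2_seq_class[OF a cu(1)] cut_cauchy(2)[OF lc])
qed

lemma T_extensional: "a \<in> RV \<Longrightarrow> T (Rcls a) \<in> hcarrier E \<rightarrow>\<^sub>E hcarrier E"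
proof (rule PiE_I)
  fix z assume a: "a \<in> RV" and "z \<in> hcarrier E"
  then obtain u where "u \<in> CV" "z = cls u" by (metis carrier_cases)
  with a show "T (Rcls a) z \<in> hcarrier E" by (simp add: T_cls cls_mem)
qed (simp add: T_def compose_def)

lemma T_bounded:
  assumes a: "a \<in> RV"
  shows "bounded_op (T (Rcls a))"
proof -
  obtain C where C: "C > 0" "\<And>n. R (a n) \<le> C" using R.cauchy_bounded[OF a] by blast
  have "hnorm E (T (Rcls a) z) \<le> C * hnorm E z" if "z \<in> hcarrier E" for z
  proof -
    from that obtain u where u: "u \<in> CV" "z = cls u" by (rule carrier_cases)
    have "N (cut (conv G \<sigma> (a n) (cut (u n)))) \<le> C * N (u n)" for n
    proof -
      note mem = R.cauchy_seqsD[OF a, of n] N.cauchy_seqsD[OF u(1), of n]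
      have "N (cut (conv G \<sigma> (a n) (cut (u n)))) \<le> N (conv G \<sigma> (a n) (cut (u n)))"
        by (intro N_cut_le Cc_conv cut_mem mem)
      also have "\<dots> \<le> R (a n) * N (cut (u n))" by (intro N_conv_left cut_mem mem)
      also have "\<dots> \<le> C * N (u n)" using C by (intro mult_mono N_cut_le mem) (auto simp: N_nonneg cut_mem mem)
      finally show ?thesis .
    qed
    then show ?thesis unfolding u(2) T_cls(2)[OF a u(1)] by (intro hnorm_mono[OF T_cls(1)[OF a u(1)] u(1)])
  qed
  then show ?thesis
    using T_extensional[OF a] C(1) unfolding bounded_op_def by (intro conjI exI[of _ C]) auto
qed

text \<open>The cutoff is self-adjoint by \<open>kin_cut\<close>, and the adjoint of convolution by
  a function is convolution by its involution, by \<open>kin_conv\<close>. Since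
  \<open>invol\<close> does not increase the reduced norm, the sequence of involutions is Cauchy
  again and provides the adjoint.\<close>

lemma T_adjointable:
  assumes a: "a \<in> RV"
  shows "T (Rcls a) \<in> adjointable E"
proof -
  let ?b = "\<lambda>n. invol G (a n)"
  have b: "?b \<in> RV"
  proof (rule R.cauchy_seqsI)
    fix e :: real assume "e > 0"
    then obtain n0 where n0: "\<And>m n. m \<ge> n0 \<Longrightarrow> n \<ge> n0 \<Longrightarrow> R (\<lambda>\<gamma>. a m \<gamma> - a n \<gamma>) < e"
      by (rule R.cauchy_seqsD2[OF a]) blast
    have "R (\<lambda>\<gamma>. invol G (a m) \<gamma> - invol G (a n) \<gamma>) < e" if "m \<ge> n0" "n \<ge> n0" for m n
      using R_invol_le[OF R.diff_mem[OF R.cauchy_seqsD[OF a, of m] R.cauchy_seqsD[OF a, of n]]] n0[OF that]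
      by (simp add: invol_diff)
    then show "\<exists>n0. \<forall>m\<ge>n0. \<forall>n\<ge>n0. R (\<lambda>\<gamma>. invol G (a m) \<gamma> - invol G (a n) \<gamma>) < e" by blast
  qed (simp add: Cc_invol R.cauchy_seqsD[OF a])
  have "hinner E (T (Rcls a) x) y = hinner E x (T (Rcls ?b) y)" if "x \<in> hcarrier E" "y \<in> hcarrier E" for x y
  proof -
    obtain u v where u: "u \<in> CV" "x = cls u" and v: "v \<in> CV" "y = cls v"
      using \<open>x \<in> _\<close> \<open>y \<in> _\<close> by (metis carrier_cases)
    have "kin (cut (conv G \<sigma> (a n) (cut (u n)))) (v n) = kin (u n) (cut (conv G \<sigma> (?b n) (cut (v n))))" for n
    proof -
      note mem = R.cauchy_seqsD[OF a, of n] N.cauchy_seqsD[OF u(1), of n] N.cauchy_seqsD[OF v(1), of n]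
      show ?thesis
        by (simp add: kin_cut kin_conv mem cut_mem Cc_conv Cc_invol)
    qed
    then show ?thesis
      unfolding u(2) v(2) T_cls(2)[OF a u(1)] T_cls(2)[OF b v(1)]
      by (simp add: E_inner T_cls(1)[OF a u(1)] T_cls(1)[OF b v(1)] u(1) v(1))
  qed
  then show ?thesis
    using T_extensional[OF a] T_extensional[OF b] unfolding adjointable_def by blast
qed

text \<open>This places \<open>T (Rcls a)\<close> in its own Calkin class. The difference is the
  zero operator, realised as the rank one operator of two zero vectors; being of finite rank, it
  approximates itself.\<close>

lemma op_minus_self_compact:
  assumes a: "a \<in> RV"
  shows "op_minus E (T (Rcls a)) (T (Rcls a)) \<in> compact_ops E"
proof -
  let ?z = "\<lambda>_ _. 0 :: complex" and ?Z = "cls (\<lambda>_ _. 0)"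
  let ?O = "rank_one E ?Z ?Z"
  have z: "?z \<in> CV" by (rule N.const_cauchy[OF Cc_zero])
  have O: "?O x = ?Z" if "x \<in> hcarrier E" for x
    using that by (elim carrier_cases) (simp add: E_rank_one[OF z z] conv_zero_left)
  have minus: "hminus E x x = ?Z" if "x \<in> hcarrier E" for x
    using that by (elim carrier_cases) (simp add: E_minus)
  have O_ext: "?O \<in> hcarrier E \<rightarrow>\<^sub>E hcarrier E"
    by (rule PiE_I) (simp_all add: O cls_mem[OF z], simp add: rank_one_def)
  have eq: "op_minus E (T (Rcls a)) (T (Rcls a)) = ?O"
    using minus T_extensional[OF a] O
    by (intro ext) (auto simp: op_minus_def rank_one_def restrict_def PiE_def Pi_def)
  have OO: "op_minus E ?O ?O = ?O"
    using minus O_ext O by (intro ext) (auto simp: op_minus_def rank_one_def restrict_def PiE_def Pi_def)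
  have inn: "hinner E ?Z y = hinner E x ?Z" if "x \<in> hcarrier E" "y \<in> hcarrier E" for x y
  proof -
    obtain u v where "u \<in> CV" "x = cls u" "v \<in> CV" "y = cls v"
      using \<open>x \<in> _\<close> \<open>y \<in> _\<close> by (metis carrier_cases)
    then show ?thesis by (simp add: E_inner z kin_zero)
  qed
  have "\<forall>x\<in>hcarrier E. \<forall>y\<in>hcarrier E. hinner E (?O x) y = hinner E x (?O y)"
    using inn O by metis
  with O_ext have adj: "?O \<in> adjointable E" unfolding adjointable_def by blast
  have Z0: "hnorm E ?Z = 0" using hnorm_const[OF Cc_zero] by (simp add: N.zero)
  have "{hnorm E (?O x) | x. x \<in> hcarrier E \<and> hnorm E x \<le> 1} = {0}"
  proof (intro equalityI subsetI)
    fix r assume "r \<in> {0 :: real}"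
    then show "r \<in> {hnorm E (?O x) | x. x \<in> hcarrier E \<and> hnorm E x \<le> 1}"
      using O[OF cls_mem[OF z]] Z0 cls_mem[OF z] by (intro CollectI exI[of _ ?Z]) simp
  qed (use O Z0 in auto)
  then have "op_norm E ?O = 0" by (simp add: op_norm_def)
  moreover have "?O \<in> finite_rank E" by (intro finite_rank.rank_one cls_mem z)
  ultimately have "\<exists>Q\<in>finite_rank E. op_norm E (op_minus E ?O Q) < e" if "e > 0" for e
    using that OO by (intro bexI[of _ ?O]) simp_all
  then show ?thesis
    unfolding eq compact_ops_def using adj by blast
qed

text \<open>By contradiction, with the limit \<open>l\<close> of the reduced norms of the
  differences. The order of the choices matters: \<open>f\<close> and \<open>v\<close> depend on
  \<open>l\<close>, the finite rank operator \<open>Q\<close> on \<open>v\<close>, and only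
  afterwards come the arrow \<open>\<eta>\<close> and the lift \<open>h\<close>.\<close>

lemma compact_imp_null:
  assumes unb: "r_unbounded G c" and a: "a \<in> RV" and b: "b \<in> RV"
    and comp: "op_minus E (T (Rcls a)) (T (Rcls b)) \<in> compact_ops E"
  shows "Rcls a = Rcls b"
proof -
  define d where "d n \<gamma> = a n \<gamma> - b n \<gamma>" for n \<gamma>
  have d: "d \<in> RV" using Rminus.op_cauchy[OF a b] by (simp add: d_def[abs_def])
  have dm: "d n \<in> Cc G F" for n by (rule R.cauchy_seqsD[OF d])
  obtain l where l: "(\<lambda>n. R (d n)) \<longlonglongrightarrow> l"
    using R.cauchy_norm[OF d] by (auto simp: Cauchy_convergent_iff convergent_def)
  have "l \<ge> 0" by (rule LIMSEQ_le_const[OF l]) (auto simp: R.nonneg dm)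
  have "l = 0"
  proof (rule ccontr)
    assume "l \<noteq> 0"
    with \<open>l \<ge> 0\<close> have l_pos: "l > 0" by simp
    \<comment> \<open>The tolerance for replacing \<open>d i\<close> by the fixed \<open>f\<close>:
      of the half of \<open>l\<close> that is detected below, 3/8 remain.\<close>
    then have "l / 8 > 0" by simp
    then obtain n0 where n0: "\<And>m n. m \<ge> n0 \<Longrightarrow> n \<ge> n0 \<Longrightarrow> R (\<lambda>\<gamma>. d m \<gamma> - d n \<gamma>) < l / 8"
      by (rule R.cauchy_seqsD2[OF d]) blast
    have "\<forall>\<^sub>F n in sequentially. l / 2 < R (d n)"
      by (rule order_tendstoD(1)[OF l]) (use l_pos in simp)
    then obtain n1 where n1: "\<And>n. n \<ge> n1 \<Longrightarrow> l / 2 < R (d n)" by (auto simp: eventually_sequentially)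
    define n where "n = max n0 n1"
    define f where "f = d n"
    have f: "f \<in> Cc G F" using dm by (simp add: f_def)
    \<comment> \<open>Since the reduced norm of \<open>f\<close> exceeds \<open>l / 2\<close>, the
      bound fails, and its failure is witnessed by a finitely supported vector on a single
      fibre.\<close>
    have "\<not> bnd (arrows G) f (l / 2)"
      using n1[of n] reduced_norm_le_iff(1)[OF f, of "l / 2"] l_pos by (simp add: n_def f_def)
    then obtain x v0 where v0: "v0 \<in> fs (arrows G) x" "l / 2 * l2norm v0 < l2norm (conv G \<sigma> f v0)"
      by (auto simp: bnd_def not_le)
    \<comment> \<open>The factor makes the l1 norm at most 1. The added 1 in the denominator
      excludes division by zero, and a real factor keeps the values in \<open>F\<close>.\<close>
    define s where "s = 1 / (1 + (\<Sum>\<gamma>\<in>nonzeros v0. cmod (v0 \<gamma>)))"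
    have s_pos: "s > 0" unfolding s_def by (simp add: add_pos_nonneg sum_nonneg)
    define v where "v \<gamma> = of_real s * v0 \<gamma>" for \<gamma>
    have nz: "nonzeros v = nonzeros v0" using s_pos by (auto simp: v_def nonzeros_def)
    have "of_real s * v0 \<gamma> \<in> F" for \<gamma>
      using fsD(4)[OF v0(1)] by (intro scalar_closed(5,7)) auto
    then have v: "v \<in> fs (arrows G) x" using v0(1) nz by (auto simp: fs_def v_def)
    note v' = fsD[OF v]
    have l2v: "l2norm v = s * l2norm v0" "l2norm (conv G \<sigma> f v) = s * l2norm (conv G \<sigma> f v0)"
      using s_pos by (simp_all add: v_def[abs_def] conv_scale_right l2norm_scale)
    have fv: "l / 2 * l2norm v < l2norm (conv G \<sigma> f v)"
      using v0(2) s_pos mult_strict_left_mono[OF v0(2) s_pos] by (simp add: l2v mult.left_commute)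
    have v_sum: "(\<Sum>\<gamma>\<in>nonzeros v. cmod (v \<gamma>)) \<le> 1"
    proof -
      have "(\<Sum>\<gamma>\<in>nonzeros v. cmod (v \<gamma>)) = s * (\<Sum>\<gamma>\<in>nonzeros v0. cmod (v0 \<gamma>))"
        using s_pos by (simp add: nz v_def norm_mult sum_distrib_left)
      also have "\<dots> \<le> 1"
        using sum_nonneg[of "nonzeros v0" "\<lambda>\<gamma>. cmod (v0 \<gamma>)"] by (simp add: s_def divide_simps)
      finally show ?thesis .
    qed
    have "l2norm v \<noteq> 0"
    proof
      assume "l2norm v = 0"
      then have "v = (\<lambda>_. 0)" using l2norm_eq_0D[OF v'(1)] by blast
      with fv show False by (simp add: conv_zero_right)
    qed
    then have L: "l2norm v > 0" using l2norm_nonneg[of v] by linarith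
    have "nonzeros v \<noteq> {}" using L by (auto simp: l2norm_def)
    then have x: "x \<in> units G" using v'(3) fibre_units by blast
    \<comment> \<open>The approximation error and the action of \<open>Q\<close> each cost at most
      \<open>e\<close>. Together they make an eighth of \<open>l * l2norm v\<close>, which is below
      the 3/8 of the lower bound.\<close>
    define e where "e = l * l2norm v / 16"
    have e: "e > 0" using L l_pos by (simp add: e_def)
    obtain Q where Q: "Q \<in> finite_rank E" "op_norm E (op_minus E (op_minus E (T (Rcls a)) (T (Rcls b))) Q) < e"
      using comp e unfolding compact_ops_def by blast
    have Qf: "bounded_op Q" "vanishes_far Q" using finite_rank_far[OF Q(1)] by auto
    obtain m0 where m0: "\<And>h. h \<in> Cc G F \<Longrightarrow> \<forall>\<gamma>\<in>nonzeros h. m0 < c \<gamma> \<Longrightarrow> hnorm E (Q (cls (\<lambda>_. h))) \<le> e * N h"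
      using Qf(2) e unfolding vanishes_far_def by blast
    obtain B where B: "B \<ge> 0" "\<And>\<gamma>. \<gamma> \<in> nonzeros f \<Longrightarrow> \<bar>c \<gamma>\<bar> \<le> B" using cocycle_bounded[OF f] by blast
    \<comment> \<open>Beyond \<open>m0\<close> the operator \<open>Q\<close> is small;
      \<open>B\<close> makes up for the most negative value of \<open>c\<close> on the support of
      \<open>f\<close>, which convolution by \<open>f\<close> adds.\<close>
    define m where "m = max m0 B"
    \<comment> \<open>Translation adds \<open>c \<eta>\<close> to values of \<open>c\<close> that
      may be as low as \<open>- D\<close> on the support of \<open>v\<close>.\<close>
    define D where "D = (\<Sum>\<gamma>\<in>nonzeros v. \<bar>c \<gamma>\<bar>)"
    have D: "\<bar>c \<gamma>\<bar> \<le> D" if "\<gamma> \<in> nonzeros v" for \<gamma>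
      unfolding D_def by (rule member_le_sum[OF that _ v'(1)]) simp
    have "D \<ge> 0" by (simp add: D_def sum_nonneg)
    then have "m + D + 1 > 0" using B(1) by (simp add: m_def le_max_iff_disj add_nonneg_pos)
    then obtain \<eta> where \<eta>: "\<eta> \<in> arrows G" "rng G \<eta> = x" "c \<eta> > m + D + 1"
      using unb x unfolding r_unbounded_def by blast
    define y where "y = src G \<eta>"
    have y: "y \<in> units G" using \<eta>(1) by (simp add: y_def src_mem_units)
    have vx: "v \<in> fs (arrows G) (rng G \<eta>)" using v \<eta>(2) by simp
    define w where "w = conv G \<sigma> v (delta \<eta>)"
    note tr = l2norm_conv_delta[OF vx \<eta>(1), folded w_def y_def]
    have fd: "fibre_finite (delta \<eta>)" using \<eta>(1) by (intro fibre_finite_finite) auto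
    have w_far: "m < c \<gamma>" if "\<gamma> \<in> nonzeros w" for \<gamma>
    proof -
      have "\<gamma> \<in> (\<lambda>\<gamma>. mul G \<gamma> \<eta>) ` nonzeros v" using that tr(2) by simp
      then obtain \<xi> where \<xi>: "\<xi> \<in> nonzeros v" "\<gamma> = mul G \<xi> \<eta>" by blast
      then have "(\<xi>, \<eta>) \<in> composable G" using v'(3) \<eta>(1,2) by (auto simp: composable_iff fibre_def)
      then have "c \<gamma> = c \<xi> + c \<eta>" using c_mul \<xi>(2) by simp
      with D[OF \<xi>(1)] \<eta>(3) show ?thesis by (simp add: abs_le_iff)
    qed
    have fw: "l2norm (conv G \<sigma> f w) = l2norm (conv G \<sigma> f v)"
    proof -
      have "conv G \<sigma> f v \<in> fs (arrows G) (rng G \<eta>)"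
        by (rule conv_fs[OF fibre_finite_Cc[OF f] Cc_range[OF f] vx])
      from l2norm_conv_delta(1)[OF this \<eta>(1)] show ?thesis
        by (simp add: w_def conv_assoc[OF v'(5) fd])
    qed
    \<comment> \<open>The lift has to stay in the far region on all fibres, not only on the one over
      \<open>y\<close>; it is therefore taken inside this open set.\<close>
    define W where "W = {\<gamma> \<in> topspace X. c \<gamma> \<in> {m<..}}"
    have W: "openin X W" unfolding W_def by (rule openin_continuous_map_preimage[OF c_cont]) auto
    have "nonzeros w \<subseteq> W" using w_far fsD(2)[OF tr(3)] by (auto simp: W_def topspace_X)
    from lift_fs[OF tr(3) W this] obtain h where h: "h \<in> Cc G F" "nonzeros h \<subseteq> W"
        "\<And>\<gamma>. \<gamma> \<in> fibre y \<Longrightarrow> h \<gamma> = w \<gamma>" "bnd S h (\<Sum>\<gamma>\<in>nonzeros w. cmod (w \<gamma>))"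
      by metis
    have h_far: "m < c \<gamma>" if "\<gamma> \<in> nonzeros h" for \<gamma> using h(2) that by (auto simp: W_def)
    \<comment> \<open>The bound is the l1 norm of \<open>w\<close>, which equals that of
      \<open>v\<close> and hence does not depend on \<open>\<eta>\<close>.\<close>
    have Nh: "N h \<le> 1"
    proof -
      have "N h \<le> (\<Sum>\<gamma>\<in>nonzeros w. cmod (w \<gamma>))"
        using N_le_iff[OF h(1)] h(4) by (simp add: sum_nonneg)
      with tr(4) v_sum show ?thesis by simp
    qed
    have hy: "conv G \<sigma> h (delta y) = w"
      using h(3) fsD(3)[OF tr(3)] by (auto simp: conv_delta_unit[OF y] nonzeros_def fun_eq_iff)
    have "m \<ge> 0" using B(1) by (simp add: m_def)
    have cut_h: "cut h = h" using h_far \<open>m \<ge> 0\<close> by (intro cut_id) (meson less_imp_le order.strict_trans1)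
    \<comment> \<open>On the support of the convolution, \<open>c\<close> exceeds
      \<open>m - B\<close>, which is nonnegative by the choice of \<open>m\<close>.\<close>
    have cut_fh: "cut (conv G \<sigma> f h) = conv G \<sigma> f h"
    proof (rule cut_id)
      fix \<gamma> assume "\<gamma> \<in> nonzeros (conv G \<sigma> f h)"
      then obtain \<xi> \<zeta> where *: "\<xi> \<in> nonzeros f" "\<zeta> \<in> nonzeros h" "(\<xi>, \<zeta>) \<in> composable G" "mul G \<xi> \<zeta> = \<gamma>"
        by (rule nonzeros_conv)
      show "0 \<le> c \<gamma>"
        using c_mul[OF *(3)] *(4) B(2)[OF *(1)] h_far[OF *(2)] by (simp add: m_def abs_le_iff)
    qed
    let ?z = "cls (\<lambda>_. h)"
    have hc: "(\<lambda>_. h) \<in> CV" by (rule N.const_cauchy[OF h(1)])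
    note z = cls_mem[OF hc]
    have z1: "hnorm E ?z \<le> 1" using Nh by (simp add: hnorm_const[OF h(1)])
    let ?D = "op_minus E (T (Rcls a)) (T (Rcls b))"
    have Db: "bounded_op ?D" by (intro bounded_op_minus T_bounded a b)
    have "hnorm E (op_minus E ?D Q ?z) < e"
      using le_op_norm[OF bounded_op_minus[OF Db Qf(1)] z z1] Q(2) by simp
    moreover have "hnorm E (Q ?z) \<le> e"
    proof -
      have "hnorm E (Q ?z) \<le> e * N h" using h_far by (intro m0[OF h(1)]) (auto simp: m_def)
      also have "\<dots> \<le> e" using Nh e by (simp add: mult_left_le)
      finally show ?thesis .
    qed
    moreover have "hnorm E (?D ?z) \<le> hnorm E (op_minus E ?D Q ?z) + hnorm E (Q ?z)"
      using E_closed(5)[of "?D ?z" "Q ?z"] Db Qf(1) z unfolding bounded_op_def by (simp add: op_minus_def)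
    ultimately have upper: "hnorm E (?D ?z) \<le> 2 * e" by simp
    let ?k = "\<lambda>n \<gamma>. cut (conv G \<sigma> (a n) (cut h)) \<gamma> - cut (conv G \<sigma> (b n) (cut h)) \<gamma>"
    have Dz: "?D ?z = cls ?k"
      using z by (simp add: op_minus_def T_cls[OF a hc] T_cls[OF b hc] E_minus)
    have kc: "?k \<in> CV" by (rule minus.op_cauchy[OF T_cls(1)[OF a hc] T_cls(1)[OF b hc]])
    have k_eq: "?k i = cut (conv G \<sigma> (d i) h)" for i
      by (simp add: cut_h cut_diff[symmetric] conv_diff_left[OF fibre_finite_Cc[OF h(1)], symmetric] d_def[abs_def])
    \<comment> \<open>On the fibre over \<open>y\<close>, the action of \<open>f\<close> on
      \<open>h\<close> is compared with that of \<open>d i\<close>. The error \<open>?q\<close>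
      comes from \<open>d i - f\<close> and is at most an eighth of \<open>l * l2norm v\<close>, as
      cutting off can only shrink it. The outer cutoff stays in place for \<open>d i\<close>,
      because no common bound for \<open>c\<close> on the supports of the \<open>d i\<close> is
      available.\<close>
    have lower: "3 / 8 * l * l2norm v \<le> N (?k i)" if "i \<ge> n" for i
    proof -
      let ?g = "\<lambda>\<gamma>. d i \<gamma> - f \<gamma>"
      have g: "?g \<in> Cc G F" by (rule Cc_diff[OF dm f])
      have gh: "conv G \<sigma> ?g h \<in> Cc G F" by (rule Cc_conv[OF g h(1)])
      have kC: "cut (conv G \<sigma> (d i) h) \<in> Cc G F" by (intro cut_mem Cc_conv dm h(1))
      have fh: "conv G \<sigma> f h \<in> Cc G F" by (rule Cc_conv[OF f h(1)])
      note dy = delta_unit_fs[OF y]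
      note dyf = fsD(5)[OF dy]
      let ?p = "conv G \<sigma> (cut (conv G \<sigma> (d i) h)) (delta y)"
      let ?q = "conv G \<sigma> (cut (conv G \<sigma> ?g h)) (delta y)"
      have "conv G \<sigma> ?g h = (\<lambda>\<gamma>. conv G \<sigma> (d i) h \<gamma> - conv G \<sigma> f h \<gamma>)"
        by (rule conv_diff_left[OF fibre_finite_Cc[OF h(1)]])
      then have "cut (conv G \<sigma> ?g h) = (\<lambda>\<gamma>. cut (conv G \<sigma> (d i) h) \<gamma> - conv G \<sigma> f h \<gamma>)"
        by (simp only: cut_diff cut_fh)
      then have "?q = (\<lambda>\<gamma>. ?p \<gamma> - conv G \<sigma> (conv G \<sigma> f h) (delta y) \<gamma>)"
        by (simp only: conv_diff_left[OF dyf])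
      then have "conv G \<sigma> (conv G \<sigma> f h) (delta y) = (\<lambda>\<gamma>. ?p \<gamma> - ?q \<gamma>)" by simp
      moreover have "conv G \<sigma> (conv G \<sigma> f h) (delta y) = conv G \<sigma> f w"
        by (simp add: conv_assoc[OF fibre_finite_Cc[OF h(1)] dyf] hy)
      ultimately have "l2norm (conv G \<sigma> f w) = l2norm (\<lambda>\<gamma>. ?p \<gamma> - ?q \<gamma>)" by simp
      also have "\<dots> \<le> l2norm ?p + l2norm ?q"
        by (intro l2norm_diff finite_nonzeros_conv[OF _ dy] fibre_finite_Cc kC cut_mem gh)
      also have "l2norm ?p \<le> N (?k i)" unfolding k_eq by (rule l2norm_unit_le_N[OF kC y])
      also have "l2norm ?q \<le> l2norm (conv G \<sigma> (conv G \<sigma> ?g h) (delta y))"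
        by (rule l2norm_mono[OF finite_nonzeros_conv[OF fibre_finite_Cc[OF gh] dy]])
          (auto simp: conv_delta_unit[OF y] norm_cut_le)
      also have "conv G \<sigma> (conv G \<sigma> ?g h) (delta y) = conv G \<sigma> ?g w"
        by (simp add: conv_assoc[OF fibre_finite_Cc[OF h(1)] dyf] hy)
      also have "l2norm (conv G \<sigma> ?g w) \<le> R ?g * l2norm w" by (rule bndD[OF R_bnd[OF g] tr(3)])
      also have "\<dots> \<le> l / 8 * l2norm v"
        using n0[of i n] that unfolding tr(1) f_def n_def by (intro mult_right_mono) auto
      finally have "l2norm (conv G \<sigma> f w) \<le> N (?k i) + l / 8 * l2norm v" by simp
      with fv fw show ?thesis by simp
    qed
    have "3 / 8 * l * l2norm v \<le> hnorm E (cls ?k)"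
      by (rule LIMSEQ_le_const[OF hnorm_tendsto[OF kc]]) (use lower in blast)
    with upper have "3 / 8 * l * l2norm v \<le> 2 * e" unfolding Dz by simp
    moreover have "l * l2norm v > 0" using l_pos L by simp
    ultimately show False by (simp add: e_def)
  qed
  with l show ?thesis unfolding R.seq_class_eq_iff[OF a b] by (simp add: d_def[abs_def])
qed

text \<open>\<open>T B\<close> lies in its own class, hence in that of \<open>T A\<close> if the two
  classes agree; this membership says that the difference of the operators is compact.\<close>

lemma calkin_map_inj:
  assumes "r_unbounded G c"
  shows "calkin_map G F \<sigma> c chi \<in> reduced_algebra G F \<sigma> \<rightarrow> calkin E \<and>
    inj_on (calkin_map G F \<sigma> c chi) (reduced_algebra G F \<sigma>)"
proof
  have cases: "\<exists>a\<in>RV. A = Rcls a" if "A \<in> reduced_algebra G F \<sigma>" for A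
    using that unfolding reduced_algebra_def by (metis R.completion_cases)
  show "calkin_map G F \<sigma> c chi \<in> reduced_algebra G F \<sigma> \<rightarrow> calkin E"
  proof
    fix A assume "A \<in> reduced_algebra G F \<sigma>"
    then obtain a where "a \<in> RV" "A = Rcls a" using cases by blast
    then show "calkin_map G F \<sigma> c chi A \<in> calkin E"
      using T_adjointable by (simp add: calkin_map_eq calkin_quot_def calkin_def quotientI)
  qed
  show "inj_on (calkin_map G F \<sigma> c chi) (reduced_algebra G F \<sigma>)"
  proof (rule inj_onI)
    fix A B assume AB: "A \<in> reduced_algebra G F \<sigma>" "B \<in> reduced_algebra G F \<sigma>"
      and eq: "calkin_map G F \<sigma> c chi A = calkin_map G F \<sigma> c chi B"
    obtain a b where a: "a \<in> RV" "A = Rcls a" and b: "b \<in> RV" "B = Rcls b"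
      using cases[OF AB(1)] cases[OF AB(2)] by blast
    have "(T B, T B) \<in> compact_rel E"
      using T_adjointable[OF b(1)] op_minus_self_compact[OF b(1)] by (simp add: b(2) compact_rel_def)
    then have "T B \<in> calkin_quot E (T A)"
      using eq by (simp add: calkin_map_eq calkin_quot_def)
    then have "op_minus E (T A) (T B) \<in> compact_ops E" by (simp add: calkin_quot_def compact_rel_def)
    then show "A = B" unfolding a(2) b(2) by (rule compact_imp_null[OF assms a(1) b(1)])
  qed
qed

end

theorem proposition1p18:
  fixes G :: "'g groupoid" and F :: "complex set" and \<sigma> :: "'g \<Rightarrow> 'g \<Rightarrow> complex"
    and c :: "'g \<Rightarrow> real" and \<epsilon> :: real and chi :: "real \<Rightarrow> real"
  assumes "lch_etale_groupoid G"
    and "scalar_field F"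
    and "exact_cocycle G c"
    and "normalised_two_cocycle G F \<sigma>"
    and "\<epsilon> > 0"
    and "continuous_on UNIV chi"
    and "mono chi"
    and "\<And>x. x \<le> - \<epsilon> \<Longrightarrow> chi x = 0"
    and "\<And>x. x \<ge> 0 \<Longrightarrow> chi x = 1"
    and "r_unbounded G c"
  shows "calkin_map G F \<sigma> c chi \<in> reduced_algebra G F \<sigma> \<rightarrow> calkin (kernel_module G F \<sigma> c) \<and>
    inj_on (calkin_map G F \<sigma> c chi) (reduced_algebra G F \<sigma>)"

proof -
  from assms(3) obtain \<mu> where c: "continuous_cocycle G c" and \<mu>: "haar_system (kernel G c) \<mu>"
    by (auto simp: exact_cocycle_def)
  have "topological_groupoid G" using assms(1) by (simp add: lch_etale_groupoid_def)
  with assms c \<mu> interpret cutoff G F \<sigma> c \<mu> chi \<epsilon>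
    by (intro cutoff.intro kernel_cocycle.intro lch_twisted_groupoid.intro twisted_groupoid.intro
        twisted_groupoid_axioms.intro kernel_cocycle_axioms.intro cutoff_axioms.intro) auto
  show ?thesis by (rule calkin_map_inj[OF assms(10)])
qed

end
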